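(* Let $C$ be a smooth irreducible curve of degree $d$. Let $(n_1,\dots,n_k)\in\mathbb{N}^k$ be a $k$-tuple, and let $\tilde C=T_{(n_1,\dots,n_k)}(C)$. For every $1\le i\le k$, $\tilde C$ has a $d$-tacnode of order $n_i-1$, and another singular point which is a blow down of a $d$-tacnode of order $n_1+\cdots+n_k-1$ (i.e., the curve has the following singularities: $[d_{n_1}],\dots,[d_{n_k}]$ and $[d(n_1+\cdots+n_k),\,d_{n_1+\cdots+n_k}]$). The degree of the resulting curve is $d(n_1+\cdots+n_k+1)$.
   Context: Curves are complex plane projective curves and $\mathbb{N}=\{1,2,3,\dots\}$. Singularity types: if a singular point $P$ is resolved by a sequence of $s$ blow-ups, with only one singular point appearing at each blow-up, and $t_i>1$ ($1\le i\le s$) is the multiplicity of the curve at $P$ before the $i$-th blow-up, then $[t_1,\dots,t_s]$ is called the type of the singularity. A sequence of $r$ equal multiplicities $l$ is abbreviated $l_r$ (e.g. $[2,2,2]=[2_3]$). A $d$-tacnode is a singular point where $d$ smooth branches of the curve have a common tangent at the same point; a $d$-tacnode of order $k$ is a $d$-tacnode such that the higher derivatives of the branches are also equal up to order $k$ (the usual tacnode is a $2$-tacnode of order $1$). A blow down of a $d$-tacnode is the singular point obtained from a $d$-tacnode located on an exceptional curve when that curve is blown down. The Hirzebruch surface $F_n$ is the $\mathbb{P}^1$-bundle over $\mathbb{P}^1$ whose exceptional section has self-intersection $-n$. Elementary transformations: the first type ($F_n$ to $F_{n+1}$) blows up a point on the exceptional section and then blows down the proper transform of the fiber through that point. The second type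 ($F_n$ to $F_{n-1}$) blows up a point on a fiber $Q$, outside the exceptional section, and then blows down the proper transform of $Q$. In both cases the transformation is said to be performed on that fiber; the new fiber (the exceptional curve of the blow-up) replaces the old one and is called its proper transform. Construction of $T_{(n_1,\dots,n_k)}$: take $k$ different lines $Q_1,\dots,Q_k$, all meeting $C$ transversally and intersecting in a point $O$ outside $C$, in such a way that, for a disk $D$ centered at $O$, the intersection points of the lines with the boundary of $D$ are organized counterclockwise. An additional line $P$ also passes through $O$ and intersects $C$ transversally. Blow up $O$ to get $F_1$. Apply $n_i$ elementary transformations of the first type on the proper transform of $Q_i$ for all $i$, reaching $F_{(\sum n_i)+1}$. Then apply $\sum n_i$ elementary transformations of the second type on the proper transform of $P$, returning to $F_1$. Finally blow down the exceptional section to get $\mathbb{P}^2$. This defines the Cremona transformation $T_{(n_1,\dots,n_k)}$; the image of $C$ is its proper transform.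
   Formalization: Added: the first point blown up on the proper transform of P (second type) does not lie on the transformed curve; otherwise the degree drops below d(n_1+...+n_k+1) and the claim fails. For d = 1, entries 1 in the singularity types are dropped. *)

theory Defs
  imports "HOL-Complex_Analysis.Complex_Analysis"
begin

section \<open>Polynomials in two and three variables\<close>

text \<open>
  Elements of \<^typ>\<open>complex poly poly\<close> are polynomials in x, y and elements of
  \<^typ>\<open>complex poly poly poly\<close> are polynomials in x, y, z. The innermost variable is x and
  the outermost one is y, respectively z: the coefficient of x^i y^j z^k is
  \<open>coeff (coeff (coeff F k) j) i\<close>.
  The evaluation maps below take an embedding of the complex numbers into the target ring, so that
  they serve both for evaluation at points and for substitution of polynomials.
\<close>

definition eval2 :: "(complex \<Rightarrow> 'r::comm_ring_1) \<Rightarrow> complex poly poly \<Rightarrow> 'r \<Rightarrow> 'r \<Rightarrow> 'r" where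
  "eval2 emb f x y = poly (map_poly (\<lambda>p. poly (map_poly emb p) x) f) y"

definition eval3 :: "(complex \<Rightarrow> 'r::comm_ring_1) \<Rightarrow> complex poly poly poly \<Rightarrow> 'r \<Rightarrow> 'r \<Rightarrow> 'r \<Rightarrow> 'r" where
  "eval3 emb F x y z = poly (map_poly (\<lambda>q. eval2 emb q x y) F) z"

definition const2 :: "complex \<Rightarrow> complex poly poly" where
  "const2 c = [:[:c:]:]"

definition X2 :: "complex poly poly" where
  "X2 = [:[:0, 1:]:]"

definition Y2 :: "complex poly poly" where
  "Y2 = [:0, 1:]"

definition ev3 :: "complex poly poly poly \<Rightarrow> complex^3 \<Rightarrow> complex" where
  "ev3 F v = eval3 (\<lambda>c. c) F (v$1) (v$2) (v$3)"

definition grad :: "complex poly poly poly \<Rightarrow> complex^3 \<Rightarrow> complex^3" where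
  "grad F v = vector [ev3 (map_poly (map_poly pderiv) F) v, ev3 (map_poly pderiv F) v, ev3 (pderiv F) v]"

definition form :: "nat \<Rightarrow> complex poly poly poly \<Rightarrow> bool" where
  "form d F \<longleftrightarrow> (\<forall>i j k. coeff (coeff (coeff F k) j) i \<noteq> 0 \<longrightarrow> i + j + k = d)"

section \<open>The projective plane and its curves\<close>

text \<open>A point of the projective plane is the set of its homogeneous coordinate vectors.\<close>

definition ppt :: "complex^3 \<Rightarrow> (complex^3) set" where
  "ppt v = {c *s v | c. c \<noteq> 0}"

definition proj_plane :: "(complex^3) set set" where
  "proj_plane = {ppt v | v. v \<noteq> 0}"

definition curve :: "complex poly poly poly \<Rightarrow> (complex^3) set set" where
  "curve F = {ppt v | v. v \<noteq> 0 \<and> ev3 F v = 0}"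

definition proj_line :: "complex^3 \<Rightarrow> (complex^3) set set" where
  "proj_line a = {ppt v | v. v \<noteq> 0 \<and> (\<Sum>i\<in>UNIV. a$i * v$i) = 0}"

definition is_line :: "(complex^3) set set \<Rightarrow> bool" where
  "is_line L \<longleftrightarrow> (\<exists>a. a \<noteq> 0 \<and> L = proj_line a)"

definition singular_pt :: "complex poly poly poly \<Rightarrow> (complex^3) set \<Rightarrow> bool" where
  "singular_pt F p \<longleftrightarrow> (\<exists>v. v \<noteq> 0 \<and> p = ppt v \<and> ev3 F v = 0 \<and> grad F v = 0)"

definition smooth_curve :: "complex poly poly poly \<Rightarrow> bool" where
  "smooth_curve F \<longleftrightarrow> (\<forall>p. \<not> singular_pt F p)"

text \<open>
  At every common point, the differential of F does not vanish identically on the plane in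
  complex 3-space that underlies L; that is, the curve is smooth there and L is not its tangent.
\<close>

definition transversal :: "complex poly poly poly \<Rightarrow> (complex^3) set set \<Rightarrow> bool" where
  "transversal F L \<longleftrightarrow>
     (\<forall>v. v \<noteq> 0 \<and> ppt v \<in> L \<inter> curve F \<longrightarrow>
        (\<exists>w. w \<noteq> 0 \<and> ppt w \<in> L \<and> (\<Sum>i\<in>UNIV. grad F v $ i * w$i) \<noteq> 0))"

definition zariski_closure :: "(complex^3) set set \<Rightarrow> (complex^3) set set" where
  "zariski_closure S = {p \<in> proj_plane. \<forall>e H. form e H \<and> S \<subseteq> curve H \<longrightarrow> p \<in> curve H}"

section \<open>Singularities of plane curves\<close>

text \<open>
  The following notions concern the germ at the origin of the affine curve f = 0.
\<close>

definition mult0 :: "complex poly poly \<Rightarrow> nat" where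
  "mult0 f = (LEAST m. \<exists>i j. i + j = m \<and> coeff (coeff f j) i \<noteq> 0)"

text \<open>
  The exceptional curve of the blow-up of the origin consists of the tangent directions:
  \<open>Some t\<close> is the direction y = t x, and \<open>None\<close> is the direction x = 0. The polynomial
  \<open>strict f e\<close> is a local equation of the proper transform in an affine chart of the blow-up
  whose origin is the point e of the exceptional curve. The chart is given by
  (x, y) -> (x, x (y + t)), with exceptional curve x = 0, respectively by (x, y) -> (x y, y),
  with exceptional curve y = 0. The divisions are exact.
\<close>

fun strict :: "complex poly poly \<Rightarrow> complex option \<Rightarrow> complex poly poly" where
  "strict f (Some t) = eval2 const2 f X2 (X2 * (Y2 + const2 t)) div X2 ^ mult0 f"
| "strict f None = eval2 const2 f (X2 * Y2) Y2 div Y2 ^ mult0 f"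

text \<open>
  \<open>germ_type f [t1, ..., ts]\<close>: the singularity has type [t1, ..., ts]. A smooth point of the
  curve has the empty type.
\<close>

inductive germ_type :: "complex poly poly \<Rightarrow> nat list \<Rightarrow> bool" where
  smooth: "mult0 f = 1 \<Longrightarrow> germ_type f []"
| blowup: "t > 1 \<Longrightarrow> mult0 f = t \<Longrightarrow> germ_type (strict f e) ts \<Longrightarrow>
     (\<forall>e'. e' \<noteq> e \<longrightarrow> mult0 (strict f e') \<le> 1) \<Longrightarrow> germ_type f (t # ts)"

text \<open>
  d-tacnode of order k: after a linear change of coordinates the curve is, near the origin, the
  union of d graphs y = \<phi> j x through the origin, whose derivatives agree exactly up to order k. For
  k = 0 this is an ordinary d-fold point (d smooth branches with distinct tangents).
\<close>

definition germ_tacnode :: "nat \<Rightarrow> nat \<Rightarrow> complex poly poly \<Rightarrow> bool" where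
  "germ_tacnode d k f \<longleftrightarrow>
     (\<exists>a b c e :: complex. \<exists>(\<phi> :: nat \<Rightarrow> complex \<Rightarrow> complex) r s.
        a * e - b * c \<noteq> 0 \<and> r > 0 \<and> s > 0 \<and>
        (\<forall>j<d. \<phi> j holomorphic_on ball 0 r \<and> \<phi> j 0 = 0) \<and>
        (\<forall>x\<in>ball 0 r. \<forall>y\<in>ball 0 s.
           eval2 (\<lambda>z. z) f (a * x + b * y) (c * x + e * y) = 0 \<longleftrightarrow> (\<exists>j<d. y = \<phi> j x)) \<and>
        (\<forall>i<d. \<forall>j<d. \<forall>m\<le>k. (deriv ^^ m) (\<phi> i) 0 = (deriv ^^ m) (\<phi> j) 0) \<and>
        (\<forall>i<d. \<forall>j<d. i \<noteq> j \<longrightarrow> (deriv ^^ Suc k) (\<phi> i) 0 \<noteq> (deriv ^^ Suc k) (\<phi> j) 0))"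

text \<open>
  The proper transform under the blow-up of the origin meets the exceptional curve in exactly one
  point, which is a d-tacnode of order k.
\<close>

definition germ_blow_down_tacnode :: "nat \<Rightarrow> nat \<Rightarrow> complex poly poly \<Rightarrow> bool" where
  "germ_blow_down_tacnode d k f \<longleftrightarrow>
     (\<exists>e. germ_tacnode d k (strict f e) \<and> (\<forall>e'. e' \<noteq> e \<longrightarrow> mult0 (strict f e') = 0))"

text \<open>
  An invertible matrix M that maps [0:0:1] to p gives affine coordinates
  (x, y) -> [M (x, y, 1)] with origin p.
\<close>

definition centered :: "complex^3^3 \<Rightarrow> (complex^3) set \<Rightarrow> bool" where
  "centered M p \<longleftrightarrow> invertible M \<and> ppt (M *v axis 3 1) = p"

definition local_eq :: "complex poly poly poly \<Rightarrow> complex^3^3 \<Rightarrow> complex poly poly" where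
  "local_eq F M =
     (let l = (\<lambda>i. const2 (M$i$1) * X2 + const2 (M$i$2) * Y2 + const2 (M$i$3))
      in eval3 const2 F (l 1) (l 2) (l 3))"

definition has_type :: "complex poly poly poly \<Rightarrow> (complex^3) set \<Rightarrow> nat list \<Rightarrow> bool" where
  "has_type F p ts \<longleftrightarrow> (\<exists>M. centered M p \<and> germ_type (local_eq F M) ts)"

definition tacnode_at :: "nat \<Rightarrow> nat \<Rightarrow> complex poly poly poly \<Rightarrow> (complex^3) set \<Rightarrow> bool" where
  "tacnode_at d k F p \<longleftrightarrow> (\<exists>M. centered M p \<and> germ_tacnode d k (local_eq F M))"

definition blow_down_tacnode_at :: "nat \<Rightarrow> nat \<Rightarrow> complex poly poly poly \<Rightarrow> (complex^3) set \<Rightarrow> bool" where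
  "blow_down_tacnode_at d k F p \<longleftrightarrow>
     (\<exists>M. centered M p \<and> germ_blow_down_tacnode d k (local_eq F M))"

section \<open>Hirzebruch surfaces\<close>

text \<open>
  Homogeneous coordinates (s, u, v) on the Hirzebruch surface with exceptional section of
  self-intersection -n: s gives the point of the base line, and [u : v] the point of the fiber,
  where v/u is a fiber coordinate with values in O(n). The exceptional section is u = 0 (its normal
  coordinate u/v has degree -n).
\<close>

type_synonym hcoord = "(complex^2) \<times> complex \<times> complex"

definition hpt :: "nat \<Rightarrow> hcoord \<Rightarrow> hcoord set" where
  "hpt n h = (case h of (s, u, v) \<Rightarrow>
     {(l *s s, m * u, l ^ n * m * v) | l m. l \<noteq> 0 \<and> m \<noteq> 0})"

definition hirzebruch :: "nat \<Rightarrow> hcoord set set" where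
  "hirzebruch n = {hpt n (s, u, v) | s u v. s \<noteq> 0 \<and> (u, v) \<noteq> (0, 0)}"

definition fiber :: "nat \<Rightarrow> complex^2 \<Rightarrow> hcoord set set" where
  "fiber n b = {hpt n (b, u, v) | u v. (u, v) \<noteq> (0, 0)}"

definition fiber_form :: "complex^2 \<Rightarrow> complex^2 \<Rightarrow> complex" where
  "fiber_form b s = b$2 * s$1 - b$1 * s$2"

definition binary_form :: "nat \<Rightarrow> (complex^2 \<Rightarrow> complex) \<Rightarrow> bool" where
  "binary_form n g \<longleftrightarrow> (\<exists>a. g = (\<lambda>s. \<Sum>i\<le>n. a i * (s$1) ^ i * (s$2) ^ (n - i)))"

text \<open>
  Homogeneous coordinates (s, u, v), (z0, z1) on the blow-up of the point in which the fiber over b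
  meets the section h = 0 (the incidence variety [z0 : z1] = [fiber_form b : h]). The blow-up map
  forgets (z0, z1), the exceptional curve is the preimage of the point, and the proper transform of
  the fiber over b is z0 = 0.
\<close>

definition blowup_coords :: "complex^2 \<Rightarrow> (hcoord \<Rightarrow> complex) \<Rightarrow> (hcoord \<times> complex \<times> complex) set" where
  "blowup_coords b h = {((s, u, v), (z0, z1)) | s u v z0 z1.
     s \<noteq> 0 \<and> (u, v) \<noteq> (0, 0) \<and> (z0, z1) \<noteq> (0, 0) \<and> z0 * h (s, u, v) = z1 * fiber_form b s}"

text \<open>
  Elementary transformations as correspondences: a point of the blow-up relates its image under the
  blow-up map to its image under the contraction of the proper transform of the fiber. The
  contraction to the surface of index n + 1 is (s, z1, z0 v): the curve z0 = 0 goes to the point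
  v = 0 of the new fiber, outside the exceptional section. The contraction to the
  surface of index n - 1 is (s, z0 u, z1): here z0 = 0 goes to the point of the new
  fiber on the exceptional section.
  Every point of the fiber outside the exceptional section is the intersection with a section
  v = g(s) u for a binary form g of degree n. Different choices of g through the same point, or of
  the identification of the contracted surface with the model, differ by an
  automorphism of the target.
\<close>

definition first_type :: "nat \<Rightarrow> complex^2 \<Rightarrow> (hcoord set \<times> hcoord set) set" where
  "first_type n b =
     {(hpt n (s, u, v), hpt (Suc n) (s, z1, z0 * v)) | s u v z0 z1.
        ((s, u, v), (z0, z1)) \<in> blowup_coords b (\<lambda>(s, u, v). u)}"

definition second_type :: "nat \<Rightarrow> complex^2 \<Rightarrow> hcoord set \<Rightarrow> (hcoord set \<times> hcoord set) set \<Rightarrow> bool" where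
  "second_type n b c R \<longleftrightarrow>
     (\<exists>g. binary_form n g \<and> c = hpt n (b, 1, g b) \<and>
        R = {(hpt n (s, u, v), hpt (n - 1) (s, z0 * u, z1)) | s u v z0 z1.
               ((s, u, v), (z0, z1)) \<in> blowup_coords b (\<lambda>(s, u, v). v - g s * u)})"

text \<open>Successive transformations of the first type on the fibers over the points of a list.\<close>

fun first_types :: "nat \<Rightarrow> (complex^2) list \<Rightarrow> (hcoord set \<times> hcoord set) set" where
  "first_types n [] = Id_on (hirzebruch n)"
| "first_types n (b # bs) = first_type n b O first_types (Suc n) bs"

text \<open>Successive transformations of the second type on the fiber over b, with the blown-up points listed.\<close>

inductive second_types ::
    "complex^2 \<Rightarrow> nat \<Rightarrow> hcoord set list \<Rightarrow> (hcoord set \<times> hcoord set) set \<Rightarrow> bool" for b where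
  "second_types b n [] (Id_on (hirzebruch n))"
| "second_type n b c R \<Longrightarrow> second_types b (n - 1) cs R' \<Longrightarrow> second_types b n (c # cs) (R O R')"

section \<open>The Cremona transformation\<close>

text \<open>
  The blow-down of the exceptional section of the surface of index 1; for an invertible matrix A it
  is the blow-up of the plane at the point A [0:0:1]. The fibers go to the lines through this point.
\<close>

definition blow_down :: "complex^3^3 \<Rightarrow> (hcoord set \<times> (complex^3) set) set" where
  "blow_down A =
     {(hpt 1 (s, u, v), ppt (A *v vector [u * s$1, u * s$2, v])) | s u v.
        s \<noteq> 0 \<and> (u, v) \<noteq> (0, 0)}"

text \<open>
  \<open>cremona ns p0 Qs P \<tau> cs T\<close>: the correspondence T is a transformation of the plane constructed
  from the tuple ns, the point p0, and the lines Qs and P through p0; \<tau> is its first half, up to the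
  last transformation of the first type, and cs lists the points blown up in the
  transformations of the second type. The matrix B is the choice of homogeneous coordinates on the
  final plane.
\<close>

definition cremona ::
    "nat list \<Rightarrow> (complex^3) set \<Rightarrow> (complex^3) set set list \<Rightarrow> (complex^3) set set \<Rightarrow>
     ((complex^3) set \<times> hcoord set) set \<Rightarrow> hcoord set list \<Rightarrow>
     ((complex^3) set \<times> (complex^3) set) set \<Rightarrow> bool" where
  "cremona ns p0 Qs P \<tau> cs T \<longleftrightarrow>
     (\<exists>A B bs b R.
        centered A p0 \<and> invertible B \<and>
        length bs = length Qs \<and>
        (\<forall>i<length Qs. bs ! i \<noteq> 0 \<and> Qs ! i = blow_down A `` fiber 1 (bs ! i)) \<and>
        b \<noteq> 0 \<and> P = blow_down A `` fiber 1 b \<and>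
        \<tau> = (blow_down A)\<inverse> O first_types 1 (concat (map2 replicate ns bs)) \<and>
        length cs = sum_list ns \<and>
        second_types b (sum_list ns + 1) cs R \<and>
        T = \<tau> O R O blow_down B)"

text \<open>
  The proper transform of a curve under a correspondence that is an isomorphism onto its image
  outside the set S, which does not contain the curve.
\<close>

definition proper_transform ::
    "((complex^3) set \<times> (complex^3) set) set \<Rightarrow> (complex^3) set set \<Rightarrow> (complex^3) set set \<Rightarrow>
     (complex^3) set set" where
  "proper_transform T S C = zariski_closure (T `` (C - S))"

text \<open>
  The type with entries ts. Entries 1 stand for blow-ups at smooth points and are not recorded.
\<close>

definition type_of :: "nat list \<Rightarrow> nat list" where
  "type_of ts = filter (\<lambda>t. t > 1) ts"

end

theory Submission
  imports Defs
    "HOL-Computational_Algebra.Field_as_Ring"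
    "HOL-Computational_Algebra.Fundamental_Theorem_Algebra"
    "HOL-Computational_Algebra.Polynomial_Factorial"
begin

text \<open>
  In coordinates with O = [0:0:1], let q be the product of the equations of the lines Q_i with
  multiplicities n_i, l the equation of P and N the sum of the n_i. The transformations of the first
  type multiply the fiber coordinate by q, those of the second type replace it by its quotient by l^N
  after subtraction of a form g of degree N + 1. So T maps [x:y:z] to [x l^N : y l^N : z q - g], and the
  image of F = 0 has the equation F(x q, y q, z l^N + g) = 0 of degree d (N + 1).

  As P and the Q_i are transversal, near each of them the curve F = 0 consists of d graphs
  z = \<psi>_j of a parameter t of the pencil of lines through O, with distinct values at t = 0. Near Q_i, the image
  consists of the graphs z = (q \<psi>_j - g) / l^N, whose differences vanish to order n_i exactly. The line P
  is contracted to O. With l = t, the proper transform of the image under the blow-up of O consists of the graphs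
  y = t^N / (q \<psi>_j - g), where the condition on the first center says that
  q \<psi>_j - g does not vanish at t = 0.
\<close>

(* Every occurrence of $ would otherwise be ambiguous with vec_nth. *)
no_notation fps_nth (infixl \<open>$\<close> 75)

section \<open>Evaluation of polynomials\<close>

text \<open>The proper transform is a Zariski closure of the image of C minus the lines, so the
  correspondences are evaluated only where they are single valued. The one exception is the first
  center on P, where the formula for the first half of T still holds. The price is that every form
  vanishing on this image must be shown to vanish on all of G = 0; limits along holomorphic branches
  serve for this instead of elimination theory. Germs are given by polynomials and exact division,
  but their branches are only holomorphic. Both kinds of singular points are therefore reduced to
  one family of polynomials, \<open>tac\<close>, which is stable under blow-up with the parameter n
  dropping by one. At n = 0 it is \<Phi> in a shifted coordinate, with d simple roots at x = 0 by
  transversality. Polynomial identities are checked at points, and gradients are computed as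
  derivatives along paths.\<close>

definition rhom :: "('a::comm_ring_1 \<Rightarrow> 'b::comm_ring_1) \<Rightarrow> bool" where
  "rhom h \<longleftrightarrow> h 1 = 1 \<and> (\<forall>a b. h (a + b) = h a + h b) \<and> (\<forall>a b. h (a * b) = h a * h b)"

lemma rhomI:
  assumes "h 1 = 1" "\<And>a b. h (a + b) = h a + h b" "\<And>a b. h (a * b) = h a * h b"
  shows "rhom h"
  using assms by (simp add: rhom_def)

context
  fixes h :: "'a::comm_ring_1 \<Rightarrow> 'b::comm_ring_1"
  assumes h: "rhom h"
begin

lemma rhom_1: "h 1 = 1" and rhom_add: "h (a + b) = h a + h b" and rhom_mult: "h (a * b) = h a * h b"
  using h by (auto simp: rhom_def)

lemma rhom_0: "h 0 = 0"
  using rhom_add[of 0 0] by simp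

lemma rhom_minus: "h (- a) = - h a"
  using rhom_add[of "-a" a] rhom_0 by (simp add: eq_neg_iff_add_eq_0)

lemma rhom_diff: "h (a - b) = h a - h b"
  using rhom_add[of a "-b"] rhom_minus by simp

lemma rhom_power: "h (a ^ n) = h a ^ n"
  by (induction n) (simp_all add: rhom_1 rhom_mult)

lemma rhom_sum: "h (\<Sum>i\<in>A. f i) = (\<Sum>i\<in>A. h (f i))"
  by (induction A rule: infinite_finite_induct) (simp_all add: rhom_0 rhom_add)

lemma rhom_prod: "h (\<Prod>i\<in>A. f i) = (\<Prod>i\<in>A. h (f i))"
  by (induction A rule: infinite_finite_induct) (simp_all add: rhom_1 rhom_mult)

lemma map_poly_rhom_pCons: "map_poly h (pCons a p) = pCons (h a) (map_poly h p)"
  by (simp add: map_poly_pCons rhom_0)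

lemma map_poly_rhom_add: "map_poly h (p + q) = map_poly h p + map_poly h q"
  by (rule poly_eqI) (simp add: coeff_map_poly rhom_0 rhom_add)

lemma map_poly_rhom_mult: "map_poly h (p * q) = map_poly h p * map_poly h q"
  by (rule poly_eqI) (simp add: coeff_map_poly rhom_0 coeff_mult rhom_sum rhom_mult)

lemma rhom_poly_map_poly: "rhom (\<lambda>p. poly (map_poly h p) x)"
  by (rule rhomI) (simp_all add: map_poly_rhom_add map_poly_rhom_mult rhom_1)

lemma rhom_poly: "h (poly p x) = poly (map_poly h p) (h x)"
  by (induction p) (simp_all add: map_poly_rhom_pCons rhom_0 rhom_add rhom_mult)

lemma map_poly_rhom_compose: "g 0 = 0 \<Longrightarrow> map_poly h (map_poly g p) = map_poly (\<lambda>c. h (g c)) p"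
  by (rule poly_eqI) (simp add: coeff_map_poly rhom_0)

end

lemma rhom_eval2: "rhom h \<Longrightarrow> rhom (\<lambda>f. eval2 h f x y)"
  unfolding eval2_def by (intro rhom_poly_map_poly)

lemma rhom_eval3: "rhom h \<Longrightarrow> rhom (\<lambda>F. eval3 h F x y z)"
  unfolding eval3_def by (intro rhom_poly_map_poly rhom_eval2)

lemma rhom_id [simp]: "rhom (\<lambda>c. c)"
  by (simp add: rhom_def)

lemma rhom_poly_at [simp]: "rhom (\<lambda>p. poly p x)"
  by (rule rhomI) simp_all

lemma rhom_const1 [simp]: "rhom (\<lambda>c. [:c:])"
  by (rule rhomI) (simp_all add: one_pCons)

lemma rhom_const2 [simp]: "rhom const2"
  unfolding const2_def by (rule rhomI) (simp_all add: one_pCons)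

definition const3 :: "complex \<Rightarrow> complex poly poly poly" where
  "const3 c = [:[:[:c:]:]:]"

lemma rhom_const3 [simp]: "rhom const3"
  unfolding const3_def by (rule rhomI) (simp_all add: one_pCons)

text \<open>Homomorphisms of the target commute with substitution. With evaluation at a point as
  \<open>g\<close>, a substituted polynomial is reduced to its values; the rules
  \<open>ev2_eval2\<close>, \<open>e3_eval3\<close> and the like arise in this way.\<close>

lemma rhom_comp_eval2:
  assumes g: "rhom g" and h: "rhom h"
  shows "g (eval2 h f x y) = eval2 (\<lambda>c. g (h c)) f (g x) (g y)"
  unfolding eval2_def
  by (simp add: rhom_poly[OF g] map_poly_rhom_compose[OF g] rhom_0[OF rhom_poly_map_poly[OF h]] rhom_0[OF h])

lemma rhom_comp_eval3:
  assumes g: "rhom g" and h: "rhom h"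
  shows "g (eval3 h f x y z) = eval3 (\<lambda>c. g (h c)) f (g x) (g y) (g z)"
  unfolding eval3_def
  by (simp add: rhom_poly[OF g] map_poly_rhom_compose[OF g] rhom_0[OF rhom_eval2[OF h]] rhom_comp_eval2[OF g h])

abbreviation ev2 :: "complex poly poly \<Rightarrow> complex \<Rightarrow> complex \<Rightarrow> complex" where
  "ev2 f x y \<equiv> eval2 (\<lambda>c. c) f x y"

abbreviation e3 :: "complex poly poly poly \<Rightarrow> complex \<Rightarrow> complex \<Rightarrow> complex \<Rightarrow> complex" where
  "e3 F x y z \<equiv> eval3 (\<lambda>c. c) F x y z"

lemma rhom_ev2 [simp]: "rhom (\<lambda>f. ev2 f x y)"
  by (simp add: rhom_eval2)

lemma rhom_e3 [simp]: "rhom (\<lambda>f. e3 f x y z)"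
  by (simp add: rhom_eval3)

lemmas ev2_simps [simp] =
  rhom_0[OF rhom_ev2] rhom_1[OF rhom_ev2] rhom_add[OF rhom_ev2] rhom_mult[OF rhom_ev2]
  rhom_minus[OF rhom_ev2] rhom_diff[OF rhom_ev2] rhom_power[OF rhom_ev2] rhom_sum[OF rhom_ev2]
  rhom_prod[OF rhom_ev2]

lemmas e3_simps [simp] =
  rhom_0[OF rhom_e3] rhom_1[OF rhom_e3] rhom_add[OF rhom_e3] rhom_mult[OF rhom_e3]
  rhom_minus[OF rhom_e3] rhom_diff[OF rhom_e3] rhom_power[OF rhom_e3] rhom_sum[OF rhom_e3]

lemma ev2_pCons [simp]: "ev2 (pCons p f) x y = poly p x + y * ev2 f x y"
  by (simp add: eval2_def map_poly_pCons)

lemma e3_pCons [simp]: "e3 (pCons f F) x y z = ev2 f x y + z * e3 F x y z"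
  by (simp add: eval3_def map_poly_pCons eval2_def)

lemma ev2_smult [simp]: "ev2 (smult p f) x y = poly p x * ev2 f x y"
  using rhom_mult[OF rhom_ev2, of "[:p:]" f x y] by simp

lemma e3_smult [simp]: "e3 (smult f F) x y z = ev2 f x y * e3 F x y z"
  using rhom_mult[OF rhom_e3, of "[:f:]" F x y z] by simp

lemma poly_eval2 [simp]: "poly (eval2 (\<lambda>c. [:c:]) f p q) x = ev2 f (poly p x) (poly q x)"
  using rhom_comp_eval2[of "\<lambda>f. poly f x" "\<lambda>c. [:c:]" f p q] by simp

lemma ev2_X2 [simp]: "ev2 X2 x y = x" and ev2_Y2 [simp]: "ev2 Y2 x y = y"
  and ev2_const2 [simp]: "ev2 (const2 c) x y = c"
  by (simp_all add: X2_def Y2_def const2_def)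

lemma e3_const3 [simp]: "e3 (const3 c) x y z = c"
  by (simp add: const3_def)

lemma ev2_eval2 [simp]: "ev2 (eval2 const2 f p q) x y = ev2 f (ev2 p x y) (ev2 q x y)"
  using rhom_comp_eval2[of "\<lambda>f. ev2 f x y" const2 f p q] by simp

lemma ev2_eval3 [simp]: "ev2 (eval3 const2 F p q r) x y = e3 F (ev2 p x y) (ev2 q x y) (ev2 r x y)"
  using rhom_comp_eval3[of "\<lambda>f. ev2 f x y" const2 F p q r] by simp

lemma e3_eval3 [simp]:
  "e3 (eval3 const3 F p q r) x y z = e3 F (e3 p x y z) (e3 q x y z) (e3 r x y z)"
  using rhom_comp_eval3[of "\<lambda>f. e3 f x y z" const3 F p q r] by simp

lemma poly_eval3 [simp]:
  "poly (eval3 (\<lambda>c. [:c:]) F p q r) x = e3 F (poly p x) (poly q x) (poly r x)"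
  using rhom_comp_eval3[of "\<lambda>f. poly f x" "\<lambda>c. [:c:]" F p q r] by simp

lemma ev2_alt: "ev2 f x y = poly (map_poly (\<lambda>p. poly p x) f) y"
  by (simp add: eval2_def)

lemma e3_alt: "e3 F x y z = poly (map_poly (\<lambda>f. ev2 f x y) F) z"
  by (simp add: eval3_def)

text \<open>For fixed x, a polynomial in y without nonzero values has zero coefficients, and each
  coefficient is then a polynomial in x of the same kind. Hence polynomial identities may be checked
  at points.\<close>

lemma ev2_eq_0D:
  assumes "\<And>x y. ev2 f x y = 0"
  shows "f = 0"
proof (rule poly_eqI)
  fix j
  have "map_poly (\<lambda>p. poly p x) f = 0" for x
    using assms[unfolded ev2_alt] by (simp flip: poly_all_0_iff_0)
  then have "poly (coeff f j) x = 0" for x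
    by (metis coeff_0 coeff_map_poly poly_0)
  then show "coeff f j = coeff 0 j"
    by (simp flip: poly_all_0_iff_0)
qed

lemma ev2_eqI: "(\<And>x y. ev2 f x y = ev2 g x y) \<Longrightarrow> f = g"
  using ev2_eq_0D[of "f - g"] by simp

lemma e3_eq_0D:
  assumes "\<And>x y z. e3 F x y z = 0"
  shows "F = 0"
proof (rule poly_eqI)
  fix j
  have "map_poly (\<lambda>p. ev2 p x y) F = 0" for x y
    using assms[unfolded e3_alt] by (simp flip: poly_all_0_iff_0)
  then have "ev2 (coeff F j) x y = 0" for x y
    by (metis coeff_0 coeff_map_poly ev2_simps(1))
  then show "coeff F j = coeff 0 j"
    by (simp add: ev2_eq_0D)
qed

lemma e3_eqI: "(\<And>x y z. e3 F x y z = e3 G x y z) \<Longrightarrow> F = G"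
  using e3_eq_0D[of "F - G"] by simp

lemma poly_map_poly_expand:
  assumes "rhom h"
  shows "poly (map_poly h p) x = (\<Sum>i\<le>degree p. h (coeff p i) * x ^ i)"
proof -
  have "poly (map_poly h p) x = poly (map_poly h (\<Sum>i\<le>degree p. monom (coeff p i) i)) x"
    by (simp add: poly_as_sum_of_monoms)
  also have "\<dots> = (\<Sum>i\<le>degree p. poly (map_poly h (monom (coeff p i) i)) x)"
    by (rule rhom_sum[OF rhom_poly_map_poly[OF assms]])
  also have "\<dots> = (\<Sum>i\<le>degree p. h (coeff p i) * x ^ i)"
    by (simp add: map_poly_monom rhom_0[OF assms] poly_monom)
  finally show ?thesis .
qed

lemma eval3_expand:
  assumes h: "rhom h"
  shows "eval3 h F x y z =
    (\<Sum>k\<le>degree F. (\<Sum>j\<le>degree (coeff F k). (\<Sum>i\<le>degree (coeff (coeff F k) j).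
       h (coeff (coeff (coeff F k) j) i) * x ^ i) * y ^ j) * z ^ k)"
proof -
  have "eval2 h f x y = (\<Sum>j\<le>degree f. poly (map_poly h (coeff f j)) x * y ^ j)" for f
    unfolding eval2_def by (rule poly_map_poly_expand[OF rhom_poly_map_poly[OF h]])
  then have "eval2 h f x y = (\<Sum>j\<le>degree f. (\<Sum>i\<le>degree (coeff f j). h (coeff (coeff f j) i) * x ^ i) * y ^ j)" for f
    unfolding poly_map_poly_expand[OF h] .
  then show ?thesis
    unfolding eval3_def poly_map_poly_expand[OF rhom_eval2[OF h]] by simp
qed

section \<open>Forms\<close>

lemma form_scale:
  assumes h: "rhom h" and F: "form d F"
  shows "eval3 h F (t * x) (t * y) (t * z) = t ^ d * eval3 h F x y z"
proof -
  have "h (coeff (coeff (coeff F k) j) i) * (t * x) ^ i * (t * y) ^ j * (t * z) ^ k =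
      t ^ d * (h (coeff (coeff (coeff F k) j) i) * x ^ i * y ^ j * z ^ k)" for i j k
  proof (cases "coeff (coeff (coeff F k) j) i = 0")
    case True
    then show ?thesis by (simp add: rhom_0[OF h])
  next
    case False
    then have "i + j + k = d" using F by (auto simp: form_def)
    then show ?thesis by (auto simp: power_mult_distrib power_add)
  qed
  then show ?thesis
    unfolding eval3_expand[OF h]
    by (simp add: sum_distrib_left sum_distrib_right mult.assoc)
qed


text \<open>
  Scaling by 2 multiplies the coefficient of x^i y^j z^k by 2^(i + j + k), and the powers of 2 are
  distinct.
\<close>

lemma formI:
  assumes hom: "\<And>x y z. e3 F (2 * x) (2 * y) (2 * z) = 2 ^ d * e3 F x y z"
  shows "form d F"
proof -
  \<comment> \<open>Scaling is done level by level: each map scales its own variable and applies the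
    previous map to the coefficients, so that \<open>s3 F\<close> is F(2x, 2y, 2z).\<close>
  define s1 where "s1 = (\<lambda>p. pcompose p [:0, 2:] :: complex poly)"
  define s2 where "s2 = (\<lambda>p. pcompose (map_poly s1 p) [:0, [:2:]:])"
  define s3 where "s3 = (\<lambda>p. pcompose (map_poly s2 p) [:0, [:[:2:]:]:])"
  have s10: "s1 0 = 0" and s20: "s2 0 = 0"
    by (simp_all add: s1_def s2_def)
  have e1: "poly (s1 p) x = poly p (2 * x)" for p x
    by (simp add: s1_def poly_pcompose mult.commute)
  have c1: "coeff (s1 p) i = 2 ^ i * coeff p i" for p i
    by (simp add: s1_def coeff_pcompose_linear)
  have c2: "coeff (s2 p) j = smult (2 ^ j) (s1 (coeff p j))" for p j
    by (simp add: s2_def coeff_pcompose_linear coeff_map_poly s10 poly_const_pow)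
  have c3: "coeff (s3 p) k = smult [:2 ^ k:] (s2 (coeff p k))" for p k
    by (simp add: s3_def coeff_pcompose_linear coeff_map_poly s20 poly_const_pow)
  have pc: "poly (pcompose p [:0, 2:]) y = poly p (2 * y)" for p and y :: complex
    by (simp add: poly_pcompose mult.commute)
  have e2: "ev2 (s2 f) x y = ev2 f (2 * x) (2 * y)" for f x y
  proof -
    have "map_poly (\<lambda>p. poly p x) (s2 f) = pcompose (map_poly (\<lambda>p. poly p (2 * x)) f) [:0, 2:]"
      by (rule poly_eqI) (simp add: coeff_map_poly c2 e1 coeff_pcompose_linear)
    then show ?thesis
      unfolding ev2_alt by (simp only: pc)
  qed
  have e3: "e3 (s3 f) x y z = e3 f (2 * x) (2 * y) (2 * z)" for f x y z
  proof -
    have "map_poly (\<lambda>p. ev2 p x y) (s3 f) = pcompose (map_poly (\<lambda>p. ev2 p (2 * x) (2 * y)) f) [:0, 2:]"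
      by (rule poly_eqI) (simp add: coeff_map_poly c3 e2 coeff_pcompose_linear)
    then show ?thesis
      unfolding e3_alt by (simp only: pc)
  qed
  have eq: "s3 F = const3 (2 ^ d) * F"
    by (rule e3_eqI) (simp add: e3 hom)
  show ?thesis
    unfolding form_def
  proof (intro allI impI)
    fix i j k assume nz: "coeff (coeff (coeff F k) j) i \<noteq> 0"
    have "coeff (coeff (coeff (s3 F) k) j) i = 2 ^ (i + j + k) * coeff (coeff (coeff F k) j) i"
      by (simp add: c1 c2 c3 power_add)
    moreover have "coeff (coeff (coeff (s3 F) k) j) i = 2 ^ d * coeff (coeff (coeff F k) j) i"
      by (simp add: eq const3_def)
    ultimately have "(2::complex) ^ (i + j + k) = 2 ^ d"
      using nz by simp
    then have "norm ((2::complex) ^ (i + j + k)) = norm ((2::complex) ^ d)"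
      by simp
    then have "(2::real) ^ (i + j + k) = 2 ^ d"
      by (simp only: norm_power) simp
    then show "i + j + k = d"
      by simp
  qed
qed


lemma form_on_z_axis:
  assumes F: "form d F" shows "e3 F 0 0 z = e3 F 0 0 1 * z ^ d"
  using form_scale[OF rhom_id F, of z 0 0 1] by (simp add: mult.commute)

section \<open>Linear changes of coordinates\<close>

definition X3 :: "complex poly poly poly" where "X3 = [:[:[:0, 1:]:]:]"
definition Y3 :: "complex poly poly poly" where "Y3 = [:[:0, 1:]:]"
definition Z3 :: "complex poly poly poly" where "Z3 = [:0, 1:]"

lemma e3_X3 [simp]: "e3 X3 x y z = x" and e3_Y3 [simp]: "e3 Y3 x y z = y" and e3_Z3 [simp]: "e3 Z3 x y z = z"
  by (simp_all add: X3_def Y3_def Z3_def)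

definition lin_comp :: "complex poly poly poly \<Rightarrow> complex^3^3 \<Rightarrow> complex poly poly poly" where
  "lin_comp F A = (let l = (\<lambda>i. const3 (A$i$1) * X3 + const3 (A$i$2) * Y3 + const3 (A$i$3) * Z3)
     in eval3 const3 F (l 1) (l 2) (l 3))"

lemma ev3_vector [simp]: "ev3 F (vector [x, y, z]) = e3 F x y z"
  by (simp add: ev3_def)

lemma vector_3_eta: "vector [v$1, v$2, v$3] = (v :: complex^3)"
  by (simp add: vec_eq_iff forall_3)

lemma vector_2_eta: "vector [v$1, v$2] = (v :: complex^2)"
  by (simp add: vec_eq_iff forall_2)

lemma mult_vector_3:
  fixes x y z :: complex
  shows "(A :: complex^3^3) *v vector [x, y, z] = (vector [A$1$1 * x + A$1$2 * y + A$1$3 * z,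
     A$2$1 * x + A$2$2 * y + A$2$3 * z, A$3$1 * x + A$3$2 * y + A$3$3 * z] :: complex^3)"
  unfolding vec_eq_iff forall_3 by (simp add: matrix_vector_mult_def sum_3)

lemma e3_lin_comp [simp]: "e3 (lin_comp F A) x y z = ev3 F (A *v vector [x, y, z])"
  by (simp add: lin_comp_def mult_vector_3)

lemma ev3_lin_comp [simp]: "ev3 (lin_comp F A) v = ev3 F (A *v v)"
  by (metis e3_lin_comp ev3_vector vector_3_eta)

lemma ev3_eqI: "(\<And>v. ev3 F v = ev3 G v) \<Longrightarrow> F = G"
  by (metis e3_eqI ev3_vector)

lemma ev3_mult [simp]: "ev3 (F * G) v = ev3 F v * ev3 G v" and ev3_1 [simp]: "ev3 1 v = 1"
  by (simp_all add: ev3_def)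

lemma ev2_local_eq [simp]: "ev2 (local_eq F M) x y = ev3 F (M *v vector [x, y, 1])"
  by (simp add: local_eq_def Let_def mult_vector_3)

lemma ev3_scale: "form d F \<Longrightarrow> ev3 F (t *s v) = t ^ d * ev3 F v"
  unfolding ev3_def using form_scale[OF rhom_id] by simp

lemma form_lin_comp: "form d F \<Longrightarrow> form d (lin_comp F A)"
proof (rule formI)
  fix x y z assume F: "form d F"
  have "vector [2 * x, 2 * y, 2 * z] = 2 *s (vector [x, y, z] :: complex^3)"
    by (simp add: vec_eq_iff forall_3)
  then show "e3 (lin_comp F A) (2 * x) (2 * y) (2 * z) = 2 ^ d * e3 (lin_comp F A) x y z"
    by (simp add: ev3_scale[OF F] vector_scalar_commute)
qed

lemma lin_comp_mult: "lin_comp (F * G) A = lin_comp F A * lin_comp G A"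
  and lin_comp_1: "lin_comp 1 A = 1"
  by (rule ev3_eqI; simp)+

lemma lin_comp_inverse:
  assumes "A ** B = mat 1" shows "lin_comp (lin_comp F A) B = F"
  by (rule ev3_eqI) (simp add: matrix_vector_mul_assoc assms)

lemma irreducible_lin_comp:
  assumes F: "irreducible F" and A: "invertible A"
  shows "irreducible (lin_comp F A)"
proof -
  obtain B where AB: "A ** B = mat 1" "B ** A = mat 1"
    using A by (auto simp: invertible_def)
  have unit: "lin_comp G A' dvd 1 \<longleftrightarrow> G dvd 1" if "A' ** B' = mat 1" for A' B' G
    by (metis dvd_def lin_comp_1 lin_comp_inverse lin_comp_mult that)
  show ?thesis
    unfolding irreducible_def
  proof (intro conjI allI impI)
    show "lin_comp F A \<noteq> 0"
      using F lin_comp_inverse[OF AB(1), of F] lin_comp_mult[of 0 0 B]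
      by (metis irreducible_def lin_comp_mult mult_zero_left mult_zero_right)
    show "\<not> lin_comp F A dvd 1"
      using F unit[OF AB(1)] by (auto simp: irreducible_def)
    fix G H assume "lin_comp F A = G * H"
    then have "F = lin_comp G B * lin_comp H B"
      by (metis AB(1) lin_comp_inverse lin_comp_mult)
    then show "G dvd 1 \<or> H dvd 1"
      using F unit[OF AB(2)] by (auto simp: irreducible_def)
  qed
qed

section \<open>Derivatives\<close>

lemma map_poly_pderiv_pCons: "map_poly pderiv (pCons p f) = pCons (pderiv p) (map_poly pderiv f)"
  by (simp add: map_poly_pCons)

text \<open>Chain rule along a path. It ties the formal partial derivatives, of which
  \<open>map_poly pderiv\<close> is the one in the inner variable x, to analytic ones, so that later
  formulas for gradients follow from uniqueness of the derivative.\<close>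

lemma ev2_has_field_derivative:
  assumes x: "(x has_field_derivative x') (at t)" and y: "(y has_field_derivative y') (at t)"
  shows "((\<lambda>t. ev2 f (x t) (y t)) has_field_derivative
    (ev2 (map_poly pderiv f) (x t) (y t) * x' + ev2 (pderiv f) (x t) (y t) * y')) (at t)"
proof (induction f)
  case 0
  then show ?case by simp
next
  case (pCons p f)
  have "((\<lambda>t. poly p (x t)) has_field_derivative poly (pderiv p) (x t) * x') (at t)"
    by (rule DERIV_chain2[OF poly_DERIV x])
  from DERIV_add[OF this DERIV_mult[OF y pCons.IH]] show ?case
    by (simp add: map_poly_pderiv_pCons pderiv_pCons algebra_simps)
qed

lemma e3_has_field_derivative:
  assumes x: "(x has_field_derivative x') (at t)" and y: "(y has_field_derivative y') (at t)"
    and z: "(z has_field_derivative z') (at t)"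
  shows "((\<lambda>t. e3 F (x t) (y t) (z t)) has_field_derivative
    (e3 (map_poly (map_poly pderiv) F) (x t) (y t) (z t) * x' +
     e3 (map_poly pderiv F) (x t) (y t) (z t) * y' + e3 (pderiv F) (x t) (y t) (z t) * z')) (at t)"
proof (induction F)
  case 0
  then show ?case by simp
next
  case (pCons f F)
  from DERIV_add[OF ev2_has_field_derivative[OF x y] DERIV_mult[OF z pCons.IH]] show ?case
    by (simp add: map_poly_pCons pderiv_pCons algebra_simps)
qed

definition grad_dot :: "complex poly poly poly \<Rightarrow> complex^3 \<Rightarrow> complex^3 \<Rightarrow> complex" where
  "grad_dot F v w = (\<Sum>i\<in>UNIV. grad F v $ i * w $ i)"

lemma grad_dot_add: "grad_dot F v (a *s w + b *s w') = a * grad_dot F v w + b * grad_dot F v w'"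
  by (simp add: grad_dot_def sum_3 algebra_simps)

lemma grad_eq_0_iff: "grad F v = 0 \<longleftrightarrow> (\<forall>w. grad_dot F v w = 0)"
proof
  assume *: "\<forall>w. grad_dot F v w = 0"
  have "grad F v $ i = 0" for i
    using *[rule_format, of "axis i 1"] by (simp add: grad_dot_def axis_def if_distrib cong: if_cong)
  then show "grad F v = 0" by (simp add: vec_eq_iff)
qed (simp add: grad_dot_def)

lemma ev3_has_field_derivative:
  assumes "\<And>i. ((\<lambda>t. \<gamma> t $ i) has_field_derivative \<gamma>' $ i) (at t)"
  shows "((\<lambda>t. ev3 F (\<gamma> t)) has_field_derivative grad_dot F (\<gamma> t) \<gamma>') (at t)"
  unfolding ev3_def grad_dot_def grad_def sum_3
  using e3_has_field_derivative[OF assms assms assms] by simp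

lemma ev3_line_has_field_derivative:
  "((\<lambda>t. ev3 F (v + t *s w)) has_field_derivative grad_dot F (v + t *s w) w) (at t)"
  by (rule ev3_has_field_derivative) (auto intro!: derivative_eq_intros)

text \<open>Euler's identity, by differentiating F(t v) = t^d F(v) at t = 1.\<close>

lemma grad_dot_self:
  assumes F: "form d F"
  shows "grad_dot F v v = d * ev3 F v"
proof -
  have "((\<lambda>t. ev3 F (0 + t *s v)) has_field_derivative grad_dot F v v) (at 1)"
    using ev3_line_has_field_derivative[of F 0 v 1] by simp
  moreover have "((\<lambda>t. t ^ d * ev3 F v) has_field_derivative (of_nat d * ev3 F v)) (at 1)"
    by (auto intro!: derivative_eq_intros)
  ultimately show ?thesis
    by (simp add: ev3_scale[OF F] DERIV_unique)
qed

text \<open>Differentiate F(t v + s t w) = t^d F(v + s w) at s = 0. The factor t stays on the left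
  so that no exponent d - 1 occurs.\<close>

lemma grad_dot_scale:
  assumes F: "form d F" and t: "t \<noteq> 0"
  shows "t * grad_dot F (t *s v) w = t ^ d * grad_dot F v w"
proof -
  have "((\<lambda>s. ev3 F (t *s v + s *s (t *s w))) has_field_derivative grad_dot F (t *s v) (t *s w)) (at 0)"
    using ev3_line_has_field_derivative[of F "t *s v" "t *s w" 0] by simp
  moreover have "ev3 F (t *s v + s *s (t *s w)) = t ^ d * ev3 F (v + s *s w)" for s
  proof -
    have "t *s v + s *s (t *s w) = t *s (v + s *s w)"
      by (simp add: vec_eq_iff algebra_simps)
    then show ?thesis by (simp only: ev3_scale[OF F])
  qed
  moreover have "((\<lambda>s. t ^ d * ev3 F (v + s *s w)) has_field_derivative (t ^ d * grad_dot F v w)) (at 0)"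
    using DERIV_cmult[OF ev3_line_has_field_derivative[of F v w 0]] by simp
  ultimately have "grad_dot F (t *s v) (t *s w) = t ^ d * grad_dot F v w"
    by (simp only: DERIV_unique)
  then show ?thesis
    using grad_dot_add[of F "t *s v" t w 0 0] by simp
qed

lemma tendsto_e3:
  assumes "(x \<longlongrightarrow> a) net" "(y \<longlongrightarrow> b) net" "(z \<longlongrightarrow> c) net"
  shows "((\<lambda>t. e3 F (x t) (y t) (z t)) \<longlongrightarrow> e3 F a b c) net"
  unfolding eval3_expand[OF rhom_id] by (intro tendsto_intros assms)

section \<open>Points of the plane\<close>

lemma ppt_eq_iff: "ppt v = ppt w \<longleftrightarrow> (\<exists>c. c \<noteq> 0 \<and> v = c *s w)"
proof
  assume "ppt v = ppt w"
  moreover have "v \<in> ppt v" unfolding ppt_def by (auto intro!: exI[of _ 1])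
  ultimately show "\<exists>c. c \<noteq> 0 \<and> v = c *s w" by (auto simp: ppt_def)
next
  assume "\<exists>c. c \<noteq> 0 \<and> v = c *s w"
  then obtain c where c: "c \<noteq> 0" "v = c *s w" by auto
  have sub: "ppt (c *s w) \<subseteq> ppt w" if "c \<noteq> 0" for c w
    using that by (auto simp: ppt_def vector_smult_assoc)
  have "w = inverse c *s v"
    using c by (simp add: vector_smult_assoc)
  then show "ppt v = ppt w"
    using sub[of c w] sub[of "inverse c" v] c by auto
qed

lemma ppt_scale: "c \<noteq> 0 \<Longrightarrow> ppt (c *s v) = ppt v"
  by (auto simp: ppt_eq_iff)

lemma ppt_in_curve_iff:
  assumes F: "form d F" and v: "v \<noteq> 0"
  shows "ppt v \<in> curve F \<longleftrightarrow> ev3 F v = 0"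
proof
  assume "ppt v \<in> curve F"
  then show "ev3 F v = 0"
    by (auto simp: curve_def ppt_eq_iff ev3_scale[OF F])
qed (use v in \<open>auto simp: curve_def\<close>)

lemma curve_subset: "curve F \<subseteq> proj_plane"
  by (auto simp: curve_def proj_plane_def)

lemma invertible_mult_eq_0: "invertible (A :: complex^3^3) \<Longrightarrow> A *v v = 0 \<longleftrightarrow> v = 0"
  by (metis invertible_def matrix_vector_mul_assoc matrix_vector_mul_lid matrix_vector_mult_0_right)

section \<open>Multiplicities and blow-ups of germs\<close>

lemma poly_poly_ev2: "poly (poly f r) x = ev2 f x (poly r x)"
  by (induction f) simp_all

lemma coeff_poly_linear:
  fixes f :: "complex poly poly"
  shows "coeff (poly f [:0, y:]) k = (\<Sum>j\<le>k. coeff (coeff f j) (k - j) * y ^ j)"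
proof (induction f arbitrary: k)
  case (pCons p f)
  show ?case
  proof (cases k)
    case (Suc n)
    have "(\<Sum>j\<le>Suc n. coeff (coeff (pCons p f) j) (Suc n - j) * y ^ j) =
        coeff p (Suc n) + (\<Sum>j\<le>n. coeff (coeff f j) (n - j) * y ^ Suc j)"
      by (subst sum.atMost_Suc_shift) simp
    then show ?thesis
      using Suc by (simp add: pCons.IH sum_distrib_left mult_ac)
  qed simp
qed simp

text \<open>The multiplicity is the order in x of f(x, x y), whose leading coefficient is the initial form of f.\<close>

lemma mult0_eqI:
  assumes eq: "\<And>x y. ev2 f x (x * y) = x ^ m * ev2 h x y" and nz: "ev2 h 0 y0 \<noteq> 0"
  shows "mult0 f = m"
proof -
  have poly_eq: "poly f [:0, y:] = monom 1 m * poly h [:y:]" for y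
    unfolding poly_eq_poly_eq_iff[symmetric] fun_eq_iff
    by (simp add: poly_poly_ev2 poly_monom eq mult.commute[of _ y] flip: eq)
  have sum: "(\<Sum>j\<le>k. coeff (coeff f j) (k - j) * y ^ j) =
      (if k < m then 0 else coeff (poly h [:y:]) (k - m))" for k y
    using arg_cong[OF poly_eq[of y], of "\<lambda>p. coeff p k"] by (simp add: coeff_poly_linear coeff_monom_mult)
  have low: "coeff (coeff f j) i = 0" if "i + j < m" for i j
  proof -
    define k where "k = i + j"
    \<comment> \<open>The relation holds for every y, so it is read as a polynomial in y whose
      coefficients vanish one by one.\<close>
    define p where "p = (\<Sum>j\<le>k. monom (coeff (coeff f j) (k - j)) j)"
    have "poly p y = 0" for y
      using sum[where k = k and y = y] that by (simp add: p_def poly_sum poly_monom k_def)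
    then have "p = 0"
      using poly_all_0_iff_0[of p] by blast
    then have "coeff p j = 0" by simp
    then show ?thesis
      by (simp add: p_def coeff_sum k_def if_distrib cong: if_cong)
  qed
  have "\<exists>i j. i + j = m \<and> coeff (coeff f j) i \<noteq> 0"
  proof (rule ccontr)
    assume "\<not> ?thesis"
    then have "(\<Sum>j\<le>m. coeff (coeff f j) (m - j) * y0 ^ j) = 0"
      by (intro sum.neutral) auto
    then have "coeff (poly h [:y0:]) 0 = 0"
      using sum[where k = m and y = y0] by simp
    then show False
      using nz poly_poly_ev2[of h "[:y0:]" 0] by (simp add: poly_0_coeff_0)
  qed
  then show ?thesis
    unfolding mult0_def
  proof (rule Least_equality)
    fix k assume "\<exists>i j. i + j = k \<and> coeff (coeff f j) i \<noteq> 0"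
    then show "m \<le> k" using low not_less by blast
  qed
qed

lemma ev2_0_0: "ev2 f 0 0 = coeff (coeff f 0) 0"
  by (cases f) (simp add: poly_0_coeff_0)

lemma ev2_pderiv_0_0: "ev2 (pderiv f) 0 0 = coeff (coeff f 1) 0"
  by (simp add: ev2_0_0 coeff_pderiv)

lemma mult0_eq_0: "ev2 f 0 0 \<noteq> 0 \<Longrightarrow> mult0 f = 0"
  unfolding mult0_def by (rule Least_eq_0) (simp add: ev2_0_0)

lemma mult0_le_1: "ev2 (pderiv f) 0 0 \<noteq> 0 \<Longrightarrow> mult0 f \<le> 1"
  unfolding mult0_def ev2_pderiv_0_0 by (intro Least_le exI[of _ 0] exI[of _ 1]) simp

lemma mult0_eq_1:
  assumes "ev2 f 0 0 = 0" "ev2 (pderiv f) 0 0 \<noteq> 0" shows "mult0 f = 1"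
proof -
  have "\<exists>i j. i + j = mult0 f \<and> coeff (coeff f j) i \<noteq> 0"
    unfolding mult0_def
  proof (rule LeastI)
    show "\<exists>i j. i + j = 1 \<and> coeff (coeff f j) i \<noteq> 0"
      using assms(2)[unfolded ev2_pderiv_0_0] by (intro exI[of _ 0] exI[of _ 1]) simp
  qed
  then have "mult0 f \<noteq> 0" using assms(1) by (metis add_is_0 ev2_0_0)
  then show ?thesis using mult0_le_1[OF assms(2)] by simp
qed

text \<open>A single quotient \<open>h\<close>, computed in the direction t = 0, serves all
  directions \<open>Some t\<close>: their charts differ by a translation of y. Exhibiting the factor
  \<open>X2 ^ m\<close> makes the division exact.\<close>

lemma strict_Some:
  assumes "\<And>x y. ev2 f x (x * y) = x ^ m * ev2 h x y" "mult0 f = m"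
  shows "strict f (Some t) = eval2 const2 h X2 (Y2 + const2 t)"
proof -
  have "eval2 const2 f X2 (X2 * (Y2 + const2 t)) = X2 ^ m * eval2 const2 h X2 (Y2 + const2 t)"
    by (rule ev2_eqI) (simp add: assms(1))
  moreover have "X2 \<noteq> 0" by (simp add: X2_def)
  ultimately show ?thesis by (simp add: assms(2))
qed

lemma strict_None:
  assumes "\<And>x y. ev2 f (x * y) y = y ^ m * ev2 h x y" "mult0 f = m"
  shows "strict f None = h"
proof -
  have "eval2 const2 f (X2 * Y2) Y2 = Y2 ^ m * h"
    by (rule ev2_eqI) (simp add: assms(1))
  moreover have "Y2 \<noteq> 0" by (simp add: Y2_def)
  ultimately show ?thesis by (simp add: assms(2))
qed

section \<open>The germs of the tacnodes\<close>

text \<open>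
  If the polynomial \<Phi> in w (of degree d, with coefficients polynomials in x) has the roots \<psi> j x,
  then \<open>tac d n \<Phi> L k\<close> is an equation of the union of the graphs
  y = (x^n * \<psi> j x - k x) / L x.
\<close>

definition tac :: "nat \<Rightarrow> nat \<Rightarrow> complex poly poly \<Rightarrow> complex poly \<Rightarrow> complex poly \<Rightarrow> complex poly poly" where
  "tac d n \<Phi> L k = (\<Sum>j\<le>d. [:coeff \<Phi> j:] * X2 ^ (n * (d - j)) * (Y2 * [:L:] + [:k:]) ^ j)"

lemma ev2_tac: "ev2 (tac d n \<Phi> L k) x y =
    (\<Sum>j\<le>d. poly (coeff \<Phi> j) x * x ^ (n * (d - j)) * (y * poly L x + poly k x) ^ j)"
  by (simp add: tac_def mult_ac)

lemma ev2_sum_coeffs: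
  assumes "degree \<Phi> \<le> d"
  shows "ev2 \<Phi> x w = (\<Sum>j\<le>d. poly (coeff \<Phi> j) x * w ^ j)"
proof -
  have "ev2 \<Phi> x w = (\<Sum>j\<le>degree \<Phi>. poly (coeff \<Phi> j) x * w ^ j)"
    unfolding ev2_alt by (rule poly_map_poly_expand) simp
  also have "\<dots> = (\<Sum>j\<le>d. poly (coeff \<Phi> j) x * w ^ j)"
    using assms by (intro sum.mono_neutral_left) (auto simp: coeff_eq_0)
  finally show ?thesis .
qed

lemma ev2_tac_root:
  assumes "degree \<Phi> \<le> d" "x \<noteq> 0"
  shows "ev2 (tac d n \<Phi> L k) x y = x ^ (n * d) * ev2 \<Phi> x ((y * poly L x + poly k x) / x ^ n)"
proof -
  have "x ^ (n * (d - j)) * z ^ j = x ^ (n * d) * (z / x ^ n) ^ j" if "j \<le> d" for j z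
  proof -
    have "x ^ (n * d) = x ^ (n * (d - j)) * x ^ (n * j)"
      using that by (simp flip: power_add add: diff_mult_distrib2)
    then show ?thesis using assms(2) by (simp add: power_divide power_mult)
  qed
  then show ?thesis
    by (simp add: ev2_tac ev2_sum_coeffs[OF assms(1)] sum_distrib_left mult.assoc mult.left_commute)
qed

lemma ev2_tac_0: "degree \<Phi> \<le> d \<Longrightarrow> ev2 (tac d 0 \<Phi> L k) x y = ev2 \<Phi> x (y * poly L x + poly k x)"
  by (simp add: ev2_tac ev2_sum_coeffs)

text \<open>On x = 0 the positive powers of x kill all terms with j < d. The d-th power that remains
  shows that all graphs pass through the same point.\<close>

lemma ev2_tac_Suc_0: "ev2 (tac d (Suc n) \<Phi> L k) 0 y = poly (coeff \<Phi> d) 0 * (y * poly L 0 + poly k 0) ^ d"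
proof -
  have "ev2 (tac d (Suc n) \<Phi> L k) 0 y =
      (\<Sum>j\<le>d. if j = d then poly (coeff \<Phi> d) 0 * (y * poly L 0 + poly k 0) ^ d else 0)"
    unfolding ev2_tac by (rule sum.cong) auto
  then show ?thesis by simp
qed

text \<open>The formula divides by x^n and is available only off x = 0. Multiplying both sides by
  \<open>X2\<close> makes them agree everywhere, and this factor cancels.\<close>

lemma tac_eqI:
  assumes deg: "degree \<Phi> \<le> d"
    and f: "\<And>x y. x \<noteq> 0 \<Longrightarrow> ev2 f x y = x ^ (n * d) * ev2 \<Phi> x ((y * poly L x + poly k x) / x ^ n)"
  shows "f = tac d n \<Phi> L k"
proof -
  have "X2 * f = X2 * tac d n \<Phi> L k"
  proof (rule ev2_eqI)
    fix x y show "ev2 (X2 * f) x y = ev2 (X2 * tac d n \<Phi> L k) x y"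
      using f[of x y] ev2_tac_root[OF deg, of x n L k y] by (cases "x = 0") simp_all
  qed
  moreover have "X2 \<noteq> 0" by (simp add: X2_def)
  ultimately show ?thesis by simp
qed

text \<open>By \<open>deg\<close> and \<open>lead\<close>, none of the d roots of
  \<open>\<Phi>\<close> escapes to infinity at x = 0; by \<open>simple\<close> they are distinct
  there. They are the initial values of the branches, and the condition on \<open>L\<close> keeps
  the graphs finite near 0.\<close>

locale tac_germ =
  fixes d :: nat and \<Phi> :: "complex poly poly" and L :: "complex poly"
  assumes d: "d \<ge> 1" and deg: "degree \<Phi> \<le> d" and lead: "poly (coeff \<Phi> d) 0 \<noteq> 0" and L: "poly L 0 \<noteq> 0"
    and simple: "\<And>w. ev2 \<Phi> 0 w = 0 \<Longrightarrow> ev2 (pderiv \<Phi>) 0 w \<noteq> 0"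
begin

lemma deg_0: "degree (map_poly (\<lambda>p. poly p 0) \<Phi>) = d"
proof (rule antisym)
  show "degree (map_poly (\<lambda>p. poly p 0) \<Phi>) \<le> d"
    using deg map_poly_degree_leq le_trans by blast
  show "d \<le> degree (map_poly (\<lambda>p. poly p 0) \<Phi>)"
    using lead by (intro le_degree) (simp add: coeff_map_poly)
qed

lemma ex_root: "\<exists>w. ev2 \<Phi> 0 w = 0"
  using Fundamental_Theorem_Algebra.fundamental_theorem_of_algebra[of "map_poly (\<lambda>p. poly p 0) \<Phi>"] deg_0 d
  by (simp add: ev2_alt constant_degree)

lemma ex_nonroot: "\<exists>w. ev2 \<Phi> 0 w \<noteq> 0"
  using deg_0 d unfolding ev2_alt by (metis degree_0 not_one_le_zero poly_all_0_iff_0)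

lemma tac_not_0: "\<exists>y. ev2 (tac d n \<Phi> L k) 0 y \<noteq> 0"
proof (cases n)
  case 0
  obtain w where "ev2 \<Phi> 0 w \<noteq> 0" using ex_nonroot by blast
  then show ?thesis
    using L 0 deg by (intro exI[of _ "(w - poly k 0) / poly L 0"]) (simp add: ev2_tac_0)
next
  case (Suc m)
  then show ?thesis
    using L lead by (intro exI[of _ "(1 - poly k 0) / poly L 0"]) (simp add: ev2_tac_Suc_0)
qed

text \<open>The constant coefficient 0 in \<open>pCons 0 k\<close> lets the graphs pass through the
  origin. Blowing up divides their functions by x, which lowers the exponent of x by one and leaves
  \<open>k\<close>.\<close>

lemma ev2_tac_Some:
  "ev2 (tac d (Suc n) \<Phi> L (pCons 0 k)) x (x * y) = x ^ d * ev2 (tac d n \<Phi> L k) x y"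
proof -
  have "x ^ (Suc n * (d - j)) * (x * y * poly L x + poly (pCons 0 k) x) ^ j =
      x ^ d * (x ^ (n * (d - j)) * (y * poly L x + poly k x) ^ j)" if "j \<le> d" for j
  proof -
    have "x * y * poly L x + poly (pCons 0 k) x = x * (y * poly L x + poly k x)"
      by (simp add: algebra_simps)
    moreover have "x ^ d = x ^ (d - j) * x ^ j" using that by (simp flip: power_add)
    ultimately show ?thesis by (simp add: power_mult_distrib power_add)
  qed
  then show ?thesis
    by (simp only: ev2_tac sum_distrib_left mult.assoc) (simp add: mult.left_commute)
qed

lemma mult0_tac: "mult0 (tac d (Suc n) \<Phi> L (pCons 0 k)) = d"
  using tac_not_0 mult0_eqI[OF ev2_tac_Some] by blast

text \<open>Moving the origin of the chart to y = t subtracts t from the functions, that is, adds t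
  L to k. So the family \<open>tac\<close> is stable under blow-up.\<close>

lemma strict_tac_Some:
  "strict (tac d (Suc n) \<Phi> L (pCons 0 k)) (Some t) = tac d n \<Phi> L (smult t L + k)"
  unfolding strict_Some[OF ev2_tac_Some mult0_tac]
  by (rule ev2_eqI) (simp add: ev2_tac algebra_simps)

text \<open>The branches are graphs over x, so none is tangent to x = 0: at the origin of this chart
  the proper transform has the value \<open>poly (coeff \<Phi> d) 0 * poly L 0 ^ d\<close>.\<close>

lemma mult0_strict_tac_None: "mult0 (strict (tac d (Suc n) \<Phi> L (pCons 0 k)) None) = 0"
proof -
  define s where "s p = eval2 const2 [:p:] (X2 * Y2) 0" for p
  have s: "ev2 (s p) x y = poly p (x * y)" for p x y
    by (simp add: s_def)
  \<comment> \<open>In this chart the power of x contributes y^((n+1)(d-j)) and the j-th power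
    contributes y^j; removing y^d leaves y^(n(d-j)).\<close>
  define h where "h = (\<Sum>j\<le>d. s (coeff \<Phi> j) * X2 ^ (Suc n * (d - j)) * Y2 ^ (n * (d - j)) * (s L + X2 * s k) ^ j)"
  have h: "ev2 h x y = (\<Sum>j\<le>d. poly (coeff \<Phi> j) (x * y) * x ^ (Suc n * (d - j)) * y ^ (n * (d - j)) *
      (poly L (x * y) + x * poly k (x * y)) ^ j)" for x y
    unfolding h_def by (simp only: ev2_simps ev2_X2 ev2_Y2 s)
  have "ev2 (tac d (Suc n) \<Phi> L (pCons 0 k)) (x * y) y = y ^ d * ev2 h x y" for x y
  proof -
    have "(x * y) ^ (Suc n * (d - j)) * (y * poly L (x * y) + poly (pCons 0 k) (x * y)) ^ j =
        y ^ d * (x ^ (Suc n * (d - j)) * y ^ (n * (d - j)) * (poly L (x * y) + x * poly k (x * y)) ^ j)"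
      if "j \<le> d" for j
    proof -
      have "y * poly L (x * y) + poly (pCons 0 k) (x * y) = y * (poly L (x * y) + x * poly k (x * y))"
        by (simp add: algebra_simps)
      moreover have "y ^ d = y ^ (d - j) * y ^ j" using that by (simp flip: power_add)
      ultimately show ?thesis by (simp add: power_mult_distrib power_add)
    qed
    then show ?thesis
      by (simp only: ev2_tac h sum_distrib_left mult.assoc) (simp add: mult.left_commute)
  qed
  then have "strict (tac d (Suc n) \<Phi> L (pCons 0 k)) None = h"
    by (rule strict_None) (rule mult0_tac)
  moreover have "ev2 h 0 0 = (\<Sum>j\<le>d. if j = d then poly (coeff \<Phi> d) 0 * poly L 0 ^ d else 0)"
    unfolding h by (rule sum.cong) auto
  ultimately show ?thesis
    using lead L by (intro mult0_eq_0) simp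
qed

lemma pderiv_tac_0: "ev2 (pderiv (tac d 0 \<Phi> L k)) 0 0 = ev2 (pderiv \<Phi>) 0 (poly k 0) * poly L 0"
proof -
  have "((\<lambda>y. ev2 (tac d 0 \<Phi> L k) 0 y) has_field_derivative ev2 (pderiv (tac d 0 \<Phi> L k)) 0 0) (at 0)"
    using ev2_has_field_derivative[OF DERIV_const DERIV_ident, of _ 0 0] by simp
  moreover have "((\<lambda>y. ev2 \<Phi> 0 (y * poly L 0 + poly k 0)) has_field_derivative
      ev2 (pderiv \<Phi>) 0 (0 * poly L 0 + poly k 0) * poly L 0) (at 0)"
    by (rule ev2_has_field_derivative[OF DERIV_const, THEN DERIV_cong])
      (auto intro!: derivative_eq_intros)
  ultimately show ?thesis
    by (simp add: ev2_tac_0[OF deg] DERIV_unique)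
qed

text \<open>For n = 0 the branches are separated, because the roots of \<open>\<Phi>\<close> at x =
  0 are simple: the germ is smooth or empty.\<close>

lemma mult0_tac_0_le_1: "mult0 (tac d 0 \<Phi> L k) \<le> 1"
proof (cases "ev2 \<Phi> 0 (poly k 0) = 0")
  case True
  then show ?thesis using simple L by (intro mult0_le_1) (simp add: pderiv_tac_0)
next
  case False
  then show ?thesis using mult0_eq_0[of "tac d 0 \<Phi> L k"] by (simp add: ev2_tac_0[OF deg])
qed

lemma mult0_tac_0_eq_1: "ev2 \<Phi> 0 (poly k 0) = 0 \<Longrightarrow> mult0 (tac d 0 \<Phi> L k) = 1"
  using simple L by (intro mult0_eq_1) (simp_all add: pderiv_tac_0 ev2_tac_0[OF deg])

text \<open>Each blow-up lowers n by one but also changes k, hence the induction over arbitrary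
  k.\<close>

lemma germ_type_tac_Suc:
  assumes "d > 1"
  shows "germ_type (tac d (Suc n) \<Phi> L (pCons 0 k)) (replicate (Suc n) d)"
proof (induction n arbitrary: k)
  case 0
  obtain w where w: "ev2 \<Phi> 0 w = 0" using ex_root by blast
  \<comment> \<open>At the last blow-up the curve meets the exceptional curve in d smooth points.
    Any of them serves as the point that the rule \<open>blowup\<close> asks for; this is the one of
    the root w.\<close>
  define t where "t = (w - poly k 0) / poly L 0"
  have "mult0 (tac d 0 \<Phi> L (smult t L + k)) = 1"
    using w L by (intro mult0_tac_0_eq_1) (simp add: t_def)
  then have "germ_type (strict (tac d (Suc 0) \<Phi> L (pCons 0 k)) (Some t)) []"
    unfolding strict_tac_Some by (rule germ_type.smooth)
  moreover have "mult0 (strict (tac d (Suc 0) \<Phi> L (pCons 0 k)) e) \<le> 1" for e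
  proof (cases e)
    case None
    then show ?thesis using mult0_strict_tac_None[of 0 k] by simp
  next
    case (Some t)
    then show ?thesis using mult0_tac_0_le_1 by (simp only: strict_tac_Some)
  qed
  ultimately have "germ_type (tac d (Suc 0) \<Phi> L (pCons 0 k)) (d # [])"
    using assms mult0_tac by (intro germ_type.blowup[where e = "Some t"]) auto
  then show ?case by simp
next
  case (Suc n)
  \<comment> \<open>The only direction in which the new k again vanishes at 0, that is, the common
    tangent of the branches. The proper transform misses all other directions.\<close>
  define t where "t = - poly k 0 / poly L 0"
  have eq0: "poly (smult s L + k) 0 = 0 \<longleftrightarrow> s = t" for s
    using L by (auto simp: t_def field_simps add_eq_0_iff)
  then obtain k' where k': "smult t L + k = pCons 0 k'"
    by (metis pCons_cases poly_pCons mult_zero_left add_0_right)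
  have "germ_type (strict (tac d (Suc (Suc n)) \<Phi> L (pCons 0 k)) (Some t)) (replicate (Suc n) d)"
    unfolding strict_tac_Some k' by (rule Suc.IH)
  moreover have "mult0 (strict (tac d (Suc (Suc n)) \<Phi> L (pCons 0 k)) e) = 0" if "e \<noteq> Some t" for e
  proof (cases e)
    case None
    then show ?thesis using mult0_strict_tac_None[of "Suc n" k] by simp
  next
    case (Some s)
    then have "s \<noteq> t" using that by simp
    then show ?thesis
      unfolding Some strict_tac_Some using lead eq0[of s]
      by (intro mult0_eq_0) (simp add: ev2_tac_Suc_0)
  qed
  ultimately have "germ_type (tac d (Suc (Suc n)) \<Phi> L (pCons 0 k)) (d # replicate (Suc n) d)"
    using assms mult0_tac by (intro germ_type.blowup[where e = "Some t"]) auto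
  then show ?case by simp
qed

text \<open>For d = 1 the germ is smooth and \<open>type_of\<close> removes every entry; for larger
  d it removes none.\<close>

lemma germ_type_tac:
  assumes n: "n \<ge> 1" and k: "poly k 0 = 0"
  shows "germ_type (tac d n \<Phi> L k) (type_of (replicate n d))"
proof -
  obtain m k' where eq: "n = Suc m" "k = pCons 0 k'"
    using n k by (metis pCons_cases poly_pCons mult_zero_left add_0_right Suc_le_D One_nat_def)
  show ?thesis
  proof (cases "d = 1")
    case True
    then have "germ_type (tac d n \<Phi> L k) []"
      unfolding eq by (intro germ_type.smooth) (use mult0_tac in simp)
    then show ?thesis using True by (simp add: type_of_def filter_replicate)
  next
    case False
    then have "d > 1" using d by simp
    then show ?thesis
      using germ_type_tac_Suc[of m k'] by (simp add: eq type_of_def)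
  qed
qed

end

section \<open>Holomorphic roots\<close>

lemma ev2_coeffs: "ev2 f x y = (\<Sum>j\<le>degree f. poly (coeff f j) x * y ^ j)"
  by (rule ev2_sum_coeffs) simp

lemma tendsto_ev2:
  assumes "(x \<longlongrightarrow> a) net" "(y \<longlongrightarrow> b) net"
  shows "((\<lambda>t. ev2 f (x t) (y t)) \<longlongrightarrow> ev2 f a b) net"
  unfolding ev2_coeffs by (intro tendsto_intros tendsto_poly assms)

lemma holomorphic_on_ev2:
  assumes "g holomorphic_on S" "h holomorphic_on S"
  shows "(\<lambda>t. ev2 f (g t) (h t)) holomorphic_on S"
proof (induction f)
  case (pCons p f)
  have "(\<lambda>t. poly p (g t)) holomorphic_on S"
    by (induction p) (auto intro!: holomorphic_intros assms)
  then show ?case using pCons.IH assms by (auto intro!: holomorphic_intros)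
qed simp

text \<open>Newton's iteration with the slope frozen at the initial point converges uniformly in x.\<close>

lemma holomorphic_root:
  assumes root: "ev2 \<Phi> 0 w0 = 0" and simple: "ev2 (pderiv \<Phi>) 0 w0 \<noteq> 0"
  obtains r \<psi> where "r > 0" "\<psi> holomorphic_on ball 0 r" "\<psi> 0 = w0"
    "\<And>x. x \<in> ball 0 r \<Longrightarrow> ev2 \<Phi> x (\<psi> x) = 0"
proof -
  define D where "D = ev2 (pderiv \<Phi>) 0 w0"
  have D: "D \<noteq> 0" using simple by (simp add: D_def)
  define N where "N = (\<lambda>x w. w - ev2 \<Phi> x w / D)"
  have "((\<lambda>p. ev2 (pderiv \<Phi>) (fst p) (snd p)) \<longlongrightarrow> D) (nhds (0, w0))"
    unfolding D_def by (rule tendsto_ev2) (auto intro!: tendsto_eq_intros filterlim_ident)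
  then have "\<forall>\<^sub>F p in nhds (0, w0). dist (ev2 (pderiv \<Phi>) (fst p) (snd p)) D < norm D / 2"
    using D by (intro tendstoD) auto
  then obtain \<delta> where \<delta>: "\<delta> > 0" and
    close: "\<And>p. dist p (0, w0) < \<delta> \<Longrightarrow> dist (ev2 (pderiv \<Phi>) (fst p) (snd p)) D < norm D / 2"
    unfolding eventually_nhds_metric by blast
  define \<epsilon> where "\<epsilon> = \<delta> / 3"
  have \<epsilon>: "\<epsilon> > 0" using \<delta> by (simp add: \<epsilon>_def)
  have contr: "norm (N x w - N x w') \<le> 1/2 * norm (w - w')"
    if "norm x < \<epsilon>" "w \<in> cball w0 \<epsilon>" "w' \<in> cball w0 \<epsilon>" for x w w'
  proof (rule field_differentiable_bound[OF convex_cball _ _ that(2,3)])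
    fix v assume v: "v \<in> cball w0 \<epsilon>"
    have deriv: "((\<lambda>v. ev2 \<Phi> x v) has_field_derivative ev2 (pderiv \<Phi>) x v) (at v)"
      using ev2_has_field_derivative[OF DERIV_const DERIV_ident, of \<Phi> x v] by simp
    show "(N x has_field_derivative (1 - ev2 (pderiv \<Phi>) x v / D)) (at v within cball w0 \<epsilon>)"
      unfolding N_def
      by (rule has_field_derivative_at_within) (auto intro!: derivative_eq_intros deriv simp: D)
    have "dist (x, v) (0, w0) \<le> norm x + norm (v - w0)"
      using norm_Pair_le[of x "v - w0"] by (simp add: dist_norm)
    also have "\<dots> < \<delta>"
      using that(1) v \<delta> by (auto simp: \<epsilon>_def dist_norm norm_minus_commute)
    finally have "norm (ev2 (pderiv \<Phi>) x v - D) < norm D / 2"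
      using close[of "(x, v)"] by (simp add: dist_norm)
    moreover have "1 - ev2 (pderiv \<Phi>) x v / D = - (ev2 (pderiv \<Phi>) x v - D) / D"
      using D by (simp add: field_simps)
    ultimately show "norm (1 - ev2 (pderiv \<Phi>) x v / D) \<le> 1 / 2"
      using D by (simp add: norm_divide norm_minus_commute field_simps)
  qed
  have "((\<lambda>x. ev2 \<Phi> x w0) \<longlongrightarrow> 0) (nhds 0)"
    using tendsto_ev2[where f = \<Phi> and net = "nhds 0" and x = "\<lambda>x. x" and a = 0 and y = "\<lambda>_. w0" and b = w0]
    by (simp add: root filterlim_ident)
  \<comment> \<open>With this bound the first Newton step moves w0 by at most \<epsilon> / 2, and
    the contraction by 1/2 accounts for the other half, so that the disc is mapped to
    itself.\<close>
  then have "\<forall>\<^sub>F x in nhds 0. dist (ev2 \<Phi> x w0) 0 < norm D * \<epsilon> / 2"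
    using D \<epsilon> by (intro tendstoD) auto
  then obtain \<eta> where \<eta>: "\<eta> > 0" and start: "\<And>x. norm x < \<eta> \<Longrightarrow> norm (ev2 \<Phi> x w0) < norm D * \<epsilon> / 2"
    unfolding eventually_nhds_metric by auto
  define r where "r = min \<epsilon> \<eta>"
  have r: "r > 0" using \<epsilon> \<eta> by (simp add: r_def)
  have maps: "N x w \<in> cball w0 \<epsilon>" if "norm x < r" "w \<in> cball w0 \<epsilon>" for x w
  proof -
    have "norm (N x w - N x w0) \<le> 1/2 * norm (w - w0)"
      using that \<epsilon> by (intro contr) (auto simp: r_def)
    moreover have "norm (w - w0) \<le> \<epsilon>" using that by (simp add: dist_norm norm_minus_commute)
    moreover have "norm (N x w0 - w0) \<le> \<epsilon> / 2"
      using start[of x] that D by (simp add: r_def N_def norm_divide field_simps)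
    moreover have "norm (N x w - w0) \<le> norm (N x w - N x w0) + norm (N x w0 - w0)"
      using norm_triangle_ineq[of "N x w - N x w0" "N x w0 - w0"] by simp
    ultimately show ?thesis by (simp add: dist_norm norm_minus_commute)
  qed
  have fix1: "\<exists>!w. w \<in> cball w0 \<epsilon> \<and> N x w = w" if "norm x < r" for x
    using Banach_fix[of "cball w0 \<epsilon>" "1/2" "N x"] that maps[of x] contr[of x] \<epsilon>
    by (auto simp: complete_eq_closed dist_norm r_def image_subset_iff)
  define \<psi> where "\<psi> = (\<lambda>x. THE w. w \<in> cball w0 \<epsilon> \<and> N x w = w)"
  have \<psi>: "\<psi> x \<in> cball w0 \<epsilon>" "N x (\<psi> x) = \<psi> x" if "norm x < r" for x
    using theI'[OF fix1[OF that]] by (auto simp: \<psi>_def)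
  \<comment> \<open>The fixed point is defined for each x separately. Its holomorphy comes from the
    iterates, which are holomorphic in x and converge to it uniformly.\<close>
  define f where "f = (\<lambda>n x. (N x ^^ n) w0)"
  have f_mem: "f n x \<in> cball w0 \<epsilon>" if "norm x < r" for n x
    by (induction n) (use that \<epsilon> maps in \<open>auto simp: f_def\<close>)
  have f_close: "norm (f n x - \<psi> x) \<le> (1/2) ^ n * \<epsilon>" if "norm x < r" for n x
  proof (induction n)
    case 0
    then show ?case using \<psi>(1)[OF that] by (simp add: f_def dist_norm)
  next
    case (Suc n)
    have "norm (f (Suc n) x - \<psi> x) = norm (N x (f n x) - N x (\<psi> x))"
      using \<psi>(2)[OF that] by (simp add: f_def)
    also have "\<dots> \<le> 1/2 * norm (f n x - \<psi> x)"
      using f_mem[OF that] \<psi>(1)[OF that] that by (intro contr) (auto simp: r_def)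
    finally show ?case using Suc by simp
  qed
  have holo: "\<psi> holomorphic_on ball 0 r"
  proof (rule holomorphic_uniform_sequence[where f = f])
    show "f n holomorphic_on ball 0 r" for n
    proof (induction n)
      case (Suc n)
      then show ?case
        unfolding f_def N_def using D
        by (auto intro!: holomorphic_intros holomorphic_on_ev2 holomorphic_on_ident)
    qed (simp add: f_def)
    fix x :: complex assume x: "x \<in> ball 0 r"
    then obtain e where e: "e > 0" "cball x e \<subseteq> ball 0 r"
      using open_ball open_contains_cball[of "ball 0 r"] by blast
    have "(\<lambda>n. (1/2::real) ^ n * \<epsilon>) \<longlonglongrightarrow> 0"
      by (intro tendsto_mult_left_zero LIMSEQ_power_zero) simp
    then have "uniform_limit (cball x e) f \<psi> sequentially"
      unfolding uniform_limit_iff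
    proof (intro allI impI)
      fix \<kappa> :: real assume "\<kappa> > 0"
      have "\<forall>\<^sub>F n in sequentially. (1/2::real) ^ n * \<epsilon> < \<kappa>"
        using \<open>(\<lambda>n. (1/2::real) ^ n * \<epsilon>) \<longlonglongrightarrow> 0\<close> \<open>\<kappa> > 0\<close> by (rule order_tendstoD(2))
      then show "\<forall>\<^sub>F n in sequentially. \<forall>x\<in>cball x e. dist (f n x) (\<psi> x) < \<kappa>"
      proof eventually_elim
        case (elim n)
        show ?case
        proof
          fix y assume "y \<in> cball x e"
          then have "norm y < r" using e(2) by auto
          then show "dist (f n y) (\<psi> y) < \<kappa>"
            using f_close[of y n] elim by (simp add: dist_norm)
        qed
      qed
    qed
    then show "\<exists>e. 0 < e \<and> cball x e \<subseteq> ball 0 r \<and> uniform_limit (cball x e) f \<psi> sequentially"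
      using e by blast
  qed simp
  have "\<psi> 0 = w0"
  proof -
    have "N 0 w0 = w0" by (simp add: N_def root)
    then show ?thesis
      unfolding \<psi>_def using r \<epsilon> by (intro the1_equality[OF fix1]) simp_all
  qed
  moreover have "ev2 \<Phi> x (\<psi> x) = 0" if "x \<in> ball 0 r" for x
    using \<psi>(2)[of x] that D by (simp add: N_def)
  ultimately show thesis using that r holo by blast
qed

text \<open>Among the derivatives of x^n at 0 up to order n only the last is nonzero, so Leibniz's
  rule has at most one term. Applied to the difference of two graphs, this gives their exact order
  of contact.\<close>

lemma higher_deriv_power_mult:
  assumes u: "u holomorphic_on S" and S: "open S" "0 \<in> S" and m: "m \<le> n"
  shows "(deriv ^^ m) (\<lambda>x. x ^ n * u x) 0 = (if m = n then fact n * u 0 else 0)"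
proof -
  have pow: "(deriv ^^ i) (\<lambda>x::complex. x ^ n) 0 = (if i = n then fact n else 0)" if "i \<le> n" for i
    using higher_deriv_power[of i 0 n 0] that by (auto simp: pochhammer_fact)
  have "(deriv ^^ m) (\<lambda>x. x ^ n * u x) 0 =
      (\<Sum>i=0..m. of_nat (m choose i) * (deriv ^^ i) (\<lambda>x. x ^ n) 0 * (deriv ^^ (m - i)) u 0)"
    by (rule higher_deriv_mult[OF _ u S]) (auto intro!: holomorphic_intros)
  also have "\<dots> = (\<Sum>i=0..m. if i = m then (if m = n then fact n * u 0 else 0) else 0)"
    using m by (intro sum.cong) (auto simp: pow)
  finally show ?thesis by simp
qed

lemma eventually_ne_0:
  assumes "f holomorphic_on ball 0 r" "r > 0" "f 0 \<noteq> 0"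
  shows "\<forall>\<^sub>F x in nhds (0::complex). f x \<noteq> (0::complex)"
proof -
  have "isCont f 0"
    using assms(1,2) by (meson centre_in_ball continuous_on_eq_continuous_at holomorphic_on_imp_continuous_on open_ball)
  then have "(f \<longlongrightarrow> f 0) (nhds 0)"
    by (simp add: isCont_def tendsto_nhds_iff)
  then show ?thesis using assms(3) by (rule tendsto_imp_eventually_ne)
qed

lemma holomorphic_on_poly: "poly p holomorphic_on S"
  by (induction p) (auto intro!: holomorphic_intros simp: fun_eq_iff)

lemma poly_ne_0_near: "poly p 0 \<noteq> 0 \<Longrightarrow> \<forall>\<^sub>F x in nhds (0::complex). poly p x \<noteq> 0"
  using eventually_ne_0[of "poly p" 1] holomorphic_on_poly by auto

context tac_germ
begin

lemma card_roots: "card {w. ev2 \<Phi> 0 w = 0} = d"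
proof -
  define p where "p = map_poly (\<lambda>p. poly p 0) \<Phi>"
  have ev: "ev2 \<Phi> 0 w = poly p w" for w by (simp add: ev2_alt p_def)
  have "pderiv p = map_poly (\<lambda>p. poly p 0) (pderiv \<Phi>)"
    by (rule poly_eqI) (simp add: p_def coeff_pderiv coeff_map_poly rhom_mult[OF rhom_poly_at] of_nat_poly)
  then have "rsquarefree p"
    using simple by (auto simp: rsquarefree_roots ev2_alt p_def)
  then have "smult (lead_coeff p) (\<Prod>z|poly p z = 0. [:-z, 1:]) = p"
    by (rule complex_poly_decompose_rsquarefree)
  moreover have "p \<noteq> 0" using deg_0 d by (auto simp: p_def)
  ultimately have "degree p = degree (\<Prod>z|poly p z = 0. [:-z, 1:])"
    by (metis degree_smult_eq leading_coeff_0_iff)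
  also have "\<dots> = card {z. poly p z = 0}"
    by (subst degree_prod_eq_sum_degree) simp_all
  finally show ?thesis using deg_0 by (simp add: ev p_def)
qed

text \<open>Each root at x = 0 extends to a branch by \<open>holomorphic_root\<close>. The d
  branches keep distinct values near 0, and a nonzero polynomial of degree at most d has no room for
  a further root.\<close>

lemma local_roots:
  obtains r \<psi> where "r > 0"
    "\<And>j. j < d \<Longrightarrow> \<psi> j holomorphic_on ball 0 r"
    "inj_on (\<lambda>j. \<psi> j 0) {..<d}"
    "\<And>x. x \<in> ball 0 r \<Longrightarrow> poly L x \<noteq> 0"
    "\<And>x w. x \<in> ball 0 r \<Longrightarrow> ev2 \<Phi> x w = 0 \<longleftrightarrow> (\<exists>j<d. w = \<psi> j x)"
proof -
  obtain \<omega> where \<omega>: "bij_betw \<omega> {..<d} {w. ev2 \<Phi> 0 w = 0}"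
    using ex_bij_betw_nat_finite[of "{w. ev2 \<Phi> 0 w = 0}"] card_roots d
    by (metis atLeast0LessThan card.infinite not_one_le_zero)
  have root: "ev2 \<Phi> 0 (\<omega> j) = 0" if "j < d" for j
    using bij_betwE[OF \<omega>] that by auto
  have "\<exists>r \<psi>. r > 0 \<and> \<psi> holomorphic_on ball 0 r \<and> \<psi> 0 = \<omega> j \<and> (\<forall>x\<in>ball 0 r. ev2 \<Phi> x (\<psi> x) = 0)"
    if "j < d" for j
    using holomorphic_root[OF root[OF that] simple[OF root[OF that]]] by metis
  then obtain \<rho> \<psi> where \<psi>: "\<And>j. j < d \<Longrightarrow> \<rho> j > 0" "\<And>j. j < d \<Longrightarrow> \<psi> j holomorphic_on ball 0 (\<rho> j)"
      "\<And>j. j < d \<Longrightarrow> \<psi> j 0 = \<omega> j" "\<And>j x. j < d \<Longrightarrow> x \<in> ball 0 (\<rho> j) \<Longrightarrow> ev2 \<Phi> x (\<psi> j x) = 0"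
    by metis
  define r0 where "r0 = Min (\<rho> ` {..<d})"
  have r0: "r0 > 0" "\<And>j. j < d \<Longrightarrow> r0 \<le> \<rho> j"
    using \<psi>(1) d by (auto simp: r0_def Min_gr_iff lessThan_empty_iff)
  have holo: "\<psi> j holomorphic_on ball 0 r0" if "j < d" for j
    by (rule holomorphic_on_subset[OF \<psi>(2)[OF that]]) (use r0(2)[OF that] in auto)
  have inj: "inj_on (\<lambda>j. \<psi> j 0) {..<d}"
    using bij_betw_imp_inj_on[OF \<omega>] \<psi>(3) by (auto simp: inj_on_def)
  have "\<forall>\<^sub>F x in nhds 0. \<psi> i x - \<psi> j x \<noteq> 0" if "i < d" "j < d" "i \<noteq> j" for i j
    using that inj holo r0(1)
    by (intro eventually_ne_0[of _ r0] holomorphic_intros) (auto simp: inj_on_def)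
  then have "\<forall>\<^sub>F x in nhds 0. \<forall>i\<in>{..<d}. \<forall>j\<in>{..<d}. i \<noteq> j \<longrightarrow> \<psi> i x - \<psi> j x \<noteq> 0"
    by (intro eventually_ball_finite ballI finite_lessThan) (auto simp: eventually_mono)
  then have "\<forall>\<^sub>F x in nhds 0. (\<forall>i\<in>{..<d}. \<forall>j\<in>{..<d}. i \<noteq> j \<longrightarrow> \<psi> i x - \<psi> j x \<noteq> 0) \<and>
      poly L x \<noteq> 0 \<and> poly (coeff \<Phi> d) x \<noteq> 0"
    using L lead by (intro eventually_conj poly_ne_0_near)
  then obtain r1 where r1: "r1 > 0" and
    good: "\<And>x i j. norm x < r1 \<Longrightarrow> i < d \<Longrightarrow> j < d \<Longrightarrow> i \<noteq> j \<Longrightarrow> \<psi> i x \<noteq> \<psi> j x"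
      "\<And>x. norm x < r1 \<Longrightarrow> poly L x \<noteq> 0" "\<And>x. norm x < r1 \<Longrightarrow> poly (coeff \<Phi> d) x \<noteq> 0"
    unfolding eventually_nhds_metric by auto
  show thesis
  proof (rule that[of "min r0 r1" \<psi>])
    fix x w :: complex assume "x \<in> ball 0 (min r0 r1)"
    then have x: "norm x < r0" "norm x < r1" by auto
    show "ev2 \<Phi> x w = 0 \<longleftrightarrow> (\<exists>j<d. w = \<psi> j x)"
    proof
      assume w: "ev2 \<Phi> x w = 0"
      define p where "p = map_poly (\<lambda>p. poly p x) \<Phi>"
      have p: "poly p w = ev2 \<Phi> x w" for w by (simp add: p_def ev2_alt)
      have "coeff p d \<noteq> 0" using good(3)[OF x(2)] by (simp add: p_def coeff_map_poly)
      then have p0: "p \<noteq> 0" by auto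
      have dp: "degree p \<le> d" unfolding p_def using deg map_poly_degree_leq le_trans by blast
      have "inj_on (\<lambda>j. \<psi> j x) {..<d}" using good(1)[OF x(2)] by (auto simp: inj_on_def)
      then have c: "card ((\<lambda>j. \<psi> j x) ` {..<d}) = d" by (simp add: card_image)
      have sub: "(\<lambda>j. \<psi> j x) ` {..<d} \<subseteq> {w. poly p w = 0}"
        using \<psi>(4) x(1) r0(2) by (force simp: p)
      have "(\<lambda>j. \<psi> j x) ` {..<d} = {w. poly p w = 0}"
        using card_seteq[OF poly_roots_finite[OF p0] sub] card_poly_roots_bound[OF p0] dp c by simp
      then show "\<exists>j<d. w = \<psi> j x" using w p by auto
    next
      assume "\<exists>j<d. w = \<psi> j x"
      then obtain j where "j < d" "w = \<psi> j x" by auto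
      then show "ev2 \<Phi> x w = 0" using \<psi>(4)[of j x] r0(2)[of j] x by auto
    qed
  qed (use r0 r1 good holo inj in \<open>auto intro: holomorphic_on_subset[OF holo]\<close>)
qed

text \<open>Two graphs differ by x^n times \<open>(\<psi> i x - \<psi> j x) / poly L x\<close>,
  which does not vanish at 0. So the derivatives agree up to order n - 1 and differ at order
  n.\<close>

lemma germ_tacnode_tac:
  assumes n: "n \<ge> 1" and k: "poly k 0 = 0"
  shows "germ_tacnode d (n - 1) (tac d n \<Phi> L k)"
proof -
  obtain r \<psi> where r: "r > 0" and holo: "\<And>j. j < d \<Longrightarrow> \<psi> j holomorphic_on ball 0 r"
    and inj: "inj_on (\<lambda>j. \<psi> j 0) {..<d}" and L': "\<And>x. x \<in> ball 0 r \<Longrightarrow> poly L x \<noteq> 0"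
    and roots: "\<And>x w. x \<in> ball 0 r \<Longrightarrow> ev2 \<Phi> x w = 0 \<longleftrightarrow> (\<exists>j<d. w = \<psi> j x)"
    by (rule local_roots) blast
  define \<phi> where "\<phi> = (\<lambda>j x. (x ^ n * \<psi> j x - poly k x) / poly L x)"
  have holo': "\<phi> j holomorphic_on ball 0 r" if "j < d" for j
    unfolding \<phi>_def using holo[OF that] L'
    by (auto intro!: holomorphic_intros holomorphic_on_poly[unfolded fun_eq_iff])
  have \<phi>0: "\<phi> j 0 = 0" for j using n k by (simp add: \<phi>_def)
  have zero: "ev2 (tac d n \<Phi> L k) x y = 0 \<longleftrightarrow> (\<exists>j<d. y = \<phi> j x)" if x: "x \<in> ball 0 r" for x y
  proof (cases "x = 0")
    case True
    obtain m where "n = Suc m" using n by (cases n) auto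
    moreover have "\<exists>j. j < d" using d by (auto intro: exI[of _ 0])
    ultimately show ?thesis using True lead L k d \<phi>0 by (auto simp: ev2_tac_Suc_0)
  next
    case False
    have "ev2 (tac d n \<Phi> L k) x y = 0 \<longleftrightarrow> (\<exists>j<d. (y * poly L x + poly k x) / x ^ n = \<psi> j x)"
      using False roots[OF x] by (simp add: ev2_tac_root[OF deg])
    also have "\<dots> \<longleftrightarrow> (\<exists>j<d. y = \<phi> j x)"
      using False L'[OF x] by (auto simp: \<phi>_def field_simps)
    finally show ?thesis .
  qed
  have diff: "(deriv ^^ m) (\<phi> i) 0 - (deriv ^^ m) (\<phi> j) 0 =
      (if m = n then fact n * ((\<psi> i 0 - \<psi> j 0) / poly L 0) else 0)"
    if ij: "i < d" "j < d" and m: "m \<le> n" for i j m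
  proof -
    have u: "(\<lambda>x. (\<psi> i x - \<psi> j x) / poly L x) holomorphic_on ball 0 r"
      using holo[OF ij(1)] holo[OF ij(2)] L' by (auto intro!: holomorphic_intros holomorphic_on_poly)
    have "(deriv ^^ m) (\<phi> i) 0 - (deriv ^^ m) (\<phi> j) 0 = (deriv ^^ m) (\<lambda>x. \<phi> i x - \<phi> j x) 0"
      using higher_deriv_diff[OF holo'[OF ij(1)] holo'[OF ij(2)], of 0 m] r by simp
    also have "(\<lambda>x. \<phi> i x - \<phi> j x) = (\<lambda>x. x ^ n * ((\<psi> i x - \<psi> j x) / poly L x))"
      by (simp add: \<phi>_def fun_eq_iff diff_divide_distrib[symmetric] algebra_simps)
    finally show ?thesis
      using higher_deriv_power_mult[OF u _ _ m] r by simp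
  qed
  show ?thesis
    unfolding germ_tacnode_def
  \<comment> \<open>The graphs already have the required form, so the linear change is the identity;
    \<open>zero\<close> holds for all y, so the disc for y may have radius 1.\<close>
  proof (rule exI[of _ 1], rule exI[of _ 0], rule exI[of _ 0], rule exI[of _ 1], rule exI[of _ \<phi>],
      rule exI[of _ r], rule exI[of _ 1], intro conjI)
    show "\<forall>i<d. \<forall>j<d. \<forall>m\<le>n - 1. (deriv ^^ m) (\<phi> i) 0 = (deriv ^^ m) (\<phi> j) 0"
    proof (intro allI impI)
      fix i j m assume ij: "i < d" "j < d" and "m \<le> n - 1"
      then have "m \<le> n" "m \<noteq> n" using n by linarith+
      then show "(deriv ^^ m) (\<phi> i) 0 = (deriv ^^ m) (\<phi> j) 0"
        using diff[of i j m] ij by simp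
    qed
    show "\<forall>i<d. \<forall>j<d. i \<noteq> j \<longrightarrow> (deriv ^^ Suc (n - 1)) (\<phi> i) 0 \<noteq> (deriv ^^ Suc (n - 1)) (\<phi> j) 0"
    proof (intro allI impI)
      fix i j assume ij: "i < d" "j < d" "i \<noteq> j"
      then have "\<psi> i 0 \<noteq> \<psi> j 0" using inj by (auto simp: inj_on_def)
      then show "(deriv ^^ Suc (n - 1)) (\<phi> i) 0 \<noteq> (deriv ^^ Suc (n - 1)) (\<phi> j) 0"
        using diff[of i j n] ij n L by (auto simp del: funpow.simps)
    qed
  qed (use r holo' \<phi>0 zero in auto)
qed

end

section \<open>Restrictions of forms to pencils of lines\<close>

lemma coeff_mult_top:
  assumes "degree p \<le> m" "degree q \<le> n"
  shows "coeff (p * q) (m + n) = coeff p m * coeff q n"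
proof -
  have "coeff p i * coeff q (m + n - i) = 0" if "i \<noteq> m" for i
  proof (cases "i > m")
    case True
    then show ?thesis using assms(1) by (simp add: coeff_eq_0)
  next
    case False
    then have "m + n - i > n" using that by simp
    then show ?thesis using assms(2) by (simp add: coeff_eq_0)
  qed
  then have "coeff (p * q) (m + n) = (\<Sum>i\<le>m + n. if i = m then coeff p m * coeff q n else 0)"
    unfolding coeff_mult by (intro sum.cong) auto
  then show ?thesis by simp
qed

text \<open>A leading coefficient relative to a bound n for the degree: as \<open>a\<close> may be
  0, sums and products are covered without case distinctions.\<close>

definition top_coeff :: "nat \<Rightarrow> 'a::comm_ring_1 poly \<Rightarrow> 'a \<Rightarrow> bool" where
  "top_coeff n p a \<longleftrightarrow> degree p \<le> n \<and> coeff p n = a"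

lemma top_coeff_mult: "top_coeff m p a \<Longrightarrow> top_coeff n q b \<Longrightarrow> top_coeff (m + n) (p * q) (a * b)"
  unfolding top_coeff_def using coeff_mult_top degree_mult_le by (metis add_mono le_trans)

lemma top_coeff_power:
  assumes "degree p \<le> 1" shows "top_coeff n (p ^ n) (coeff p 1 ^ n)"
proof (induction n)
  case (Suc n)
  have "top_coeff 1 p (coeff p 1)" using assms by (simp add: top_coeff_def)
  from top_coeff_mult[OF this Suc] show ?case by simp
qed (simp add: top_coeff_def)

lemma top_coeff_sum:
  "finite A \<Longrightarrow> (\<And>i. i \<in> A \<Longrightarrow> top_coeff n (p i) (a i)) \<Longrightarrow> top_coeff n (sum p A) (sum a A)"
  unfolding top_coeff_def by (auto simp: coeff_sum intro: degree_sum_le)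

lemma eval3_expand_flat:
  assumes h: "rhom h"
  shows "eval3 h F x y z =
    (\<Sum>k\<le>degree F. \<Sum>j\<le>degree (coeff F k). \<Sum>i\<le>degree (coeff (coeff F k) j).
       h (coeff (coeff (coeff F k) j) i) * (x ^ i * (y ^ j * z ^ k)))"
  unfolding eval3_expand[OF h] by (simp add: sum_distrib_right mult.assoc)

text \<open>Every monomial of F becomes a product of d factors of degree at most 1 in the outer
  variable w, so the coefficient of w^d is F at the slopes. It supplies \<open>lead\<close> for
  \<open>tac_germ\<close>.\<close>

lemma top_coeff_eval3:
  assumes F: "form d F" and deg: "degree P \<le> 1" "degree Q \<le> 1" "degree R \<le> 1"
  shows "top_coeff d (eval3 const2 F P Q R) (eval3 (\<lambda>c. [:c:]) F (coeff P 1) (coeff Q 1) (coeff R 1))"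
  unfolding eval3_expand_flat[OF rhom_const2] eval3_expand_flat[OF rhom_const1]
proof (intro top_coeff_sum finite_atMost)
  fix k j i
  show "top_coeff d (const2 (coeff (coeff (coeff F k) j) i) * (P ^ i * (Q ^ j * R ^ k)))
    ([:coeff (coeff (coeff F k) j) i:] * (coeff P 1 ^ i * (coeff Q 1 ^ j * coeff R 1 ^ k)))"
  proof (cases "coeff (coeff (coeff F k) j) i = 0")
    case True
    then show ?thesis by (simp add: const2_def top_coeff_def)
  next
    case False
    then have d: "d = 0 + (i + (j + k))" using F[unfolded form_def, rule_format, OF False] by simp
    have "top_coeff 0 (const2 c) [:c:]" for c by (simp add: top_coeff_def const2_def)
    then show ?thesis
      unfolding d using deg by (intro top_coeff_mult top_coeff_power)
  qed
qed

text \<open>For fixed x the arguments move along a line as w varies, so the derivative in w is the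
  differential of F in the direction of the slopes. Thus transversality yields simple roots.\<close>

lemma pderiv_eval3:
  assumes PQR: "P = [:p0, p1:]" "Q = [:q0, q1:]" "R = [:r0, r1:]"
  shows "ev2 (pderiv (eval3 const2 F P Q R)) x w =
    grad_dot F (vector [ev2 P x w, ev2 Q x w, ev2 R x w]) (vector [poly p1 x, poly q1 x, poly r1 x])"
proof -
  have "((\<lambda>w. ev3 F (vector [ev2 P x w, ev2 Q x w, ev2 R x w])) has_field_derivative
      grad_dot F (vector [ev2 P x w, ev2 Q x w, ev2 R x w]) (vector [poly p1 x, poly q1 x, poly r1 x])) (at w)"
  proof (rule ev3_has_field_derivative)
    fix i :: 3
    show "((\<lambda>w. (vector [ev2 P x w, ev2 Q x w, ev2 R x w] :: complex^3) $ i) has_field_derivative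
        (vector [poly p1 x, poly q1 x, poly r1 x] :: complex^3) $ i) (at w)"
      using exhaust_3[of i] unfolding PQR by (auto intro!: derivative_eq_intros)
  qed
  moreover have "((\<lambda>w. ev2 (eval3 const2 F P Q R) x w) has_field_derivative
      ev2 (pderiv (eval3 const2 F P Q R)) x w) (at w)"
    using ev2_has_field_derivative[OF DERIV_const DERIV_ident, of _ x w] by (simp del: ev2_eval3)
  ultimately show ?thesis by (simp add: DERIV_unique)
qed

section \<open>The transformed curve in normal form\<close>

definition fib :: "complex^2 \<Rightarrow> complex poly poly" where
  "fib c = [:[:0, c$2:], [:- (c$1):]:]"

lemma ev2_fib: "ev2 (fib c) x y = c$2 * x - c$1 * y"
  by (simp add: fib_def algebra_simps)

lemma fiber_form_fib: "fiber_form c s = ev2 (fib c) (s$1) (s$2)"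
  by (simp add: fiber_form_def ev2_fib)

lemma fib_scale: "ev2 (fib c) (t * x) (t * y) = t * ev2 (fib c) x y"
  by (simp add: ev2_fib algebra_simps)

lemma fib_eq_0_iff:
  fixes c :: "complex^2"
  assumes "c \<noteq> 0"
  shows "ev2 (fib c) x y = 0 \<longleftrightarrow> (\<exists>t. x = t * c$1 \<and> y = t * c$2)"
proof
  assume *: "ev2 (fib c) x y = 0"
  show "\<exists>t. x = t * c$1 \<and> y = t * c$2"
  proof (cases "c$1 = 0")
    case True
    then have "c$2 \<noteq> 0" using assms by (auto simp: vec_eq_iff forall_2)
    then show ?thesis using * True by (intro exI[of _ "y / c$2"]) (simp add: ev2_fib)
  next
    case False
    then show ?thesis using * by (intro exI[of _ "x / c$1"]) (simp add: ev2_fib field_simps)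
  qed
qed (auto simp: ev2_fib)

text \<open>On the path b + t c the form \<open>fib b\<close> takes the value t, so t is a local
  parameter of the pencil at b.\<close>

lemma ex_dual:
  fixes b :: "complex^2"
  assumes "b \<noteq> 0"
  obtains c :: "complex^2" where "b$2 * c$1 - b$1 * c$2 = 1"
proof (cases "b$2 = 0")
  case True
  then have "b$1 \<noteq> 0" using assms by (auto simp: vec_eq_iff forall_2)
  then show thesis using True by (intro that[of "vector [0, - 1 / b$1]"]) simp
next
  case False
  then show thesis by (intro that[of "vector [1 / b$2, 0]"]) simp
qed

text \<open>
  The point O is [0:0:1], and bs and b are the points of the base of the pencil that belong to the lines
  Q_i and P.
\<close>

locale normal_form =
  fixes F :: "complex poly poly poly" and d :: nat and ns :: "nat list"
    and bs :: "(complex^2) list" and b :: "complex^2" and g :: "complex poly poly"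
    and N :: nat and q :: "complex poly poly"
  defines "N \<equiv> sum_list ns" and "q \<equiv> (\<Prod>i<length bs. fib (bs ! i) ^ (ns ! i))"
  assumes F: "form d F" "irreducible F" and smooth: "\<And>v. v \<noteq> 0 \<Longrightarrow> ev3 F v = 0 \<Longrightarrow> grad F v \<noteq> 0"
    and d: "d \<ge> 1" and apex: "e3 F 0 0 1 \<noteq> 0"
    and ns: "length ns = length bs" "ns \<noteq> []" "\<And>n. n \<in> set ns \<Longrightarrow> n \<ge> 1"
    and nonzero: "\<And>c. c \<in> set (b # bs) \<Longrightarrow> c \<noteq> 0"
    and b_bs: "\<And>i. i < length bs \<Longrightarrow> ev2 (fib (bs ! i)) (b$1) (b$2) \<noteq> 0"
    and bs_bs: "\<And>i j. i < length bs \<Longrightarrow> j < length bs \<Longrightarrow> i \<noteq> j \<Longrightarrow>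
      ev2 (fib (bs ! i)) (bs!j$1) (bs!j$2) \<noteq> 0"
    and trans: "\<And>c \<alpha> \<beta> \<alpha>' \<beta>'. c \<in> set (b # bs) \<Longrightarrow> \<alpha> * \<beta>' - \<alpha>' * \<beta> \<noteq> 0 \<Longrightarrow>
      e3 F (\<alpha> * c$1) (\<alpha> * c$2) \<beta> = 0 \<Longrightarrow>
      grad_dot F (vector [\<alpha> * c$1, \<alpha> * c$2, \<beta>]) (vector [\<alpha>' * c$1, \<alpha>' * c$2, \<beta>']) \<noteq> 0"
    and g: "\<And>t x y. ev2 g (t * x) (t * y) = t ^ (N + 1) * ev2 g x y"
    and center: "e3 F (b$1 * ev2 q (b$1) (b$2)) (b$2 * ev2 q (b$1) (b$2)) (ev2 g (b$1) (b$2)) \<noteq> 0"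
begin

abbreviation "l \<equiv> fib b"

definition G :: "complex poly poly poly" where
  "G = eval3 const3 F [:X2 * q:] [:Y2 * q:] [:g, l ^ N:]"

lemma e3_G: "e3 G x y z = e3 F (x * ev2 q x y) (y * ev2 q x y) (z * ev2 l x y ^ N + ev2 g x y)"
  by (simp add: G_def algebra_simps)

lemma ev2_q: "ev2 q x y = (\<Prod>i<length bs. ev2 (fib (bs ! i)) x y ^ (ns ! i))"
  by (simp add: q_def)

lemma N_pos: "N \<ge> 1"
proof -
  obtain n ns' where "ns = n # ns'" using ns(2) by (cases ns) auto
  then show ?thesis using ns(3)[of n] by (simp add: N_def)
qed

lemma N_sum: "N = (\<Sum>i<length bs. ns ! i)"
  using ns(1) by (simp add: N_def sum_list_sum_nth atLeast0LessThan)

lemma q_scale: "ev2 q (t * x) (t * y) = t ^ N * ev2 q x y"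
  by (simp add: ev2_q fib_scale power_mult_distrib prod.distrib N_sum power_sum)

lemma q_eq_0D:
  assumes "ev2 q x y = 0"
  obtains i t where "i < length bs" "x = t * bs!i$1" "y = t * bs!i$2"
proof -
  obtain i where "i < length bs" "ev2 (fib (bs ! i)) x y = 0"
    using assms by (auto simp: ev2_q)
  then show thesis
    using that fib_eq_0_iff[of "bs ! i" x y] nonzero[of "bs ! i"] by auto
qed

lemma q_b: "ev2 q (b$1) (b$2) \<noteq> 0"
  using b_bs by (simp add: ev2_q)

lemma l_bs: "i < length bs \<Longrightarrow> ev2 l (bs!i$1) (bs!i$2) \<noteq> 0"
  using b_bs[of i] by (simp add: ev2_fib algebra_simps)

text \<open>On the path with direction c through the base point of Q_i, q is x^n times a factor
  \<open>r\<close> that does not vanish at 0, where n = n_i. Taking x^n out of all three arguments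
  of the homogeneous F leaves the shape of \<open>tac\<close>.\<close>

lemma tacnode_germ:
  assumes i: "i < length bs" and c: "ev2 (fib (bs ! i)) (c$1) (c$2) = 1"
    and t: "ev2 g (bs!i$1) (bs!i$2) + t * ev2 l (bs!i$1) (bs!i$2) ^ N = 0"
    and f: "\<And>x y. ev2 f x y = e3 G (bs!i$1 + x * c$1) (bs!i$2 + x * c$2) (y + t)"
  shows "germ_tacnode d (ns ! i - 1) f" "germ_type f (type_of (replicate (ns ! i) d))"
proof -
  define n where "n = ns ! i"
  have n: "n \<ge> 1" using i ns by (simp add: n_def)
  define s1 where "s1 = [:bs!i$1, c$1:]"
  define s2 where "s2 = [:bs!i$2, c$2:]"
  define on where "on = (\<lambda>f. eval2 (\<lambda>c. [:c:]) f s1 s2)"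
  have on: "poly (on f) x = ev2 f (poly s1 x) (poly s2 x)" for f x by (simp add: on_def)
  have s0: "poly s1 0 = bs!i$1" "poly s2 0 = bs!i$2" by (simp_all add: s1_def s2_def)
  define r where "r = on (\<Prod>j\<in>{..<length bs} - {i}. fib (bs ! j) ^ (ns ! j))"
  have qr: "ev2 q (poly s1 x) (poly s2 x) = x ^ n * poly r x" for x
  proof -
    have "ev2 (fib (bs ! i)) (poly s1 x) (poly s2 x) = x * ev2 (fib (bs ! i)) (c$1) (c$2)"
      by (simp add: s1_def s2_def ev2_fib algebra_simps)
    then show ?thesis
      unfolding ev2_q using i c
      by (subst prod.remove[of _ i]) (simp_all add: n_def r_def on)
  qed
  have r0: "poly r 0 \<noteq> 0"
    using bs_bs i by (simp add: r_def on s0)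
  define L where "L = on (l ^ N)"
  \<comment> \<open>Then y L + k is the third argument (y + t) l^N + g of F, and the choice of t
    means k(0) = 0.\<close>
  define k where "k = on g + smult t L"
  define \<Phi> where "\<Phi> = eval3 const2 F [:r * s1:] [:r * s2:] [:0, 1:]"
  have top: "top_coeff d \<Phi> (eval3 (\<lambda>c. [:c:]) F 0 0 1)"
    unfolding \<Phi>_def using top_coeff_eval3[OF F(1), of "[:r * s1:]" "[:r * s2:]" "[:0, 1:]"] by simp
  interpret tac_germ d \<Phi> L
  proof
    show "1 \<le> d" by (rule d)
    show "degree \<Phi> \<le> d" using top by (simp add: top_coeff_def)
    have "poly (coeff \<Phi> d) 0 = e3 F 0 0 1"
      using top by (simp add: top_coeff_def)
    then show "poly (coeff \<Phi> d) 0 \<noteq> 0" using apex by simp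
    show "poly L 0 \<noteq> 0" using l_bs[OF i] by (simp add: L_def on s0)
    fix w assume "ev2 \<Phi> 0 w = 0"
    then have "e3 F (poly r 0 * bs!i$1) (poly r 0 * bs!i$2) w = 0"
      by (simp add: \<Phi>_def s0)
    then show "ev2 (pderiv \<Phi>) 0 w \<noteq> 0"
      unfolding \<Phi>_def
      using trans[of "bs ! i" "poly r 0" 1 0 w] r0 i
        pderiv_eval3[of "[:r * s1:]" "r * s1" 0 "[:r * s2:]" "r * s2" 0 "[:0, 1:]" 0 1 F 0 w]
      by (simp add: s0)
  qed
  have f_tac: "f = tac d n \<Phi> L k"
  proof (rule tac_eqI[OF deg])
    fix x y :: complex assume x: "x \<noteq> 0"
    have "ev2 f x y = e3 F (x ^ n * (poly r x * poly s1 x)) (x ^ n * (poly r x * poly s2 x))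
        (x ^ n * ((y * poly L x + poly k x) / x ^ n))"
      using x qr[of x] by (simp add: f e3_G k_def L_def on) (simp add: s1_def s2_def algebra_simps)
    also have "\<dots> = (x ^ n) ^ d * ev2 \<Phi> x ((y * poly L x + poly k x) / x ^ n)"
      by (simp only: form_scale[OF rhom_id F(1)]) (simp add: \<Phi>_def)
    finally show "ev2 f x y = x ^ (n * d) * ev2 \<Phi> x ((y * poly L x + poly k x) / x ^ n)"
      by (simp add: power_mult)
  qed
  have k: "poly k 0 = 0" using t by (simp add: k_def L_def on s0)
  show "germ_tacnode d (ns ! i - 1) f"
    using germ_tacnode_tac[OF n k] by (simp add: f_tac n_def)
  show "germ_type f (type_of (replicate (ns ! i) d))"
    using germ_type_tac[OF n k] by (simp add: f_tac n_def)
qed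

text \<open>With x along c and y along b, l equals x. The initial form is F(0, 0, l^N), a multiple
  of x^(d N), so the only tangent direction is that of P, the chart at \<open>None\<close>. There
  the proper transform is again a \<open>tac\<close>.\<close>

lemma blow_down_germ:
  assumes c: "ev2 l (c$1) (c$2) = 1"
    and f: "\<And>x y. ev2 f x y = e3 G (x * c$1 + y * b$1) (x * c$2 + y * b$2) 1"
  shows "germ_blow_down_tacnode d (N - 1) f" "germ_type f (type_of (d * N # replicate N d))"
proof -
  define s1 where "s1 = [:b$1, c$1:]"
  define s2 where "s2 = [:b$2, c$2:]"
  define on where "on = (\<lambda>f. eval2 (\<lambda>c. [:c:]) f s1 s2)"
  have on: "poly (on f) x = ev2 f (poly s1 x) (poly s2 x)" for f x by (simp add: on_def)
  have s0: "poly s1 0 = b$1" "poly s2 0 = b$2" by (simp_all add: s1_def s2_def)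
  have scale: "e3 F (y ^ N * u) (y ^ N * v) (y ^ N * w) = y ^ (d * N) * e3 F u v w" for y u v w
    by (simp only: form_scale[OF rhom_id F(1)]) (simp add: power_mult[symmetric] mult.commute)
  have G_scale: "e3 G (y * x1) (y * x2) 1 =
      y ^ (d * N) * e3 F (y * x1 * ev2 q x1 x2) (y * x2 * ev2 q x1 x2) (ev2 l x1 x2 ^ N + y * ev2 g x1 x2)"
    for y x1 x2
    unfolding scale[symmetric] 
    by (simp add: e3_G fib_scale q_scale g power_mult_distrib distrib_left mult.assoc mult.left_commute)
  \<comment> \<open>The chart at \<open>Some 0\<close> contains all directions other than that of P.
    On the exceptional curve x = 0 the quotient has the constant value F(0, 0, 1).\<close>
  define h0 where "h0 = (let u = const2 (c$1) + Y2 * const2 (b$1); v = const2 (c$2) + Y2 * const2 (b$2)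
    in eval3 const2 F (X2 * u * eval2 const2 q u v) (X2 * v * eval2 const2 q u v) (1 + X2 * eval2 const2 g u v))"
  have f_h0: "ev2 f x (x * y) = x ^ (d * N) * ev2 h0 x y" for x y
  proof -
    have "ev2 l (c$1 + y * b$1) (c$2 + y * b$2) = 1"
      using c by (simp add: ev2_fib algebra_simps)
    then show ?thesis
      using G_scale[of x "c$1 + y * b$1" "c$2 + y * b$2"] by (simp add: f h0_def Let_def algebra_simps)
  qed
  have h0: "ev2 h0 0 y \<noteq> 0" for y using apex by (simp add: h0_def Let_def)
  have mult: "mult0 f = d * N"
    by (rule mult0_eqI[OF f_h0 h0])
  define h where "h = eval3 const2 F (Y2 * [:s1 * on q:]) (Y2 * [:s2 * on q:]) (X2 ^ N + Y2 * [:on g:])"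
  have ev2_h: "ev2 h x y = e3 F (y * (poly s1 x * poly (on q) x)) (y * (poly s2 x * poly (on q) x)) (x ^ N + y * poly (on g) x)" for x y
    unfolding h_def by (simp add: mult.commute)
  have f_h: "ev2 f (x * y) y = y ^ (d * N) * ev2 h x y" for x y
  proof -
    have "ev2 l (poly s1 x) (poly s2 x) = x * ev2 l (c$1) (c$2)"
      by (simp add: s1_def s2_def ev2_fib algebra_simps)
    moreover have "ev2 f (x * y) y = e3 G (y * poly s1 x) (y * poly s2 x) 1"
      by (simp add: f s1_def s2_def algebra_simps)
    ultimately show ?thesis
      using c by (simp add: G_scale ev2_h on mult.assoc)
  qed
  have strict_h: "strict f None = h"
    by (rule strict_None[OF f_h mult])
  have strict_Some: "mult0 (strict f (Some t)) = 0" for t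
    unfolding strict_Some[OF f_h0 mult] by (rule mult0_eq_0) (simp add: h0)
  \<comment> \<open>After x^N is taken out, the arguments of F in \<open>h\<close> depend on x and w
    = y / x^N alone. The coefficient of w^d at x = 0 is F(b q, g), nonzero by
    \<open>center\<close>.\<close>
  define \<Phi> where "\<Phi> = eval3 const2 F [:0, s1 * on q:] [:0, s2 * on q:] [:1, on g:]"
  have top: "top_coeff d \<Phi> (eval3 (\<lambda>c. [:c:]) F (s1 * on q) (s2 * on q) (on g))"
    unfolding \<Phi>_def
    using top_coeff_eval3[OF F(1), of "[:0, s1 * on q:]" "[:0, s2 * on q:]" "[:1, on g:]"] by simp
  interpret tac_germ d \<Phi> 1
  proof
    show "1 \<le> d" by (rule d)
    show "degree \<Phi> \<le> d" using top by (simp add: top_coeff_def)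
    show "poly (coeff \<Phi> d) 0 \<noteq> 0"
      using top center by (simp add: top_coeff_def on s0)
    show "poly 1 0 \<noteq> (0::complex)" by simp
    fix w assume w: "ev2 \<Phi> 0 w = 0"
    define qb gb where "qb = ev2 q (b$1) (b$2)" and "gb = ev2 g (b$1) (b$2)"
    have "e3 F (w * qb * b$1) (w * qb * b$2) (1 + w * gb) = 0"
      using w by (simp add: \<Phi>_def s0 on qb_def gb_def mult_ac)
    \<comment> \<open>The determinant in \<open>trans\<close>, equal to - qb, for the point at w and
      the direction (qb b, gb) in which it moves with w.\<close>
    moreover have "(w * qb) * gb - qb * (1 + w * gb) \<noteq> 0"
      using q_b by (simp add: qb_def algebra_simps)
    ultimately show "ev2 (pderiv \<Phi>) 0 w \<noteq> 0"
      unfolding \<Phi>_def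
      using trans[of b "w * qb" gb qb "1 + w * gb"]
      pderiv_eval3[of "[:0, s1 * on q:]" 0 "s1 * on q" "[:0, s2 * on q:]" 0 "s2 * on q"
          "[:1, on g:]" 1 "on g" F 0 w]
      by (simp add: s0 on qb_def gb_def mult_ac)
  qed
  have h_tac: "h = tac d N \<Phi> 1 0"
  proof (rule tac_eqI[OF deg])
    fix x y :: complex assume x: "x \<noteq> 0"
    define w where "w = y / x ^ N"
    have "ev2 h x y = e3 F (x ^ N * (w * (poly s1 x * poly (on q) x))) (x ^ N * (w * (poly s2 x * poly (on q) x)))
        (x ^ N * (1 + w * poly (on g) x))"
      using x by (simp add: ev2_h w_def algebra_simps)
    also have "\<dots> = x ^ (d * N) * ev2 \<Phi> x w"
      by (simp only: scale) (simp add: \<Phi>_def)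
    finally show "ev2 h x y = x ^ (N * d) * ev2 \<Phi> x ((y * poly 1 x + poly 0 x) / x ^ N)"
      by (simp add: mult.commute w_def)
  qed
  have others: "mult0 (strict f e) = 0" if "e \<noteq> None" for e
    using that strict_Some by auto
  have "germ_tacnode d (N - 1) (strict f None)"
    unfolding strict_h h_tac by (rule germ_tacnode_tac[OF N_pos]) simp
  then show "germ_blow_down_tacnode d (N - 1) f"
    unfolding germ_blow_down_tacnode_def using others by blast
  have h_type: "germ_type (strict f None) (type_of (replicate N d))"
    unfolding strict_h h_tac by (rule germ_type_tac[OF N_pos]) simp
  show "germ_type f (type_of (d * N # replicate N d))"
  proof (cases "d * N > 1")
    case True
    have "germ_type f (d * N # type_of (replicate N d))"
      by (rule germ_type.blowup[OF True mult h_type]) (simp add: others)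
    then show ?thesis using True by (simp add: type_of_def)
  next
    \<comment> \<open>Only d = N = 1 is left: the image is smooth at O and \<open>type_of\<close>
      empties the list.\<close>
    case False
    then have "d = 1" "N = 1" using d N_pos by (auto simp: not_less le_Suc_eq mult_eq_1_iff)
    then show ?thesis
      using germ_type.smooth[of f] mult by (simp add: type_of_def)
  qed
qed

end

section \<open>Global properties of the transformed curve\<close>

text \<open>Only the third variable receives a polynomial that involves z, so a bound for the degree
  in z survives the substitution.\<close>

definition subst_z :: "complex poly poly poly \<Rightarrow> complex poly poly \<Rightarrow> complex poly poly \<Rightarrow>
    complex poly poly poly \<Rightarrow> complex poly poly poly" where
  "subst_z H U V W = pcompose (map_poly (\<lambda>f. eval2 const2 f U V) H) W"

lemma e3_subst_z [simp]:
  "e3 (subst_z H U V W) x y z = e3 H (ev2 U x y) (ev2 V x y) (e3 W x y z)"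
proof -
  have "eval2 const2 0 U V = 0" by (rule rhom_0[OF rhom_eval2[OF rhom_const2]])
  then have "subst_z (pCons f H) U V W = [:eval2 const2 f U V:] + W * subst_z H U V W" for f H
    by (simp add: subst_z_def map_poly_pCons pcompose_pCons)
  moreover have "subst_z 0 U V W = 0" by (simp add: subst_z_def)
  ultimately show ?thesis by (induction H) simp_all
qed

lemma degree_subst_z: "degree W \<le> 1 \<Longrightarrow> degree (subst_z H U V W) \<le> degree H"
proof -
  assume W: "degree W \<le> 1"
  have "degree (subst_z H U V W) \<le> degree (map_poly (\<lambda>f. eval2 const2 f U V) H) * degree W"
    unfolding subst_z_def by (rule degree_pcompose_le)
  also have "\<dots> \<le> degree H * 1"
    using W map_poly_degree_leq by (intro mult_le_mono)
  finally show ?thesis by simp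
qed

lemma poly_no_root_const:
  assumes "\<And>x. poly p x \<noteq> (0 :: complex)"
  obtains c where "p = [:c:]" "c \<noteq> 0"
proof -
  have "degree p = 0"
    using fundamental_theorem_of_algebra[of p] assms by (auto simp: constant_degree)
  then obtain c where "p = [:c:]" by (rule degree_eq_zeroE)
  with assms show thesis using that by auto
qed

text \<open>For x \<noteq> 0 the polynomial in y has no root and is constant, so its higher
  coefficients vanish for all x \<noteq> 0, hence identically. What remains depends on x alone and
  has no root, as the points (x, 1) show.\<close>

lemma only_zero_at_origin:
  assumes nz: "\<And>x y. (x, y) \<noteq> (0, 0) \<Longrightarrow> ev2 K x y \<noteq> 0"
  obtains c where "K = [:[:c:]:]" "c \<noteq> 0"
proof -
  have coeff0: "coeff K (Suc j) = 0" for j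
  proof -
    have "poly (coeff K (Suc j)) x = 0" if "x \<noteq> 0" for x
    proof -
      have "\<And>y. poly (map_poly (\<lambda>p. poly p x) K) y \<noteq> 0"
        using nz that by (simp flip: ev2_alt)
      then obtain c where "map_poly (\<lambda>p. poly p x) K = [:c:]"
        by (rule poly_no_root_const)
      then have "coeff (map_poly (\<lambda>p. poly p x) K) (Suc j) = 0" by simp
      then show ?thesis by (simp add: coeff_map_poly)
    qed
    then have "poly ([:0, 1:] * coeff K (Suc j)) x = 0" for x by (cases "x = 0") simp_all
    then have "[:0, 1:] * coeff K (Suc j) = 0" using poly_all_0_iff_0 by blast
    then show ?thesis by simp
  qed
  have K: "K = [:coeff K 0:]"
    by (rule poly_eqI) (simp add: coeff_pCons coeff0 split: nat.splits)
  have "ev2 K x 1 = poly (coeff K 0) x" for x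
    by (subst K) simp
  then have "poly (coeff K 0) x \<noteq> 0" for x
    using nz[of x 1] by simp
  then obtain c where "coeff K 0 = [:c:]" "c \<noteq> 0" by (rule poly_no_root_const)
  then show thesis using K that by metis
qed

lemma eventually_poly_ne_0:
  assumes "p \<noteq> (0 :: complex poly)"
  shows "\<forall>\<^sub>F t in at a. poly p t \<noteq> 0"
proof -
  have "closed ({t. poly p t = 0} - {a})"
    using poly_roots_finite[OF assms] by (intro finite_imp_closed) auto
  then have "open (- ({t. poly p t = 0} - {a}))" by blast
  then show ?thesis
    unfolding eventually_at_topological by (rule exI[of _ "- ({t. poly p t = 0} - {a})", OF conjI]) auto
qed

context normal_form
begin

text \<open>The coefficient of w^d is F(0, 0, 1), whatever x and y are: no intersection with a line
  of the pencil is lost at O.\<close>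

lemma F_pencil:
  obtains p where "\<And>w. poly p w = e3 F x y w" "degree p = d"
proof -
  define \<Phi> where "\<Phi> = eval3 const2 F [:[:x:]:] [:[:y:]:] [:0, 1:]"
  have top: "top_coeff d \<Phi> (eval3 (\<lambda>c. [:c:]) F 0 0 1)"
    unfolding \<Phi>_def using top_coeff_eval3[OF F(1), of "[:[:x:]:]" "[:[:y:]:]" "[:0, 1:]"] by simp
  define p where "p = map_poly (\<lambda>p. poly p 0) \<Phi>"
  have "poly p w = e3 F x y w" for w
    unfolding p_def ev2_alt[symmetric] by (simp add: \<Phi>_def)
  moreover have "degree p = d"
  proof (rule antisym)
    show "degree p \<le> d"
      unfolding p_def using top by (intro le_trans[OF map_poly_degree_leq]) (simp add: top_coeff_def)
    show "d \<le> degree p"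
      using apex top by (intro le_degree) (simp add: p_def coeff_map_poly top_coeff_def)
  qed
  ultimately show thesis by (rule that)
qed

lemma ex_F_root: "\<exists>w. e3 F x y w = 0"
proof -
  obtain p where "\<And>w. poly p w = e3 F x y w" "degree p = d" by (rule F_pencil[of x y]) blast
  then show ?thesis
    using fundamental_theorem_of_algebra[of p] d by (auto simp: constant_degree)
qed

lemma ex_F_nonroot: "\<exists>w. e3 F x y w \<noteq> 0"
proof -
  obtain p where p: "\<And>w. poly p w = e3 F x y w" "degree p = d" by (rule F_pencil[of x y]) blast
  have "p \<noteq> 0" using p(2) d by auto
  then show ?thesis using p(1) poly_all_0_iff_0[of p] by auto
qed

lemma F_z_axis: "e3 F 0 0 z = 0 \<longleftrightarrow> z = 0"
  using form_on_z_axis[OF F(1), of z] apex d by auto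

lemma zero_pow_N: "(0::complex) ^ N = 0"
  using N_pos by (simp add: power_0_left)

lemma g_0_0: "ev2 g 0 0 = 0"
  using g[of 0 0 0] by simp

section \<open>The substitution and its inverse\<close>

lemma form_G: "form (d * (N + 1)) G"
proof (rule formI)
  fix x y z
  have "e3 G (2 * x) (2 * y) (2 * z) = e3 F (2 ^ (N + 1) * (x * ev2 q x y)) (2 ^ (N + 1) * (y * ev2 q x y))
      (2 ^ (N + 1) * (z * ev2 l x y ^ N + ev2 g x y))"
    by (simp add: e3_G q_scale fib_scale g power_mult_distrib distrib_left mult.assoc mult.left_commute)
  also have "\<dots> = (2 ^ (N + 1)) ^ d * e3 G x y z"
    by (simp only: form_scale[OF rhom_id F(1)] e3_G)
  finally show "e3 G (2 * x) (2 * y) (2 * z) = 2 ^ (d * (N + 1)) * e3 G x y z"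
    by (simp only: power_mult[symmetric] mult.commute)
qed

text \<open>T followed by the inverse substitution multiplies the coordinates by the common factor
  l^(N (N + 1)) q, and homogeneity of F brings out its d-th power.\<close>

lemma G_inverse:
  "e3 G (x * ev2 l x y ^ N) (y * ev2 l x y ^ N) (z * ev2 q x y - ev2 g x y) =
    (ev2 l x y ^ (N * (N + 1)) * ev2 q x y) ^ d * e3 F x y z"
proof -
  define lN where "lN = ev2 l x y ^ N"
  have s: "ev2 q (x * lN) (y * lN) = lN ^ N * ev2 q x y" "ev2 l (x * lN) (y * lN) = lN * ev2 l x y"
      "ev2 g (x * lN) (y * lN) = lN ^ (N + 1) * ev2 g x y"
    using q_scale[of lN x y] fib_scale[of b lN x y] g[of lN x y] by (simp_all add: mult.commute)
  have "ev2 l x y ^ (N * (N + 1)) = lN ^ (N + 1)"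
    by (simp only: lN_def power_mult)
  moreover have "e3 G (x * lN) (y * lN) (z * ev2 q x y - ev2 g x y) =
      e3 F (lN ^ (N + 1) * ev2 q x y * x) (lN ^ (N + 1) * ev2 q x y * y) (lN ^ (N + 1) * ev2 q x y * z)"
    unfolding e3_G s power_mult_distrib lN_def[symmetric] by (simp add: algebra_simps)
  ultimately show ?thesis
    by (simp only: form_scale[OF rhom_id F(1)] lN_def[symmetric])
qed

text \<open>The opposite composition, again the identity up to a common factor. It lifts points of G
  = 0 off the lines to points of F = 0.\<close>

lemma inverse_round_trip:
  assumes "x' = x * ev2 q x y" "y' = y * ev2 q x y" "z' = z * ev2 l x y ^ N + ev2 g x y"
    and "\<mu> = ev2 q x y ^ (N + 1) * ev2 l x y ^ N"
  shows "x' * ev2 l x' y' ^ N = \<mu> * x" "y' * ev2 l x' y' ^ N = \<mu> * y"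
    "z' * ev2 q x' y' - ev2 g x' y' = \<mu> * z"
proof -
  have s: "ev2 q x' y' = ev2 q x y ^ N * ev2 q x y" "ev2 l x' y' = ev2 q x y * ev2 l x y"
      "ev2 g x' y' = ev2 q x y ^ (N + 1) * ev2 g x y"
    unfolding assms
    using q_scale[of "ev2 q x y" x y] fib_scale[of b "ev2 q x y" x y] g[of "ev2 q x y" x y]
    by (simp_all add: mult.commute)
  show "x' * ev2 l x' y' ^ N = \<mu> * x" "y' * ev2 l x' y' ^ N = \<mu> * y"
    unfolding s by (simp_all add: assms power_mult_distrib)
  show "z' * ev2 q x' y' - ev2 g x' y' = \<mu> * z"
    unfolding s by (simp add: assms algebra_simps)
qed

text \<open>On l = 0 the variable z disappears, and G is a nonzero multiple of F at the point of P
  that goes to the first center. So the image meets l = 0 only in O.\<close>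

lemma G_on_P:
  assumes "(x, y) \<noteq> (0, 0)" "ev2 l x y = 0" shows "e3 G x y z \<noteq> 0"
proof -
  obtain t where t: "x = t * b$1" "y = t * b$2"
    using assms(2) fib_eq_0_iff[of b x y] nonzero[of b] by auto
  have t0: "t \<noteq> 0" using t assms(1) by auto
  have "e3 G x y z = e3 F (t ^ (N + 1) * (b$1 * ev2 q (b$1) (b$2))) (t ^ (N + 1) * (b$2 * ev2 q (b$1) (b$2)))
      (t ^ (N + 1) * ev2 g (b$1) (b$2))"
    unfolding e3_G assms(2) unfolding t q_scale g by (simp add: zero_pow_N mult_ac)
  then show ?thesis
    using center t0 by (simp only: form_scale[OF rhom_id F(1)]) simp
qed

text \<open>On q = 0 the first two arguments of F vanish, and F has no zero on the z axis but 0; so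
  the third argument vanishes too, which determines z.\<close>

lemma G_on_Q:
  assumes "(x, y) \<noteq> (0, 0)" "ev2 q x y = 0" "e3 G x y z = 0"
  obtains i t where "i < length bs" "t \<noteq> 0" "x = t * bs!i$1" "y = t * bs!i$2"
    "z = t * (- ev2 g (bs!i$1) (bs!i$2) / ev2 l (bs!i$1) (bs!i$2) ^ N)"
proof -
  obtain i t where t: "i < length bs" "x = t * bs!i$1" "y = t * bs!i$2"
    using q_eq_0D[OF assms(2)] by blast
  have t0: "t \<noteq> 0" using t assms(1) by auto
  have "z * ev2 l x y ^ N + ev2 g x y = 0"
    using assms(2,3) by (simp add: e3_G F_z_axis)
  then have "t ^ N * (z * ev2 l (bs!i$1) (bs!i$2) ^ N + t * ev2 g (bs!i$1) (bs!i$2)) = 0"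
    unfolding t(2,3) fib_scale g by (simp add: power_mult_distrib algebra_simps)
  then have "z * ev2 l (bs!i$1) (bs!i$2) ^ N + t * ev2 g (bs!i$1) (bs!i$2) = 0"
    using t0 by simp
  then have "z = t * (- ev2 g (bs!i$1) (bs!i$2) / ev2 l (bs!i$1) (bs!i$2) ^ N)"
    using l_bs[OF t(1)] by (simp add: field_simps eq_neg_iff_add_eq_0)
  with t t0 show thesis using that by blast
qed

text \<open>
  If G = H * K, then substituting the parametrization of \<open>G_inverse\<close> shows that the prime
  element F divides the image of H or of K, so this factor has the full degree in z. The other one does
  not involve z, and as G vanishes on no line through O, it has no zero besides the origin.
\<close>

lemma irreducible_G: "irreducible G"
proof -
  have degG: "degree G \<le> degree F"
  proof -
    have "G = subst_z F (X2 * q) (Y2 * q) [:g, l ^ N:]"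
      by (rule e3_eqI) (simp add: e3_G algebra_simps)
    then show ?thesis using degree_subst_z[of "[:g, l ^ N:]"] by (simp add: le_trans)
  qed
  have G_not_0: "\<exists>z. e3 G x y z \<noteq> 0" if xy: "(x, y) \<noteq> (0, 0)" for x y
  proof (cases "ev2 l x y = 0")
    case True
    then show ?thesis using G_on_P[OF xy] by blast
  next
    case False
    obtain w where "e3 F (x * ev2 q x y) (y * ev2 q x y) w \<noteq> 0" using ex_F_nonroot by blast
    then show ?thesis
      using False by (intro exI[of _ "(w - ev2 g x y) / ev2 l x y ^ N"]) (simp add: e3_G)
  qed
  have unit: "K dvd 1" if "G = H * K" and "degree K = 0" for H K
  proof -
    obtain K0 where K0: "K = [:K0:]" using \<open>degree K = 0\<close> by (rule degree_eq_zeroE)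
    have "ev2 K0 x y \<noteq> 0" if "(x, y) \<noteq> (0, 0)" for x y
      using G_not_0[OF that] unfolding \<open>G = H * K\<close> K0 by auto
    then obtain c where "K0 = [:[:c:]:]" "c \<noteq> 0" by (rule only_zero_at_origin)
    then show ?thesis by (simp add: K0 is_unit_const_poly_iff dvd_field_iff)
  qed
  have q0: "q \<noteq> 0" and l0: "l \<noteq> 0"
    using q_b l_bs[of 0] ns(1,2) by (auto simp flip: length_greater_0_conv)
  have half: "degree K = 0" if GHK: "G = H * K"
    and dvd: "F dvd subst_z H (X2 * l ^ N) (Y2 * l ^ N) [:- g, q:]"
    and nz: "subst_z H (X2 * l ^ N) (Y2 * l ^ N) [:- g, q:] \<noteq> 0" for H K
  proof -
    have "degree F \<le> degree (subst_z H (X2 * l ^ N) (Y2 * l ^ N) [:- g, q:])"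
      by (rule dvd_imp_degree_le[OF dvd nz])
    also have "\<dots> \<le> degree H" by (rule degree_subst_z) simp
    finally have "degree G \<le> degree H" using degG by simp
    moreover have "G \<noteq> 0" using G_not_0[of 1 0] by auto
    then have "degree G = degree H + degree K"
      using GHK by (auto simp: degree_mult_eq)
    ultimately show ?thesis by simp
  qed
  have prime: "prime_elem F" by (rule irreducible_imp_prime_elem_gcd[OF F(2)])
  show ?thesis
    unfolding irreducible_def
  proof (intro conjI allI impI)
    show "G \<noteq> 0" using G_not_0[of 1 0] by auto
    show "\<not> G dvd 1"
    proof
      assume "G dvd 1"
      then obtain H where "1 = G * H" by (auto simp: dvd_def)
      \<comment> \<open>G vanishes at O because l and g vanish at (0, 0) and N is positive, whereas
        a unit has no zero.\<close>
      from arg_cong[OF this, of "\<lambda>F. e3 F 0 0 1"] have "e3 G 0 0 1 \<noteq> 0" by auto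
      then show False using N_pos F_z_axis by (simp add: e3_G g_0_0 ev2_fib)
    qed
    fix H K assume GHK: "G = H * K"
    let ?s = "\<lambda>H. subst_z H (X2 * l ^ N) (Y2 * l ^ N) [:- g, q:]"
    have eq: "?s H * ?s K = [:(l ^ (N * (N + 1)) * q) ^ d:] * F"
    proof (rule e3_eqI)
      fix x y z
      have "e3 (?s H * ?s K) x y z = e3 G (x * ev2 l x y ^ N) (y * ev2 l x y ^ N) (z * ev2 q x y - ev2 g x y)"
        unfolding GHK by simp
      then show "e3 (?s H * ?s K) x y z = e3 ([:(l ^ (N * (N + 1)) * q) ^ d:] * F) x y z"
        by (simp add: G_inverse)
    qed
    moreover have "F \<noteq> 0" using F(2) by (simp add: irreducible_def)
    ultimately have nz: "?s H \<noteq> 0" "?s K \<noteq> 0"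
      using q0 l0 by (metis mult_zero_left mult_eq_0_iff pCons_eq_0_iff power_not_zero,
          metis mult_zero_right mult_eq_0_iff pCons_eq_0_iff power_not_zero)
    have "F dvd ?s H * ?s K" unfolding eq by (rule dvd_triv_right)
    then consider "F dvd ?s H" | "F dvd ?s K" using prime by (auto simp: prime_elem_dvd_mult_iff)
    then show "H dvd 1 \<or> K dvd 1"
    proof cases
      case 1
      then show ?thesis using unit[OF GHK] half[OF GHK _ nz(1)] by simp
    next
      case 2
      have "G = K * H" using GHK by (simp add: mult.commute)
      then show ?thesis using unit[of K H] half[of K H, OF _ 2 nz(2)] by simp
    qed
  qed
qed

text \<open>
  Since the lines are transversal, a point of the curve on one of them lies on a branch that leaves
  the line, so the curve is the closure of the complement of the lines.
\<close>

lemma vanishes_on_curve: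
  assumes K: "\<And>x y z. e3 F x y z = 0 \<Longrightarrow> ev2 q x y \<noteq> 0 \<Longrightarrow> ev2 l x y \<noteq> 0 \<Longrightarrow> e3 K x y z = 0"
    and v: "(x, y, z) \<noteq> (0, 0, 0)" "e3 F x y z = 0"
  shows "e3 K x y z = 0"
proof (cases "ev2 q x y \<noteq> 0 \<and> ev2 l x y \<noteq> 0")
  case False
  have xy: "(x, y) \<noteq> (0, 0)" using v F_z_axis by auto
  have "\<exists>c\<in>set (b # bs). ev2 (fib c) x y = 0"
    using False by (force simp: ev2_q intro: nth_mem)
  then obtain c where c: "c \<in> set (b # bs)" "ev2 (fib c) x y = 0" by blast
  then obtain \<alpha> where \<alpha>: "x = \<alpha> * c$1" "y = \<alpha> * c$2"
    using fib_eq_0_iff nonzero by blast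
  have \<alpha>0: "\<alpha> \<noteq> 0" using \<alpha> xy by auto
  obtain c' :: "complex^2" where c': "c$2 * c'$1 - c$1 * c'$2 = 1"
    using ex_dual[OF nonzero[OF c(1)]] by blast
  define s1 s2 where "s1 = [:x, c'$1:]" and "s2 = [:y, c'$2:]"
  define on where "on = (\<lambda>f. eval2 (\<lambda>c. [:c:]) f s1 s2)"
  have on: "poly (on f) t = ev2 f (poly s1 t) (poly s2 t)" for f t by (simp add: on_def)
  \<comment> \<open>The path starts at the nonzero point \<alpha> c and moves in the independent
    direction c', so no line of the pencil contains it.\<close>
  have on_fib: "on (fib e) \<noteq> 0" if e: "e \<in> set (b # bs)" for e
  proof
    assume 0: "on (fib e) = 0"
    have lin: "poly (on (fib e)) t = (e$2 * x - e$1 * y) + t * (e$2 * c'$1 - e$1 * c'$2)" for t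
      by (simp add: on ev2_fib s1_def s2_def algebra_simps)
    have "ev2 (fib e) x y = 0" "ev2 (fib e) (c'$1) (c'$2) = 0"
      using lin[of 0] lin[of 1] 0 by (simp_all add: ev2_fib)
    then obtain s t where "x = s * e$1" "y = s * e$2" "c'$1 = t * e$1" "c'$2 = t * e$2"
      using fib_eq_0_iff[OF nonzero[OF e]] by metis
    then have "y * c'$1 - x * c'$2 = 0" by simp
    moreover have "y * c'$1 - x * c'$2 = \<alpha> * (c$2 * c'$1 - c$1 * c'$2)"
      by (simp add: \<alpha> algebra_simps)
    ultimately show False using c' \<alpha>0 by simp
  qed
  \<comment> \<open>As \<open>m\<close> is a nonzero polynomial in t, the branch avoids all the
    lines for small t \<noteq> 0, where K vanishes; the limit at t = 0 gives the point
    itself.\<close>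
  define m where "m = on l * (\<Prod>i<length bs. on (fib (bs ! i)) ^ (ns ! i))"
  have m: "poly m t = ev2 l (poly s1 t) (poly s2 t) * ev2 q (poly s1 t) (poly s2 t)" for t
    by (simp add: m_def poly_prod on ev2_q)
  have "m \<noteq> 0" using on_fib by (auto simp: m_def)
  define \<Phi> where "\<Phi> = eval3 const2 F [:s1:] [:s2:] [:0, 1:]"
  have \<Phi>: "ev2 \<Phi> t w = e3 F (poly s1 t) (poly s2 t) w" for t w by (simp add: \<Phi>_def)
  have s0: "poly s1 0 = x" "poly s2 0 = y" by (simp_all add: s1_def s2_def)
  have "ev2 (pderiv \<Phi>) 0 z \<noteq> 0"
    unfolding \<Phi>_def
    using pderiv_eval3[of "[:s1:]" s1 0 "[:s2:]" s2 0 "[:0, 1:]" 0 1 F 0 z]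
      trans[OF c(1), of \<alpha> 1 0 z] \<alpha> \<alpha>0 v by (simp add: s0)
  then obtain r \<psi> where r: "r > 0" "\<psi> holomorphic_on ball 0 r" "\<psi> 0 = z"
      "\<And>t. t \<in> ball 0 r \<Longrightarrow> ev2 \<Phi> t (\<psi> t) = 0"
    using holomorphic_root[of \<Phi> z] v(2) by (auto simp: \<Phi> s0)
  have "isCont \<psi> 0"
    using r(1,2) by (meson centre_in_ball continuous_on_eq_continuous_at holomorphic_on_imp_continuous_on open_ball)
  then have \<psi>: "(\<psi> \<longlongrightarrow> z) (at 0)" by (simp add: isCont_def r(3))
  have s: "((\<lambda>t. poly s1 t) \<longlongrightarrow> x) (at 0)" "((\<lambda>t. poly s2 t) \<longlongrightarrow> y) (at 0)"
    using isContD[OF poly_isCont, of s1 0] isContD[OF poly_isCont, of s2 0] by (simp_all add: s0)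
  have "\<forall>\<^sub>F t in at 0. t \<in> ball 0 r"
    by (rule eventually_at_in_open') (use r(1) in auto)
  moreover have "\<forall>\<^sub>F t in at 0. poly m t \<noteq> 0"
    by (rule eventually_poly_ne_0) fact
  ultimately have "\<forall>\<^sub>F t in at 0. e3 K (poly s1 t) (poly s2 t) (\<psi> t) = 0"
  proof eventually_elim
    case (elim t)
    then show ?case using r(4)[of t] by (intro K) (auto simp: \<Phi> m)
  qed
  then have "((\<lambda>t. e3 K (poly s1 t) (poly s2 t) (\<psi> t)) \<longlongrightarrow> 0) (at 0)"
    by (rule tendsto_eventually)
  moreover have "((\<lambda>t. e3 K (poly s1 t) (poly s2 t) (\<psi> t)) \<longlongrightarrow> e3 K x y z) (at 0)"
    by (intro tendsto_e3 s \<psi>)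
  ultimately show ?thesis using LIM_unique by blast
qed (use K v in blast)

text \<open>Extended over the lines by \<open>vanishes_on_curve\<close>, the polynomial formula for
  T reaches every point of G = 0: O from a point of the curve on P, the points with q = 0 from
  points on the Q_i, the others by \<open>inverse_round_trip\<close>.\<close>

lemma vanishes_on_G:
  assumes H: "form e H"
    and van: "\<And>x y z. e3 F x y z = 0 \<Longrightarrow> ev2 q x y \<noteq> 0 \<Longrightarrow> ev2 l x y \<noteq> 0 \<Longrightarrow>
      e3 H (x * ev2 l x y ^ N) (y * ev2 l x y ^ N) (z * ev2 q x y - ev2 g x y) = 0"
    and v: "(x, y, z) \<noteq> (0, 0, 0)" "e3 G x y z = 0"
  shows "e3 H x y z = 0"
proof -
  have van': "e3 H (x * ev2 l x y ^ N) (y * ev2 l x y ^ N) (z * ev2 q x y - ev2 g x y) = 0"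
    if "(x, y, z) \<noteq> (0, 0, 0)" "e3 F x y z = 0" for x y z
    using vanishes_on_curve[of "subst_z H (X2 * l ^ N) (Y2 * l ^ N) [:- g, q:]" x y z] van that by simp
  have unscale: "e3 H x y z = 0" if "t \<noteq> 0" "e3 H (t * x) (t * y) (t * z) = 0" for t x y z
    using that by (simp add: form_scale[OF rhom_id H])
  have unscale': "e3 H x y z = 0" if "t \<noteq> 0" "e3 H (x * t) (y * t) (z * t) = 0" for t x y z
    using that unscale[of t x y z] by (simp add: mult.commute)
  show ?thesis
  proof (cases "(x, y) = (0, 0)")
    case True
    obtain w where w: "e3 F (b$1) (b$2) w = 0" using ex_F_root by blast
    define qb gb where "qb = ev2 q (b$1) (b$2)" and "gb = ev2 g (b$1) (b$2)"
    \<comment> \<open>By \<open>center\<close>, the formula for T gives O here and not the zero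
      vector.\<close>
    have "w * qb \<noteq> gb"
    proof
      assume "w * qb = gb"
      then have "e3 F (qb * b$1) (qb * b$2) (qb * w) \<noteq> 0"
        using center by (simp add: qb_def gb_def mult.commute)
      then show False using w by (simp add: form_scale[OF rhom_id F(1)])
    qed
    moreover have "(b$1, b$2, w) \<noteq> (0, 0, 0)"
      using nonzero[of b] by (auto simp: vec_eq_iff forall_2)
    then have "e3 H 0 0 (w * qb - gb) = 0"
      using van'[of "b$1" "b$2" w] w by (simp add: ev2_fib zero_pow_N qb_def gb_def)
    ultimately have "e3 H 0 0 1 = 0"
      using form_on_z_axis[OF H, of "w * qb - gb"] by simp
    then show ?thesis
      using True form_on_z_axis[OF H, of z] by simp
  next
    case xy: False
    show ?thesis
    proof (cases "ev2 q x y = 0")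
      case True
      have l0: "ev2 l x y \<noteq> 0" using G_on_P[OF xy] v(2) by blast
      obtain w where w: "e3 F x y w = 0" using ex_F_root by blast
      have "z * ev2 l x y ^ N + ev2 g x y = 0"
        using v(2) True by (simp add: e3_G F_z_axis)
      then have gz: "0 - ev2 g x y = z * ev2 l x y ^ N"
        by (simp add: add_eq_0_iff)
      have "(x, y, w) \<noteq> (0, 0, 0)" using xy by auto
      then have "e3 H (x * ev2 l x y ^ N) (y * ev2 l x y ^ N) (z * ev2 l x y ^ N) = 0"
        using van'[of x y w, unfolded True mult_zero_right gz] w by blast
      then show ?thesis using l0 unscale'[of "ev2 l x y ^ N" x y z] by simp
    next
      case q0: False
      have l0: "ev2 l x y \<noteq> 0" using G_on_P[OF xy] v(2) by blast
      define \<mu> where "\<mu> = ev2 q x y ^ (N + 1) * ev2 l x y ^ N"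
      define x' y' z' where "x' = x * ev2 q x y" and "y' = y * ev2 q x y"
        and "z' = z * ev2 l x y ^ N + ev2 g x y"
      have "e3 H (\<mu> * x) (\<mu> * y) (\<mu> * z) = 0"
      proof -
        have "(x', y', z') \<noteq> (0, 0, 0)" using xy q0 by (auto simp: x'_def y'_def)
        moreover have "e3 F x' y' z' = 0" using v(2) by (simp add: e3_G x'_def y'_def z'_def)
        ultimately show ?thesis
          using van'[of x' y' z'] unfolding inverse_round_trip[OF x'_def y'_def z'_def \<mu>_def] by blast
      qed
      moreover have "\<mu> \<noteq> 0" using q0 l0 by (simp add: \<mu>_def)
      ultimately show ?thesis by (rule unscale[rotated])
    qed
  qed
qed

text \<open>
  Off the lines, the identity \<open>G_inverse\<close> is differentiated instead of the definition of G,
  so that no Jacobian determinant has to be computed.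
\<close>

lemma singular_G:
  assumes v: "(x, y) \<noteq> (0, 0)" "e3 G x y z = 0" "grad G (vector [x, y, z]) = 0"
  obtains i t where "i < length bs" "t \<noteq> 0" "x = t * bs!i$1" "y = t * bs!i$2"
    "z = t * (- ev2 g (bs!i$1) (bs!i$2) / ev2 l (bs!i$1) (bs!i$2) ^ N)"
proof (cases "ev2 q x y = 0")
  case True
  then show thesis using G_on_Q[OF v(1) _ v(2)] that by blast
next
  case q0: False
  have l0: "ev2 l x y \<noteq> 0" using G_on_P[OF v(1)] v(2) by blast
  define \<mu> where "\<mu> = ev2 q x y ^ (N + 1) * ev2 l x y ^ N"
  have \<mu>0: "\<mu> \<noteq> 0" using q0 l0 by (simp add: \<mu>_def)
  define x' y' z' where "x' = x * ev2 q x y" and "y' = y * ev2 q x y"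
    and "z' = z * ev2 l x y ^ N + ev2 g x y"
  note trip = inverse_round_trip[OF x'_def y'_def z'_def \<mu>_def]
  have Fu: "e3 F x' y' z' = 0" using v(2) by (simp add: e3_G x'_def y'_def z'_def)
  define u :: "complex^3" where "u = vector [x', y', z']"
  define X Y Z where "X = [:X2 * l ^ N:]" and "Y = [:Y2 * l ^ N:]" and "Z = [:- g, q:]"
  define lam where "lam = [:(l ^ (N * (N + 1)) * q) ^ d:]"
  have G_lam: "e3 G (e3 X x y z) (e3 Y x y z) (e3 Z x y z) = e3 lam x y z * e3 F x y z" for x y z
    using G_inverse[of x y z] by (simp add: X_def Y_def Z_def lam_def)
  have lam0: "e3 lam x' y' z' \<noteq> 0"
  proof -
    have "ev2 l x' y' = ev2 q x y * ev2 l x y" "ev2 q x' y' = ev2 q x y ^ N * ev2 q x y"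
      using fib_scale[of b "ev2 q x y" x y] q_scale[of "ev2 q x y" x y]
      by (simp_all add: x'_def y'_def mult.commute)
    then show ?thesis using q0 l0 by (simp add: lam_def)
  qed
  have "grad_dot F u w = 0" for w
  proof -
    \<comment> \<open>Both sides of \<open>G_inverse\<close> are differentiated along this path. The
      left derivative vanishes because \<open>\<delta> 0\<close> is a multiple of the singular
      point; on the right, the product rule leaves the derivative of F times a nonzero
      factor.\<close>
    define \<gamma> where "\<gamma> = (\<lambda>t. u + t *s w)"
    have d: "((\<lambda>t. ev3 f (\<gamma> t)) has_field_derivative grad_dot f u w) (at 0)" for f
      using ev3_line_has_field_derivative[of f u w 0] by (simp add: \<gamma>_def)
    define \<delta> where "\<delta> = (\<lambda>t. vector [ev3 X (\<gamma> t), ev3 Y (\<gamma> t), ev3 Z (\<gamma> t)] :: complex^3)"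
    define \<delta>' :: "complex^3" where "\<delta>' = vector [grad_dot X u w, grad_dot Y u w, grad_dot Z u w]"
    have \<delta>0: "\<delta> 0 = \<mu> *s vector [x, y, z]"
      using trip by (simp add: \<delta>_def \<gamma>_def u_def X_def Y_def Z_def vec_eq_iff forall_3)
    have "((\<lambda>t. \<delta> t $ i) has_field_derivative \<delta>' $ i) (at 0)" for i
      using exhaust_3[of i] d by (auto simp: \<delta>_def \<delta>'_def)
    then have "((\<lambda>t. ev3 G (\<delta> t)) has_field_derivative grad_dot G (\<delta> 0) \<delta>') (at 0)"
      by (rule ev3_has_field_derivative)
    moreover have "grad_dot G (\<delta> 0) \<delta>' = 0"
      using grad_dot_scale[OF form_G \<mu>0, of "vector [x, y, z]" \<delta>'] v(3) \<mu>0
      by (simp add: \<delta>0 grad_eq_0_iff)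
    moreover have "ev3 G (\<delta> t) = ev3 lam (\<gamma> t) * ev3 F (\<gamma> t)" for t
      using G_lam by (simp add: \<delta>_def) (simp add: ev3_def)
    moreover have "((\<lambda>t. ev3 lam (\<gamma> t) * ev3 F (\<gamma> t)) has_field_derivative
        (grad_dot lam u w * ev3 F (\<gamma> 0) + grad_dot F u w * ev3 lam (\<gamma> 0))) (at 0)"
      by (rule DERIV_mult[OF d d])
    ultimately have "grad_dot lam u w * ev3 F (\<gamma> 0) + grad_dot F u w * ev3 lam (\<gamma> 0) = 0"
      by (simp add: DERIV_unique)
    then show ?thesis using Fu lam0 by (simp add: \<gamma>_def u_def)
  qed
  then have "grad F u = 0" by (simp add: grad_eq_0_iff)
  moreover have "ev3 F u = 0" using Fu by (simp add: u_def)
  moreover have "u \<noteq> 0"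
    using v(1) q0 by (auto simp: u_def x'_def y'_def vec_eq_iff forall_3)
  ultimately show thesis using smooth by blast
qed

end

section \<open>The correspondences off the distinguished fibers\<close>

lemma hpt_eq_iff:
  "hpt n (s', u', v') = hpt n (s, u, v) \<longleftrightarrow>
    (\<exists>l m. l \<noteq> 0 \<and> m \<noteq> 0 \<and> s' = l *s s \<and> u' = m * u \<and> v' = l ^ n * m * v)"
proof
  assume "hpt n (s', u', v') = hpt n (s, u, v)"
  moreover have "(s', u', v') \<in> hpt n (s', u', v')"
    unfolding hpt_def by (force intro: exI[of _ 1])
  ultimately show "\<exists>l m. l \<noteq> 0 \<and> m \<noteq> 0 \<and> s' = l *s s \<and> u' = m * u \<and> v' = l ^ n * m * v"
    by (auto simp: hpt_def)
next
  assume "\<exists>l m. l \<noteq> 0 \<and> m \<noteq> 0 \<and> s' = l *s s \<and> u' = m * u \<and> v' = l ^ n * m * v"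
  then obtain l m where lm: "l \<noteq> 0" "m \<noteq> 0" "s' = l *s s" "u' = m * u" "v' = l ^ n * m * v" by blast
  have sub: "hpt n (l *s s, m * u, l ^ n * m * v) \<subseteq> hpt n (s, u, v)" if "l \<noteq> 0" "m \<noteq> 0" for l m s u v
  proof
    fix h assume "h \<in> hpt n (l *s s, m * u, l ^ n * m * v)"
    then obtain l' m' where "l' \<noteq> 0" "m' \<noteq> 0"
        "h = (l' *s (l *s s), m' * (m * u), l' ^ n * m' * (l ^ n * m * v))"
      by (auto simp: hpt_def)
    then have "h = ((l' * l) *s s, (m' * m) * u, (l' * l) ^ n * (m' * m) * v)" "l' * l \<noteq> 0" "m' * m \<noteq> 0"
      using that by (simp_all add: vector_smult_assoc power_mult_distrib)
    then show "h \<in> hpt n (s, u, v)"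
      unfolding hpt_def prod.case mem_Collect_eq by blast
  qed
  have inv: "s = inverse l *s s'" "u = inverse m * u'" "v = inverse l ^ n * inverse m * v'"
    using lm by (simp_all add: vector_smult_assoc power_inverse field_simps)
  then show "hpt n (s', u', v') = hpt n (s, u, v)"
    using sub[OF lm(1,2), of s u v, folded lm(3-5)] lm(1,2)
      sub[of "inverse l" "inverse m" s' u' v', folded inv] by auto
qed

lemma hpt_in_hirzebruch: "s \<noteq> 0 \<Longrightarrow> (u, v) \<noteq> (0, 0) \<Longrightarrow> hpt n (s, u, v) \<in> hirzebruch n"
  by (auto simp: hirzebruch_def)

lemma fiber_form_scale: "fiber_form b (l *s s) = l * fiber_form b s"
  by (simp add: fiber_form_def algebra_simps)

text \<open>Off the fiber over b, [z0 : z1] is forced to be [\<open>fiber_form b s\<close> : u], so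
  the correspondence is single valued and multiplies v / u by the linear form.\<close>

lemma first_type_Image:
  assumes s: "s \<noteq> 0" "(u, v) \<noteq> (0, 0)" and ff: "fiber_form b s \<noteq> 0"
  shows "first_type n b `` {hpt n (s, u, v)} = {hpt (Suc n) (s, u, fiber_form b s * v)}"
proof (rule equalityI; rule subsetI)
  fix h assume "h \<in> first_type n b `` {hpt n (s, u, v)}"
  then obtain s' u' v' z0 z1 where h: "h = hpt (Suc n) (s', z1, z0 * v')"
      and eq: "hpt n (s', u', v') = hpt n (s, u, v)"
      and z: "(z0, z1) \<noteq> (0, 0)" "z0 * u' = z1 * fiber_form b s'"
    by (fastforce simp: first_type_def blowup_coords_def)
  obtain l m where lm: "l \<noteq> 0" "m \<noteq> 0" "s' = l *s s" "u' = m * u" "v' = l ^ n * m * v"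
    using eq by (auto simp: hpt_eq_iff)
  have z1: "z1 = z0 * m / (l * fiber_form b s) * u"
    using z(2) lm ff by (simp add: fiber_form_scale field_simps)
  then have "z0 \<noteq> 0" using z(1) by auto
  then have "hpt (Suc n) (s', z1, z0 * v') = hpt (Suc n) (s, u, fiber_form b s * v)"
    unfolding hpt_eq_iff using lm ff z1
    by (intro exI[of _ l] exI[of _ "z0 * m / (l * fiber_form b s)"]) simp
  then show "h \<in> {hpt (Suc n) (s, u, fiber_form b s * v)}" using h by simp
next
  fix h assume "h \<in> {hpt (Suc n) (s, u, fiber_form b s * v)}"
  moreover have "((s, u, v), (fiber_form b s, u)) \<in> blowup_coords b (\<lambda>(s, u, v). u)"
    using s ff by (simp add: blowup_coords_def)
  ultimately show "h \<in> first_type n b `` {hpt n (s, u, v)}"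
    unfolding first_type_def by blast
qed

lemma first_types_Image:
  assumes "s \<noteq> 0" "(u, v) \<noteq> (0, 0)" "\<And>b. b \<in> set bs \<Longrightarrow> fiber_form b s \<noteq> 0"
  shows "first_types n bs `` {hpt n (s, u, v)} =
    {hpt (n + length bs) (s, u, prod_list (map (\<lambda>b. fiber_form b s) bs) * v)}"
  using assms
proof (induction bs arbitrary: n v)
  case Nil
  then show ?case using hpt_in_hirzebruch[of s u v n] by auto
next
  case (Cons b bs)
  have "first_types n (b # bs) `` {hpt n (s, u, v)} =
      first_types (Suc n) bs `` {hpt (Suc n) (s, u, fiber_form b s * v)}"
    using Cons.prems by (simp add: relcomp_Image first_type_Image)
  also have "\<dots> = {hpt (Suc n + length bs) (s, u, prod_list (map (\<lambda>b. fiber_form b s) bs) * (fiber_form b s * v))}"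
    using Cons.prems by (intro Cons.IH) auto
  finally show ?case by (simp add: mult_ac)
qed

text \<open>Here [z0 : z1] is forced to be [\<open>fiber_form b s\<close> :
  \<open>v - g s * u\<close>]; homogeneity of g makes this compatible with the scaling of s.\<close>

lemma second_type_Image:
  assumes R: "R = {(hpt n (s, u, v), hpt (n - 1) (s, z0 * u, z1)) | s u v z0 z1.
      ((s, u, v), (z0, z1)) \<in> blowup_coords b (\<lambda>(s, u, v). v - g s * u)}"
    and g: "\<And>l s. g (l *s s) = l ^ n * g s" and n: "n \<ge> 1"
    and s: "s \<noteq> 0" "(u, v) \<noteq> (0, 0)" and ff: "fiber_form b s \<noteq> 0"
  shows "R `` {hpt n (s, u, v)} = {hpt (n - 1) (s, fiber_form b s * u, v - g s * u)}"
proof (rule equalityI; rule subsetI)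
  fix h assume "h \<in> R `` {hpt n (s, u, v)}"
  then obtain s' u' v' z0 z1 where h: "h = hpt (n - 1) (s', z0 * u', z1)"
      and eq: "hpt n (s', u', v') = hpt n (s, u, v)"
      and z: "(z0, z1) \<noteq> (0, 0)" "z0 * (v' - g s' * u') = z1 * fiber_form b s'"
    by (fastforce simp: R blowup_coords_def)
  obtain l m where lm: "l \<noteq> 0" "m \<noteq> 0" "s' = l *s s" "u' = m * u" "v' = l ^ n * m * v"
    using eq by (auto simp: hpt_eq_iff)
  have ln: "l ^ n = l ^ (n - 1) * l" using n by (cases n) simp_all
  define X where "X = l ^ (n - 1) * m * (v - g s * u)"
  have "v' - g s' * u' = l * X"
    unfolding lm g ln X_def by (simp add: algebra_simps)
  with z(2) have "l * (z0 * X) = l * (z1 * fiber_form b s)"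
    unfolding lm(3) fiber_form_scale by (simp only: mult.left_commute)
  then have "z0 * (l ^ (n - 1) * m * (v - g s * u)) = z1 * fiber_form b s"
    using lm(1) by (simp add: X_def)
  then have z1: "z1 = l ^ (n - 1) * (z0 * m / fiber_form b s) * (v - g s * u)"
    using ff by (simp add: eq_divide_eq mult_ac)
  then have "z0 \<noteq> 0" using z(1) by auto
  then have "hpt (n - 1) (s', z0 * u', z1) = hpt (n - 1) (s, fiber_form b s * u, v - g s * u)"
    unfolding hpt_eq_iff using lm ff z1
    by (intro exI[of _ l] exI[of _ "z0 * m / fiber_form b s"]) simp
  then show "h \<in> {hpt (n - 1) (s, fiber_form b s * u, v - g s * u)}" using h by simp
next
  fix h assume "h \<in> {hpt (n - 1) (s, fiber_form b s * u, v - g s * u)}"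
  moreover have "((s, u, v), (fiber_form b s, v - g s * u)) \<in> blowup_coords b (\<lambda>(s, u, v). v - g s * u)"
    using s ff by (simp add: blowup_coords_def)
  ultimately show "h \<in> R `` {hpt n (s, u, v)}"
    unfolding R by blast
qed

lemma binary_form_poly:
  assumes "binary_form n g"
  obtains p where "\<And>s. g s = ev2 p (s$1) (s$2)" "\<And>t x y. ev2 p (t * x) (t * y) = t ^ n * ev2 p x y"
proof -
  obtain a where a: "g = (\<lambda>s. \<Sum>i\<le>n. a i * (s$1) ^ i * (s$2) ^ (n - i))"
    using assms by (auto simp: binary_form_def)
  define p where "p = (\<Sum>i\<le>n. const2 (a i) * X2 ^ i * Y2 ^ (n - i))"
  have ev: "ev2 p x y = (\<Sum>i\<le>n. a i * x ^ i * y ^ (n - i))" for x y by (simp add: p_def)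
  have *: "a i * (t * x) ^ i * (t * y) ^ (n - i) = t ^ n * (a i * x ^ i * y ^ (n - i))" if "i \<le> n" for i t x y
  proof -
    have "t ^ n = t ^ i * t ^ (n - i)" using that by (simp flip: power_add)
    then show ?thesis by (simp add: power_mult_distrib)
  qed
  have "ev2 p (t * x) (t * y) = t ^ n * ev2 p x y" for t x y
    unfolding ev sum_distrib_left by (intro sum.cong refl *) simp
  then show thesis using that[of p] by (simp add: a ev)
qed

text \<open>
  The centers v = g_i u of the successive transformations combine to the form
  g_1 + l (g_2 + l (g_3 + ...)), where l is the equation of the fiber.
\<close>

lemma second_types_Image:
  assumes "second_types b n cs R" "length cs \<le> n" "b \<noteq> 0"
  obtains g where "\<And>t x y. ev2 g (t * x) (t * y) = t ^ n * ev2 g x y"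
    "cs \<noteq> [] \<Longrightarrow> hd cs = hpt n (b, 1, ev2 g (b$1) (b$2))"
    "\<And>s u v. s \<noteq> 0 \<Longrightarrow> (u, v) \<noteq> (0, 0) \<Longrightarrow> fiber_form b s \<noteq> 0 \<Longrightarrow>
      R `` {hpt n (s, u, v)} =
        {hpt (n - length cs) (s, fiber_form b s ^ length cs * u, v - ev2 g (s$1) (s$2) * u)}"
  using assms
proof (induction arbitrary: thesis rule: second_types.induct)
  case (1 n)
  show ?case
  proof (rule 1(1)[of 0])
    fix s :: "complex^2" and u v :: complex assume "s \<noteq> 0" "(u, v) \<noteq> (0, 0)"
    then show "Id_on (hirzebruch n) `` {hpt n (s, u, v)} =
        {hpt (n - length []) (s, fiber_form b s ^ length [] * u, v - ev2 0 (s$1) (s$2) * u)}"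
      using hpt_in_hirzebruch[of s u v n] by auto
  qed simp_all
next
  case (2 n c R cs R')
  obtain h where h: "binary_form n h" "c = hpt n (b, 1, h b)"
      "R = {(hpt n (s, u, v), hpt (n - 1) (s, z0 * u, z1)) | s u v z0 z1.
        ((s, u, v), (z0, z1)) \<in> blowup_coords b (\<lambda>(s, u, v). v - h s * u)}"
    using 2(1) by (auto simp: second_type_def)
  obtain p where p: "\<And>s. h s = ev2 p (s$1) (s$2)" "\<And>t x y. ev2 p (t * x) (t * y) = t ^ n * ev2 p x y"
    using binary_form_poly[OF h(1)] by blast
  have n: "n \<ge> 1" "length cs \<le> n - 1" using 2(5) by auto
  obtain g where g: "\<And>t x y. ev2 g (t * x) (t * y) = t ^ (n - 1) * ev2 g x y"
    "\<And>s u v. s \<noteq> 0 \<Longrightarrow> (u, v) \<noteq> (0, 0) \<Longrightarrow> fiber_form b s \<noteq> 0 \<Longrightarrow>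
      R' `` {hpt (n - 1) (s, u, v)} =
        {hpt (n - 1 - length cs) (s, fiber_form b s ^ length cs * u, v - ev2 g (s$1) (s$2) * u)}"
    by (rule 2(3)[OF _ n(2) 2(6)]) blast
  have tn: "t ^ n = t * t ^ (n - 1)" for t :: complex using n(1) by (cases n) simp_all
  show ?case
  proof (rule 2(4)[of "p + fib b * g"])
    show "ev2 (p + fib b * g) (t * x) (t * y) = t ^ n * ev2 (p + fib b * g) x y" for t x y
      by (simp add: p(2) g(1) ev2_fib tn algebra_simps)
    \<comment> \<open>\<open>fib b\<close> vanishes at b, so the later centers do not change the
      value of the combined form there.\<close>
    show "hd (c # cs) = hpt n (b, 1, ev2 (p + fib b * g) (b$1) (b$2))"
      by (simp add: h(2) p(1) ev2_fib)
    fix s :: "complex^2" and u v :: complex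
    assume s: "s \<noteq> 0" "(u, v) \<noteq> (0, 0)" "fiber_form b s \<noteq> 0"
    have "R `` {hpt n (s, u, v)} = {hpt (n - 1) (s, fiber_form b s * u, v - h s * u)}"
      by (rule second_type_Image[OF h(3) _ n(1) s]) (simp add: p)
    moreover have "(fiber_form b s * u, v - h s * u) \<noteq> (0, 0)" using s by auto
    ultimately have "(R O R') `` {hpt n (s, u, v)} = {hpt (n - 1 - length cs)
        (s, fiber_form b s ^ length cs * (fiber_form b s * u),
         v - h s * u - ev2 g (s$1) (s$2) * (fiber_form b s * u))}"
      using g(2) s by (simp add: relcomp_Image)
    then show "(R O R') `` {hpt n (s, u, v)} = {hpt (n - length (c # cs))
        (s, fiber_form b s ^ length (c # cs) * u, v - ev2 (p + fib b * g) (s$1) (s$2) * u)}"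
      by (simp add: p(1) fiber_form_fib algebra_simps)
  qed
qed

section \<open>Coordinates for the blow-down to the plane\<close>

lemma invertible_mult_cancel: "invertible (A :: complex^3^3) \<Longrightarrow> A *v v = A *v w \<longleftrightarrow> v = w"
  by (metis invertible_def matrix_vector_mul_assoc matrix_vector_mul_lid)

lemma ppt_mult_eq_iff:
  fixes A :: "complex^3^3"
  assumes "invertible A"
  shows "ppt (A *v v) = ppt (A *v w) \<longleftrightarrow> (\<exists>c. c \<noteq> 0 \<and> v = c *s w)"
  using invertible_mult_cancel[OF assms]
  by (simp add: ppt_eq_iff flip: vector_scalar_commute)

lemma vector_3_eq_iff:
  "(vector [x, y, z] :: complex^3) = vector [x', y', z'] \<longleftrightarrow> x = x' \<and> y = y' \<and> z = z'"
  by (auto simp: vec_eq_iff forall_3)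

lemma vector_3_eq_0_iff: "(vector [x, y, z] :: complex^3) = 0 \<longleftrightarrow> (x, y, z) = (0, 0, 0)"
  by (auto simp: vec_eq_iff forall_3)

lemma vector_3_scale: "c *s vector [x, y, z] = (vector [c * x, c * y, c * z] :: complex^3)"
  by (simp add: vec_eq_iff forall_3)

lemma vector_2_eq_0_iff: "(vector [x, y] :: complex^2) = 0 \<longleftrightarrow> x = 0 \<and> y = 0"
  by (auto simp: vec_eq_iff forall_2)

lemma blow_down_Image:
  assumes "s \<noteq> 0" "(u, v) \<noteq> (0, 0)"
  shows "blow_down B `` {hpt 1 (s, u, v)} = {ppt (B *v vector [u * s$1, u * s$2, v])}"
proof (rule equalityI; rule subsetI)
  fix p assume "p \<in> blow_down B `` {hpt 1 (s, u, v)}"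
  then obtain s' u' v' where p: "p = ppt (B *v vector [u' * s'$1, u' * s'$2, v'])"
      and "hpt 1 (s', u', v') = hpt 1 (s, u, v)"
    by (auto simp: blow_down_def)
  then obtain l m where lm: "l \<noteq> 0" "m \<noteq> 0" "s' = l *s s" "u' = m * u" "v' = l * m * v"
    by (auto simp: hpt_eq_iff)
  have "vector [u' * s'$1, u' * s'$2, v'] = (l * m) *s (vector [u * s$1, u * s$2, v] :: complex^3)"
    by (simp add: vector_3_scale vector_3_eq_iff lm)
  then show "p \<in> {ppt (B *v vector [u * s$1, u * s$2, v])}"
    using p lm by (simp add: ppt_scale vector_scalar_commute)
next
  fix p assume "p \<in> {ppt (B *v vector [u * s$1, u * s$2, v])}"
  then show "p \<in> blow_down B `` {hpt 1 (s, u, v)}"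
    using assms by (auto simp: blow_down_def)
qed

lemma blow_up_Image:
  assumes A: "invertible A" and xy: "(x, y) \<noteq> (0, 0)"
  shows "(blow_down A)\<inverse> `` {ppt (A *v vector [x, y, z])} = {hpt 1 (vector [x, y], 1, z)}"
proof (rule equalityI; rule subsetI)
  fix h assume "h \<in> (blow_down A)\<inverse> `` {ppt (A *v vector [x, y, z])}"
  then obtain s u v where h: "h = hpt 1 (s, u, v)" and
      "ppt (A *v vector [u * s$1, u * s$2, v]) = ppt (A *v vector [x, y, z])"
    by (auto simp: blow_down_def)
  then obtain c where c: "c \<noteq> 0" "u * s$1 = c * x" "u * s$2 = c * y" "v = c * z"
    unfolding ppt_mult_eq_iff[OF A] by (auto simp: vector_3_scale vector_3_eq_iff)
  then have u: "u \<noteq> 0" using xy by auto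
  have "s = (c / u) *s vector [x, y]"
    using c u by (simp add: vec_eq_iff forall_2 field_simps)
  then show "h \<in> {hpt 1 (vector [x, y], 1, z)}"
    unfolding h singleton_iff hpt_eq_iff using c u
    by (intro exI[of _ "c / u"] exI[of _ u]) simp
next
  fix h assume h: "h \<in> {hpt 1 (vector [x, y], 1, z)}"
  have "(vector [x, y] :: complex^2) \<noteq> 0" using xy by (simp add: vector_2_eq_0_iff)
  then have "ppt (A *v vector [x, y, z]) \<in> blow_down A `` {hpt 1 (vector [x, y], 1, z)}"
    using blow_down_Image[of "vector [x, y]" 1 z A] by simp
  then show "h \<in> (blow_down A)\<inverse> `` {ppt (A *v vector [x, y, z])}"
    using h by simp
qed

lemma blow_down_fiber_iff:
  assumes A: "invertible A" and c: "c \<noteq> 0"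
  shows "ppt (A *v vector [x, y, z]) \<in> blow_down A `` fiber 1 c \<longleftrightarrow>
    (x, y, z) \<noteq> (0, 0, 0) \<and> ev2 (fib c) x y = 0"
proof
  assume "ppt (A *v vector [x, y, z]) \<in> blow_down A `` fiber 1 c"
  then obtain u v where uv: "(u, v) \<noteq> (0, 0)"
      and "ppt (A *v vector [x, y, z]) \<in> blow_down A `` {hpt 1 (c, u, v)}"
    by (auto simp: fiber_def)
  then have "ppt (A *v vector [x, y, z]) = ppt (A *v vector [u * c$1, u * c$2, v])"
    unfolding blow_down_Image[OF c uv] by blast
  then obtain k where k: "k \<noteq> 0" "x = k * (u * c$1)" "y = k * (u * c$2)" "z = k * v"
    unfolding ppt_mult_eq_iff[OF A] by (auto simp: vector_3_scale vector_3_eq_iff)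
  moreover have "c$1 \<noteq> 0 \<or> c$2 \<noteq> 0" using c by (auto simp: vec_eq_iff forall_2)
  ultimately show "(x, y, z) \<noteq> (0, 0, 0) \<and> ev2 (fib c) x y = 0"
    using uv by (auto simp: ev2_fib)
next
  assume v: "(x, y, z) \<noteq> (0, 0, 0) \<and> ev2 (fib c) x y = 0"
  then obtain t where t: "x = t * c$1" "y = t * c$2"
    using fib_eq_0_iff[OF c] by blast
  then have "(t, z) \<noteq> (0, 0)" using v by auto
  then have "ppt (A *v vector [x, y, z]) \<in> blow_down A `` {hpt 1 (c, t, z)}" "hpt 1 (c, t, z) \<in> fiber 1 c"
    using blow_down_Image[OF c, of t z A] t by (auto simp: fiber_def)
  then show "ppt (A *v vector [x, y, z]) \<in> blow_down A `` fiber 1 c" by blast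
qed

lemma prod_list_multiplicities:
  fixes f :: "'b \<Rightarrow> 'a::comm_monoid_mult"
  assumes "length ns = length bs"
  shows "prod_list (map f (concat (map2 replicate ns bs))) = (\<Prod>i<length bs. f (bs ! i) ^ (ns ! i))"
  using assms
proof (induction ns bs rule: list_induct2)
  case (Cons n ns b bs)
  then show ?case
    by (simp add: prod.lessThan_Suc_shift prod_list_replicate del: prod.lessThan_Suc)
qed simp

lemma length_multiplicities:
  "length ns = length bs \<Longrightarrow> length (concat (map2 replicate ns bs)) = sum_list ns"
  by (induction ns bs rule: list_induct2) simp_all

section \<open>The singular points in the projective plane\<close>

lemma grad_dot_lin_comp: "grad_dot (lin_comp F A) v w = grad_dot F (A *v v) (A *v w)"
proof -
  have "((\<lambda>t. ev3 (lin_comp F A) (v + t *s w)) has_field_derivative grad_dot (lin_comp F A) v w) (at 0)"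
    using ev3_line_has_field_derivative[of "lin_comp F A" v w 0] by simp
  moreover have "((\<lambda>t. ev3 F (A *v v + t *s (A *v w))) has_field_derivative grad_dot F (A *v v) (A *v w)) (at 0)"
    using ev3_line_has_field_derivative[of F "A *v v" "A *v w" 0] by simp
  moreover have "A *v (v + t *s w) = A *v v + t *s (A *v w)" for t
    by (simp add: matrix_vector_right_distrib vector_scalar_commute)
  ultimately show ?thesis by (simp add: DERIV_unique)
qed

text \<open>A form of degree 0 is constant, hence zero or a unit.\<close>

lemma degree_form_pos:
  assumes F: "form d F" "irreducible F" shows "d \<ge> 1"
proof (rule ccontr)
  assume "\<not> d \<ge> 1"
  then have "d = 0" by simp
  then have "e3 F x y z = e3 F 0 0 0" for x y z
    using form_scale[OF rhom_id F(1), of 0 x y z] by simp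
  then have eq: "F = const3 (e3 F 0 0 0)"
    by (intro e3_eqI) simp
  then have "e3 F 0 0 0 \<noteq> 0"
    using F(2) by (metis const3_def irreducible_def pCons_0_0)
  then have "const3 (e3 F 0 0 0) dvd 1"
    by (simp add: const3_def is_unit_const_poly_iff dvd_field_iff)
  then show False using F(2) eq by (metis irreducible_def)
qed

text \<open>
  On the plane underlying a transversal line the differential is nonzero; it vanishes on the point
  itself by Euler's identity, hence it is nonzero on every other vector of the plane.
\<close>

lemma transversal_grad_dot:
  assumes F: "form d F" and A: "invertible A" and c: "c \<noteq> 0"
    and trans: "transversal F (blow_down A `` fiber 1 c)"
    and det: "\<alpha> * \<beta>' - \<alpha>' * \<beta> \<noteq> 0"
    and v: "ev3 F (A *v vector [\<alpha> * c$1, \<alpha> * c$2, \<beta>]) = 0"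
  shows "grad_dot F (A *v vector [\<alpha> * c$1, \<alpha> * c$2, \<beta>]) (A *v vector [\<alpha>' * c$1, \<alpha>' * c$2, \<beta>']) \<noteq> 0"
proof -
  define u where "u = (\<lambda>\<alpha> \<beta>. A *v (vector [\<alpha> * c$1, \<alpha> * c$2, \<beta>] :: complex^3))"
  have c12: "c$1 \<noteq> 0 \<or> c$2 \<noteq> 0" using c by (auto simp: vec_eq_iff forall_2)
  have on_line: "ppt (u \<alpha> \<beta>) \<in> blow_down A `` fiber 1 c \<longleftrightarrow> (\<alpha>, \<beta>) \<noteq> (0, 0)" for \<alpha> \<beta>
    unfolding u_def blow_down_fiber_iff[OF A c] using c12 by (auto simp: ev2_fib)
  have u0: "u \<alpha> \<beta> \<noteq> 0" using det c12
    by (auto simp: u_def invertible_mult_eq_0[OF A] vector_3_eq_0_iff)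
  have "ppt (u \<alpha> \<beta>) \<in> blow_down A `` fiber 1 c \<inter> curve F"
    using on_line[of \<alpha> \<beta>] det v ppt_in_curve_iff[OF F u0] by (auto simp: u_def)
  then obtain w where w: "w \<noteq> 0" "ppt w \<in> blow_down A `` fiber 1 c" "grad_dot F (u \<alpha> \<beta>) w \<noteq> 0"
    using trans u0 unfolding transversal_def grad_dot_def by blast
  obtain A' where A': "A ** A' = mat 1" using A by (auto simp: invertible_def)
  define w' where "w' = A' *v w"
  have w': "w = A *v vector [w'$1, w'$2, w'$3]"
    by (simp add: vector_3_eta w'_def matrix_vector_mul_assoc A')
  then have "ev2 (fib c) (w'$1) (w'$2) = 0"
    using w(2) blow_down_fiber_iff[OF A c] by metis
  then obtain \<gamma> where \<gamma>: "w'$1 = \<gamma> * c$1" "w'$2 = \<gamma> * c$2"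
    unfolding fib_eq_0_iff[OF c] by blast
  define D where "D = \<alpha> * \<beta>' - \<alpha>' * \<beta>"
  \<comment> \<open>Cramer's rule for w in the basis of the plane that consists of the point and the
    second vector.\<close>
  define a b where "a = (\<gamma> * \<beta>' - \<alpha>' * w'$3) / D" and "b = (\<alpha> * w'$3 - \<gamma> * \<beta>) / D"
  have D: "D \<noteq> 0" using det by (simp add: D_def)
  have ab: "\<gamma> = a * \<alpha> + b * \<alpha>'" "w'$3 = a * \<beta> + b * \<beta>'"
    using D by (simp_all add: a_def b_def field_simps) (simp_all add: D_def algebra_simps)
  have "w = a *s u \<alpha> \<beta> + b *s u \<alpha>' \<beta>'"
    unfolding w' \<gamma> ab u_def vector_scalar_commute[symmetric] matrix_vector_right_distrib[symmetric]
    by (rule arg_cong[of _ _ "\<lambda>v. A *v v"]) (simp add: vec_eq_iff forall_3 algebra_simps)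
  then have "grad_dot F (u \<alpha> \<beta>) w = a * (d * ev3 F (u \<alpha> \<beta>)) + b * grad_dot F (u \<alpha> \<beta>) (u \<alpha>' \<beta>')"
    by (simp add: grad_dot_add grad_dot_self[OF F])
  then show ?thesis using w(3) v by (auto simp: u_def)
qed

section \<open>Affine charts at the singular points\<close>

lemma invertible_ker: "(\<And>v. (M :: complex^3^3) *v v = 0 \<Longrightarrow> v = 0) \<Longrightarrow> invertible M"
  by (metis invertible_left_inverse matrix_left_invertible_ker)

text \<open>In the chart w = 1 the origin is (c, t), x moves across the pencil in the direction e,
  and y moves along the line over c.\<close>

lemma local_frame:
  fixes c e :: "complex^2"
  assumes det: "c$2 * e$1 - c$1 * e$2 = 1"
  obtains M :: "complex^3^3" where "invertible M"
    "\<And>x y w. M *v vector [x, y, w] = vector [e$1 * x + c$1 * w, e$2 * x + c$2 * w, y + t * w]"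
proof -
  define M :: "complex^3^3" where
    "M = vector [vector [e$1, 0, c$1], vector [e$2, 0, c$2], vector [0, 1, t]]"
  have M: "M *v vector [x, y, w] = vector [e$1 * x + c$1 * w, e$2 * x + c$2 * w, y + t * w]" for x y w
    unfolding M_def mult_vector_3 by simp
  have "v = 0" if "M *v v = 0" for v
  proof -
    define x y w where "x = v$1" and "y = v$2" and "w = v$3"
    have v: "v = vector [x, y, w]" by (simp add: x_def y_def w_def vector_3_eta)
    have 0: "e$1 * x + c$1 * w = 0" "e$2 * x + c$2 * w = 0" "y + t * w = 0"
      using that unfolding v M vector_3_eq_0_iff by simp_all
    have "(c$2 * e$1 - c$1 * e$2) * x = c$2 * (e$1 * x + c$1 * w) - c$1 * (e$2 * x + c$2 * w)"
      "(c$2 * e$1 - c$1 * e$2) * w = e$1 * (e$2 * x + c$2 * w) - e$2 * (e$1 * x + c$1 * w)"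
      by (simp_all add: algebra_simps)
    then have "x = 0" "w = 0" unfolding 0 det by simp_all
    then show ?thesis using 0 v by (simp add: vector_3_eq_0_iff)
  qed
  then show thesis by (intro that[OF invertible_ker M])
qed

text \<open>A chart at O in which the line of the pencil over c is x = 0.\<close>

lemma axis_frame:
  fixes c e :: "complex^2"
  assumes det: "c$2 * e$1 - c$1 * e$2 = 1"
  obtains M :: "complex^3^3" where "invertible M"
    "\<And>x y w. M *v vector [x, y, w] = vector [x * e$1 + y * c$1, x * e$2 + y * c$2, w]"
proof -
  define M :: "complex^3^3" where
    "M = vector [vector [e$1, c$1, 0], vector [e$2, c$2, 0], vector [0, 0, 1]]"
  have M: "M *v vector [x, y, w] = vector [x * e$1 + y * c$1, x * e$2 + y * c$2, w]" for x y w
    unfolding M_def mult_vector_3 by (simp add: mult.commute)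
  have "v = 0" if "M *v v = 0" for v
  proof -
    define x y w where "x = v$1" and "y = v$2" and "w = v$3"
    have v: "v = vector [x, y, w]" by (simp add: x_def y_def w_def vector_3_eta)
    have 0: "x * e$1 + y * c$1 = 0" "x * e$2 + y * c$2 = 0" "w = 0"
      using that unfolding v M vector_3_eq_0_iff by simp_all
    have "(c$2 * e$1 - c$1 * e$2) * x = c$2 * (x * e$1 + y * c$1) - c$1 * (x * e$2 + y * c$2)"
      "(c$2 * e$1 - c$1 * e$2) * y = e$1 * (x * e$2 + y * c$2) - e$2 * (x * e$1 + y * c$1)"
      by (simp_all add: algebra_simps)
    then have "x = 0" "y = 0" unfolding 0 det by simp_all
    then show ?thesis using 0 v by (simp add: vector_3_eq_0_iff)
  qed
  then show thesis by (intro that[OF invertible_ker M])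
qed

lemma axis_3_eq: "(axis 3 1 :: complex^3) = vector [0, 0, 1]"
  by (simp add: vec_eq_iff forall_3 axis_def)

context normal_form
begin

text \<open>The last coordinate solves z l^N + g = 0; by \<open>G_on_Q\<close> no other point of the
  image besides O lies on the line over \<open>bs ! i\<close>.\<close>

definition tac_pt :: "nat \<Rightarrow> complex^3" where
  "tac_pt i = vector [bs!i$1, bs!i$2, - ev2 g (bs!i$1) (bs!i$2) / ev2 l (bs!i$1) (bs!i$2) ^ N]"

text \<open>The equation is carried to the final plane by B' and the chart by B; the two cancel, so
  that local equations are computed with G itself.\<close>

lemma local_eq_lin_comp:
  assumes "B' ** B = mat 1"
  shows "ev2 (local_eq (lin_comp G B') (B ** M)) x y = ev3 G (M *v vector [x, y, 1])"
proof -
  have "B' *v ((B ** M) *v v) = M *v v" for v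
    by (simp add: matrix_vector_mul_assoc matrix_mul_assoc assms)
  then show ?thesis by simp
qed

lemma tacnode_at_tac_pt:
  assumes B: "invertible B" "B' ** B = mat 1" and i: "i < length bs"
  shows "tacnode_at d (ns ! i - 1) (lin_comp G B') (ppt (B *v tac_pt i))"
    "has_type (lin_comp G B') (ppt (B *v tac_pt i)) (type_of (replicate (ns ! i) d))"
proof -
  define t where "t = - ev2 g (bs!i$1) (bs!i$2) / ev2 l (bs!i$1) (bs!i$2) ^ N"
  obtain e :: "complex^2" where e: "bs!i$2 * e$1 - bs!i$1 * e$2 = 1"
    using ex_dual[of "bs ! i"] nonzero[of "bs ! i"] i by auto
  obtain M :: "complex^3^3" where M: "invertible M"
    "\<And>x y w. M *v vector [x, y, w] = vector [e$1 * x + bs!i$1 * w, e$2 * x + bs!i$2 * w, y + t * w]"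
    using local_frame[OF e, of t] by blast
  have "M *v axis 3 1 = tac_pt i"
    by (simp add: axis_3_eq M(2) tac_pt_def t_def)
  then have cent: "centered (B ** M) (ppt (B *v tac_pt i))"
    using B(1) M(1) by (simp add: centered_def invertible_mult flip: matrix_vector_mul_assoc)
  have fe: "ev2 (fib (bs ! i)) (e$1) (e$2) = 1" using e by (simp add: ev2_fib)
  have t0: "ev2 g (bs!i$1) (bs!i$2) + t * ev2 l (bs!i$1) (bs!i$2) ^ N = 0"
    using l_bs[OF i] by (simp add: t_def)
  have ev: "ev2 (local_eq (lin_comp G B') (B ** M)) x y =
      e3 G (bs!i$1 + x * e$1) (bs!i$2 + x * e$2) (y + t)" for x y
    unfolding local_eq_lin_comp[OF B(2)] M(2) by (simp add: algebra_simps)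
  have "germ_tacnode d (ns ! i - 1) (local_eq (lin_comp G B') (B ** M))"
    "germ_type (local_eq (lin_comp G B') (B ** M)) (type_of (replicate (ns ! i) d))"
    by (rule tacnode_germ[OF i fe t0 ev])+
  then show "tacnode_at d (ns ! i - 1) (lin_comp G B') (ppt (B *v tac_pt i))"
    "has_type (lin_comp G B') (ppt (B *v tac_pt i)) (type_of (replicate (ns ! i) d))"
    unfolding tacnode_at_def has_type_def using cent by blast+
qed

lemma blow_down_tacnode_at_O:
  assumes B: "invertible B" "B' ** B = mat 1"
  shows "blow_down_tacnode_at d (N - 1) (lin_comp G B') (ppt (B *v vector [0, 0, 1]))"
    "has_type (lin_comp G B') (ppt (B *v vector [0, 0, 1])) (type_of (d * N # replicate N d))"
proof -
  obtain e :: "complex^2" where e: "b$2 * e$1 - b$1 * e$2 = 1"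
    using ex_dual[of b] nonzero[of b] by auto
  obtain M :: "complex^3^3" where M: "invertible M"
    "\<And>x y w. M *v vector [x, y, w] = vector [x * e$1 + y * b$1, x * e$2 + y * b$2, w]"
    using axis_frame[OF e] by blast
  have "M *v axis 3 1 = vector [0, 0, 1]"
    by (simp add: axis_3_eq M(2))
  then have cent: "centered (B ** M) (ppt (B *v vector [0, 0, 1]))"
    using B(1) M(1) by (simp add: centered_def invertible_mult flip: matrix_vector_mul_assoc)
  have fe: "ev2 l (e$1) (e$2) = 1" using e by (simp add: ev2_fib)
  have ev: "ev2 (local_eq (lin_comp G B') (B ** M)) x y =
      e3 G (x * e$1 + y * b$1) (x * e$2 + y * b$2) 1" for x y
    unfolding local_eq_lin_comp[OF B(2)] M(2) by simp
  show "blow_down_tacnode_at d (N - 1) (lin_comp G B') (ppt (B *v vector [0, 0, 1]))"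
    "has_type (lin_comp G B') (ppt (B *v vector [0, 0, 1])) (type_of (d * N # replicate N d))"
    unfolding blow_down_tacnode_at_def has_type_def using cent blow_down_germ[OF fe ev] by blast+
qed

lemma singular_pt_lin_comp:
  assumes B: "B' ** B = mat 1" "B ** B' = mat 1" and x: "singular_pt (lin_comp G B') p"
  shows "p = ppt (B *v vector [0, 0, 1]) \<or> p \<in> (\<lambda>i. ppt (B *v tac_pt i)) ` {..<length bs}"
proof -
  obtain v where v: "v \<noteq> 0" "p = ppt v" "ev3 (lin_comp G B') v = 0" "grad (lin_comp G B') v = 0"
    using x by (auto simp: singular_pt_def)
  define w where "w = B' *v v"
  have vw: "v = B *v w" by (simp add: w_def matrix_vector_mul_assoc B)
  define x y z where "x = w$1" and "y = w$2" and "z = w$3"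
  have w: "w = vector [x, y, z]" by (simp add: x_def y_def z_def vector_3_eta)
  have G0: "e3 G x y z = 0" using v(3) by (simp add: w_def[symmetric] w)
  have "grad_dot G w u = 0" for u
  proof -
    have "grad_dot (lin_comp G B') v (B *v u) = 0" using v(4) by (simp add: grad_eq_0_iff)
    then show ?thesis by (simp add: grad_dot_lin_comp w_def matrix_vector_mul_assoc B)
  qed
  then have grad: "grad G (vector [x, y, z]) = 0" by (simp add: grad_eq_0_iff w)
  show ?thesis
  proof (cases "(x, y) = (0, 0)")
    case True
    then have "w = z *s vector [0, 0, 1]" by (simp add: w vector_3_scale)
    moreover from this have "z \<noteq> 0" using v(1) vw by auto
    ultimately show ?thesis by (simp add: v(2) vw ppt_scale vector_scalar_commute)
  next
    case False
    obtain i t where i: "i < length bs" "t \<noteq> 0" "x = t * bs!i$1" "y = t * bs!i$2"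
      "z = t * (- ev2 g (bs!i$1) (bs!i$2) / ev2 l (bs!i$1) (bs!i$2) ^ N)"
      using singular_G[OF False G0 grad] by blast
    then have "w = t *s tac_pt i" unfolding w tac_pt_def vector_3_scale by simp
    then have "p = ppt (B *v tac_pt i)"
      using i(2) by (simp add: v(2) vw ppt_scale vector_scalar_commute)
    then show ?thesis using i(1) by blast
  qed
qed

lemma tac_pts_distinct:
  assumes B: "invertible B"
  shows "inj_on (\<lambda>i. ppt (B *v tac_pt i)) {..<length bs}"
    "ppt (B *v vector [0, 0, 1]) \<notin> (\<lambda>i. ppt (B *v tac_pt i)) ` {..<length bs}"
proof -
  show "inj_on (\<lambda>i. ppt (B *v tac_pt i)) {..<length bs}"
  proof (rule inj_onI)
    fix i j assume ij: "i \<in> {..<length bs}" "j \<in> {..<length bs}"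
      and eq: "ppt (B *v tac_pt i) = ppt (B *v tac_pt j)"
    obtain c where "c \<noteq> 0" "tac_pt i = c *s tac_pt j"
      using eq ppt_mult_eq_iff[OF B] by blast
    then have "bs!i$1 = c * bs!j$1" "bs!i$2 = c * bs!j$2"
      unfolding tac_pt_def vector_3_scale vector_3_eq_iff by blast+
    then have "ev2 (fib (bs ! i)) (bs!j$1) (bs!j$2) = 0" by (simp add: ev2_fib)
    then show "i = j" using bs_bs[of i j] ij by auto
  qed
  show "ppt (B *v vector [0, 0, 1]) \<notin> (\<lambda>i. ppt (B *v tac_pt i)) ` {..<length bs}"
  proof
    assume "ppt (B *v vector [0, 0, 1]) \<in> (\<lambda>i. ppt (B *v tac_pt i)) ` {..<length bs}"
    then obtain i where i: "i < length bs" "ppt (B *v tac_pt i) = ppt (B *v vector [0, 0, 1])"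
      by auto
    then obtain c where "c \<noteq> 0" "tac_pt i = c *s vector [0, 0, 1]"
      using ppt_mult_eq_iff[OF B] by blast
    then have "bs!i$1 = 0 \<and> bs!i$2 = 0"
      unfolding tac_pt_def vector_3_scale vector_3_eq_iff by simp
    then have "bs ! i = 0" by (simp add: vec_eq_iff forall_2)
    then show False using nonzero[of "bs ! i"] i(1) by simp
  qed
qed

end

section \<open>The Cremona transformation\<close>

theorem proposition5p8:
  fixes F :: "complex poly poly poly" and d :: nat and ns :: "nat list"
    and p0 :: "(complex^3) set" and Qs :: "(complex^3) set set list" and P :: "(complex^3) set set"
    and \<tau> :: "((complex^3) set \<times> hcoord set) set" and cs :: "hcoord set list"
    and T :: "((complex^3) set \<times> (complex^3) set) set"
  assumes C: "form d F" "irreducible F" "smooth_curve F"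
    and ns: "ns \<noteq> []" "\<forall>n\<in>set ns. n \<ge> 1" "length Qs = length ns"
    and lines: "distinct (P # Qs)"
      "\<forall>L\<in>set (P # Qs). is_line L \<and> p0 \<in> L \<and> transversal F L"
    and p0: "p0 \<in> proj_plane" "p0 \<notin> curve F"
    and T: "cremona ns p0 Qs P \<tau> cs T"
    and center: "hd cs \<notin> \<tau> `` curve F"
  shows "\<exists>G p q.
    form (d * (sum_list ns + 1)) G \<and> irreducible G \<and>
    curve G = proper_transform T (\<Union> (set (P # Qs))) (curve F) \<and>
    inj_on p {..<length ns} \<and> q \<notin> p ` {..<length ns} \<and>
    (\<forall>i<length ns. tacnode_at d (ns ! i - 1) G (p i) \<and>
       has_type G (p i) (type_of (replicate (ns ! i) d))) \<and>
    blow_down_tacnode_at d (sum_list ns - 1) G q \<and>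
    has_type G q (type_of (d * sum_list ns # replicate (sum_list ns) d)) \<and>
    (\<forall>x. singular_pt G x \<longrightarrow> x = q \<or> x \<in> p ` {..<length ns})"
proof -
  obtain A B bs b R where A: "centered A p0" and B: "invertible B"
    and len: "length bs = length Qs"
    and Qs: "\<And>i. i < length Qs \<Longrightarrow> bs ! i \<noteq> 0" "\<And>i. i < length Qs \<Longrightarrow> Qs ! i = blow_down A `` fiber 1 (bs ! i)"
    and b: "b \<noteq> 0" "P = blow_down A `` fiber 1 b"
    and \<tau>: "\<tau> = (blow_down A)\<inverse> O first_types 1 (concat (map2 replicate ns bs))"
    and cs: "length cs = sum_list ns" "second_types b (sum_list ns + 1) cs R"
    and T_eq: "T = \<tau> O R O blow_down B"
    using T unfolding cremona_def by blast
  have A_inv: "invertible A" and p0_eq: "p0 = ppt (A *v vector [0, 0, 1])"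
    using A by (simp_all add: centered_def axis_3_eq)
  obtain A' where A': "A' ** A = mat 1" "A ** A' = mat 1" using A_inv by (auto simp: invertible_def)
  obtain B' where B': "B' ** B = mat 1" "B ** B' = mat 1" using B by (auto simp: invertible_def)
  define N where "N = sum_list ns"
  define q where "q = (\<Prod>i<length bs. fib (bs ! i) ^ (ns ! i))"
  define F' where "F' = lin_comp F A"
  have len': "length ns = length bs" using ns(3) len by simp
  have F': "form d F'" "irreducible F'"
    using C A_inv by (simp_all add: F'_def form_lin_comp irreducible_lin_comp)
  have in_curve: "ppt (A *v vector [x, y, z]) \<in> curve F \<longleftrightarrow> e3 F' x y z = 0"
    if "(x, y, z) \<noteq> (0, 0, 0)" for x y z
    using that by (simp add: F'_def ppt_in_curve_iff[OF C(1)] invertible_mult_eq_0[OF A_inv] vector_3_eq_0_iff)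
  have N_pos: "N \<ge> 1"
    using ns(1,2) by (cases ns) (auto simp: N_def)
  obtain g where g: "\<And>t x y. ev2 g (t * x) (t * y) = t ^ (N + 1) * ev2 g x y"
    "cs \<noteq> [] \<Longrightarrow> hd cs = hpt (N + 1) (b, 1, ev2 g (b$1) (b$2))"
    "\<And>s u v. s \<noteq> 0 \<Longrightarrow> (u, v) \<noteq> (0, 0) \<Longrightarrow> fiber_form b s \<noteq> 0 \<Longrightarrow>
      R `` {hpt (N + 1) (s, u, v)} =
        {hpt (N + 1 - length cs) (s, fiber_form b s ^ length cs * u, v - ev2 g (s$1) (s$2) * u)}"
    using second_types_Image[OF cs(2) _ b(1)] cs(1) unfolding N_def by (metis le_add1)
  have q_eq: "prod_list (map (\<lambda>c. fiber_form c s) (concat (map2 replicate ns bs))) = ev2 q (s$1) (s$2)" for s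
    by (simp add: prod_list_multiplicities[OF len'] q_def fiber_form_fib)
  \<comment> \<open>Only the lines Q_i are excluded, so the formula also holds on P outside O, where
    it locates the first center.\<close>
  have \<tau>_Image: "\<tau> `` {ppt (A *v vector [x, y, z])} = {hpt (N + 1) (vector [x, y], 1, ev2 q x y * z)}"
    if xy: "(x, y) \<noteq> (0, 0)" and fib: "\<And>i. i < length bs \<Longrightarrow> ev2 (fib (bs ! i)) x y \<noteq> 0" for x y z
  proof -
    have "\<tau> `` {ppt (A *v vector [x, y, z])} =
        first_types 1 (concat (map2 replicate ns bs)) `` {hpt 1 (vector [x, y], 1, z)}"
      by (simp only: \<tau> relcomp_Image blow_up_Image[OF A_inv xy])
    also have "\<dots> = {hpt (1 + length (concat (map2 replicate ns bs))) (vector [x, y], 1,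
        prod_list (map (\<lambda>c. fiber_form c (vector [x, y])) (concat (map2 replicate ns bs))) * z)}"
    proof (rule first_types_Image)
      show "(vector [x, y] :: complex^2) \<noteq> 0" using xy by (simp add: vector_2_eq_0_iff)
      fix c assume "c \<in> set (concat (map2 replicate ns bs))"
      then have "c \<in> set bs" by (auto dest: set_zip_rightD)
      then show "fiber_form c (vector [x, y]) \<noteq> 0"
        using fib by (auto simp: in_set_conv_nth fiber_form_fib)
    qed simp
    finally show ?thesis
      by (simp add: q_eq length_multiplicities[OF len'] N_def)
  qed
  \<comment> \<open>Distinct lines have independent base points: if the linear form of one vanished
    at the other, the lines would coincide.\<close>
  have fib_proportional: "blow_down A `` fiber 1 c = blow_down A `` fiber 1 c'"
    if c: "c \<noteq> 0" "c' \<noteq> 0" and 0: "ev2 (fib c) (c'$1) (c'$2) = 0" for c c'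
  proof -
    have iff: "ev2 (fib c) x y = 0 \<longleftrightarrow> ev2 (fib c') x y = 0" for x y
    proof -
      have "c'$1 * ev2 (fib c) x y = c$1 * ev2 (fib c') x y" "c'$2 * ev2 (fib c) x y = c$2 * ev2 (fib c') x y"
        using 0 by (simp_all add: ev2_fib algebra_simps)
      then show ?thesis
        using c by (auto simp: vec_eq_iff forall_2)
    qed
    have sub: "blow_down A `` fiber 1 c1 \<subseteq> blow_down A `` fiber 1 c2"
      if "c1 \<noteq> 0" "c2 \<noteq> 0" "\<And>x y. ev2 (fib c1) x y = 0 \<Longrightarrow> ev2 (fib c2) x y = 0" for c1 c2
    proof
      fix p assume p: "p \<in> blow_down A `` fiber 1 c1"
      then obtain x y z where "p = ppt (A *v vector [x, y, z])"
        by (auto simp: blow_down_def)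
      then show "p \<in> blow_down A `` fiber 1 c2"
        using p that(3)
        by (simp add: blow_down_fiber_iff[OF A_inv that(1)] blow_down_fiber_iff[OF A_inv that(2)] del: One_nat_def)
    qed
    show ?thesis using sub[of c c'] sub[of c' c] iff c by blast
  qed
  have b_bs: "ev2 (fib (bs ! i)) (b$1) (b$2) \<noteq> 0" if "i < length bs" for i
    using fib_proportional[OF _ b(1), of "bs ! i"] Qs[of i] b(2) that len lines(1) by (auto simp: in_set_conv_nth)
  have bs_bs: "ev2 (fib (bs ! i)) (bs!j$1) (bs!j$2) \<noteq> 0" if "i < length bs" "j < length bs" "i \<noteq> j" for i j
  proof
    assume "ev2 (fib (bs ! i)) (bs!j$1) (bs!j$2) = 0"
    then have "Qs ! i = Qs ! j" using fib_proportional[of "bs ! i" "bs ! j"] Qs that len by simp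
    then show False using lines(1) that len by (simp add: nth_eq_iff_index_eq)
  qed
  have line_mem: "blow_down A `` fiber 1 c \<in> set (P # Qs)" if "c \<in> set (b # bs)" for c
    using that Qs(2) len by (auto simp: b(2) in_set_conv_nth)
  have line: "transversal F (blow_down A `` fiber 1 c)" "c \<noteq> 0" if "c \<in> set (b # bs)" for c
    using line_mem[OF that] lines(2) that Qs(1) b(1) len by (auto simp: in_set_conv_nth)
  have apex: "e3 F' 0 0 1 \<noteq> 0"
    using p0(2) in_curve[of 0 0 1] by (simp add: p0_eq)
  \<comment> \<open>A zero would give the point (b, gb / qb) of the curve on P, which \<tau> sends
    to the first center, contrary to \<open>center\<close>.\<close>
  have center': "e3 F' (b$1 * ev2 q (b$1) (b$2)) (b$2 * ev2 q (b$1) (b$2)) (ev2 g (b$1) (b$2)) \<noteq> 0"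
  proof
    define qb gb where "qb = ev2 q (b$1) (b$2)" and "gb = ev2 g (b$1) (b$2)"
    have qb: "qb \<noteq> 0" using b_bs by (simp add: qb_def q_def)
    assume "e3 F' (b$1 * ev2 q (b$1) (b$2)) (b$2 * ev2 q (b$1) (b$2)) (ev2 g (b$1) (b$2)) = 0"
    then have "e3 F' (qb * b$1) (qb * b$2) (qb * (gb / qb)) = 0"
      using qb by (simp add: qb_def[symmetric] gb_def[symmetric] mult.commute)
    then have 0: "e3 F' (b$1) (b$2) (gb / qb) = 0"
      using qb by (simp only: form_scale[OF rhom_id F'(1)]) simp
    have b12: "(b$1, b$2) \<noteq> (0, 0)" using b(1) by (auto simp: vec_eq_iff forall_2)
    have "ppt (A *v vector [b$1, b$2, gb / qb]) \<in> curve F"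
      using in_curve[of "b$1" "b$2" "gb / qb"] 0 b12 by auto
    moreover have "cs \<noteq> []" using cs(1) N_pos unfolding N_def by (metis list.size(3) not_one_le_zero)
    then have "\<tau> `` {ppt (A *v vector [b$1, b$2, gb / qb])} = {hd cs}"
      using \<tau>_Image[OF b12 b_bs, of "gb / qb"] qb g(2)
      by (simp add: vector_2_eta qb_def[symmetric] gb_def[symmetric])
    ultimately show False using center by blast
  qed
  have smooth: "grad F' v \<noteq> 0" if v: "v \<noteq> 0" "ev3 F' v = 0" for v
  proof
    assume "grad F' v = 0"
    then have 0: "grad_dot F (A *v v) (A *v w) = 0" for w
      by (simp add: grad_eq_0_iff F'_def grad_dot_lin_comp)
    have "grad_dot F (A *v v) w = 0" for w
      using 0[of "A' *v w"] by (simp add: matrix_vector_mul_assoc A')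
    then have "singular_pt F (ppt (A *v v))"
      using v by (auto simp: singular_pt_def grad_eq_0_iff invertible_mult_eq_0[OF A_inv] F'_def
          intro!: exI[of _ "A *v v"])
    then show False using C(3) by (simp add: smooth_curve_def)
  qed
  have trans: "grad_dot F' (vector [\<alpha> * c$1, \<alpha> * c$2, \<beta>]) (vector [\<alpha>' * c$1, \<alpha>' * c$2, \<beta>']) \<noteq> 0"
    if "c \<in> set (b # bs)" "\<alpha> * \<beta>' - \<alpha>' * \<beta> \<noteq> 0" "e3 F' (\<alpha> * c$1) (\<alpha> * c$2) \<beta> = 0" for c \<alpha> \<beta> \<alpha>' \<beta>'
    using transversal_grad_dot[OF C(1) A_inv line(2)[OF that(1)] line(1)[OF that(1)] that(2)] that(3)
    by (simp add: F'_def grad_dot_lin_comp)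
  note R_Image = g(3)
  have ns_pos: "ns ! i \<noteq> 0" if "i < length bs" for i
    using that len' ns(2) by (metis nth_mem not_one_le_zero)
  interpret normal_form F' d ns bs b g N q
    by (unfold_locales, unfold N_def[symmetric] q_def[symmetric])
      (use F' smooth degree_form_pos[OF C(1,2)] apex len' ns line(2) b_bs bs_bs trans g(1) center' in \<open>auto simp: N_def q_def\<close>)
  \<comment> \<open>As the multiplicities are positive, q vanishes exactly on the union of the
    Q_i.\<close>
  have off_lines: "p \<in> curve F - \<Union> (set (P # Qs)) \<longleftrightarrow>
      (\<exists>x y z. p = ppt (A *v vector [x, y, z]) \<and> e3 F' x y z = 0 \<and> ev2 q x y \<noteq> 0 \<and> ev2 (fib b) x y \<noteq> 0)" for p
  proof
    assume p: "p \<in> curve F - \<Union> (set (P # Qs))"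
    then obtain v where v: "v \<noteq> 0" "p = ppt v" "ev3 F v = 0" by (auto simp: curve_def)
    define w where "w = A' *v v"
    have vw: "v = A *v w" by (simp add: w_def matrix_vector_mul_assoc A')
    obtain x y z where w: "w = vector [x, y, z]" by (metis vector_3_eta)
    have xyz: "(x, y, z) \<noteq> (0, 0, 0)"
      using v(1) by (simp add: vw w invertible_mult_eq_0[OF A_inv] vector_3_eq_0_iff)
    have "ev2 (fib c) x y \<noteq> 0" if "c \<in> set (b # bs)" for c
    proof
      assume "ev2 (fib c) x y = 0"
      then have "p \<in> blow_down A `` fiber 1 c"
        using blow_down_fiber_iff[OF A_inv line(2)[OF that]] xyz by (simp add: v(2) vw w)
      then show False using p line_mem[OF that] by blast
    qed
    then have "ev2 q x y \<noteq> 0" "ev2 (fib b) x y \<noteq> 0"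
      by (auto simp: q_def)
    moreover have "e3 F' x y z = 0" using v(3) by (simp add: F'_def vw w)
    ultimately show "\<exists>x y z. p = ppt (A *v vector [x, y, z]) \<and> e3 F' x y z = 0 \<and> ev2 q x y \<noteq> 0 \<and> ev2 (fib b) x y \<noteq> 0"
      using v(2) vw w by blast
  next
    assume "\<exists>x y z. p = ppt (A *v vector [x, y, z]) \<and> e3 F' x y z = 0 \<and> ev2 q x y \<noteq> 0 \<and> ev2 (fib b) x y \<noteq> 0"
    then obtain x y z where p: "p = ppt (A *v vector [x, y, z])" "e3 F' x y z = 0" "ev2 q x y \<noteq> 0" "ev2 (fib b) x y \<noteq> 0"
      by blast
    have xyz: "(x, y, z) \<noteq> (0, 0, 0)" using p(4) by (auto simp: ev2_fib)
    have fib: "ev2 (fib c) x y \<noteq> 0" if c: "c \<in> set (b # bs)" for c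
    proof (cases "c = b")
      case False
      then obtain i where i: "i < length bs" "c = bs ! i" using c by (auto simp: in_set_conv_nth)
      then show ?thesis using p(3) ns_pos[OF i(1)] by (auto simp: q_def)
    qed (use p in simp)
    have "p \<notin> L" if L: "L \<in> set (P # Qs)" for L
    proof -
      obtain c where "c \<in> set (b # bs)" "L = blow_down A `` fiber 1 c"
        using L b(2) Qs(2) len by (auto simp: in_set_conv_nth)
      then show ?thesis
        using fib unfolding p(1) by (simp add: blow_down_fiber_iff[OF A_inv line(2)] del: One_nat_def)
    qed
    then show "p \<in> curve F - \<Union> (set (P # Qs))"
      using in_curve[OF xyz] p(1,2) by blast
  qed
  have T_Image: "T `` {ppt (A *v vector [x, y, z])} = {ppt (B *v vector [x * ev2 (fib b) x y ^ N,
      y * ev2 (fib b) x y ^ N, z * ev2 q x y - ev2 g x y])}"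
    if "ev2 q x y \<noteq> 0" "ev2 (fib b) x y \<noteq> 0" for x y z
  proof -
    have xy: "(x, y) \<noteq> (0, 0)" using that by (auto simp: ev2_fib)
    have "ev2 (fib (bs ! i)) x y \<noteq> 0" if "i < length bs" for i
      using \<open>ev2 q x y \<noteq> 0\<close> that ns_pos[OF that] by (auto simp: q_def)
    then have "T `` {ppt (A *v vector [x, y, z])} =
        blow_down B `` (R `` {hpt (N + 1) (vector [x, y], 1, ev2 q x y * z)})"
      unfolding T_eq relcomp_Image using \<tau>_Image[OF xy] by simp
    also have "R `` {hpt (N + 1) (vector [x, y], 1, ev2 q x y * z)} =
        {hpt 1 (vector [x, y], ev2 (fib b) x y ^ N, ev2 q x y * z - ev2 g x y)}"
      using R_Image[of "vector [x, y]" 1 "ev2 q x y * z"] xy that cs(1)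
      by (simp add: vector_2_eq_0_iff fiber_form_fib N_def)
    also have "blow_down B `` \<dots> = {ppt (B *v vector [ev2 (fib b) x y ^ N * x, ev2 (fib b) x y ^ N * y, ev2 q x y * z - ev2 g x y])}"
      using xy that by (subst blow_down_Image) (auto simp: vector_2_eq_0_iff)
    finally show ?thesis by (simp add: mult.commute)
  qed
  have G: "form (d * (N + 1)) (lin_comp G B')"
    by (rule form_lin_comp[OF form_G])
  have B'_inv: "invertible B'" using B' by (auto simp: invertible_def)
  have ev3_G: "ev3 (lin_comp G B') (B *v v) = ev3 G v" for v
    by (simp add: matrix_vector_mul_assoc B')
  have image_nonzero: "vector [x * ev2 (fib b) x y ^ N, y * ev2 (fib b) x y ^ N, z] \<noteq> (0 :: complex^3)"
    if "ev2 (fib b) x y \<noteq> 0" for x y z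
    using that by (auto simp: vector_3_eq_0_iff ev2_fib)
  have closure: "curve (lin_comp G B') = proper_transform T (\<Union> (set (P # Qs))) (curve F)"
  proof (rule equalityI; rule subsetI)
    fix p assume p: "p \<in> curve (lin_comp G B')"
    then obtain v where v: "v \<noteq> 0" "p = ppt v" "ev3 (lin_comp G B') v = 0" by (auto simp: curve_def)
    define w where "w = B' *v v"
    have vw: "v = B *v w" by (simp add: w_def matrix_vector_mul_assoc B')
    obtain x y z where w: "w = vector [x, y, z]" by (metis vector_3_eta)
    have xyz: "(x, y, z) \<noteq> (0, 0, 0)"
      using v(1) by (simp add: vw w invertible_mult_eq_0[OF B] vector_3_eq_0_iff)
    have Gw: "e3 G x y z = 0" using v(3) by (simp add: vw ev3_G w del: ev3_lin_comp)
    \<comment> \<open>By \<open>T_Image\<close>, the pullback of H under the formula for T vanishes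
      on the curve off the lines; \<open>vanishes_on_G\<close> extends this to all of G = 0.\<close>
    have in_H: "p \<in> curve H" if H: "form e H" "T `` (curve F - \<Union> (set (P # Qs))) \<subseteq> curve H" for e H
    proof -
      have "e3 (lin_comp H B) x y z = 0"
      proof (rule vanishes_on_G[OF form_lin_comp[OF H(1)] _ xyz Gw])
        fix x y z assume F0: "e3 F' x y z = 0" and q: "ev2 q x y \<noteq> 0" and l: "ev2 (fib b) x y \<noteq> 0"
        define u :: "complex^3" where
          "u = vector [x * ev2 (fib b) x y ^ N, y * ev2 (fib b) x y ^ N, z * ev2 q x y - ev2 g x y]"
        have "ppt (A *v vector [x, y, z]) \<in> curve F - \<Union> (set (P # Qs))"
          using off_lines F0 q l by blast
        then have "ppt (B *v u) \<in> curve H"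
          using H(2) T_Image[OF q l, of z] unfolding u_def by blast
        moreover have "B *v u \<noteq> 0"
          using image_nonzero[OF l] by (simp add: u_def invertible_mult_eq_0[OF B])
        ultimately have "ev3 H (B *v u) = 0" by (simp add: ppt_in_curve_iff[OF H(1)])
        then show "e3 (lin_comp H B) (x * ev2 (fib b) x y ^ N) (y * ev2 (fib b) x y ^ N) (z * ev2 q x y - ev2 g x y) = 0"
          by (simp add: u_def)
      qed
      then show ?thesis
        using v(1) by (simp add: v(2) ppt_in_curve_iff[OF H(1)] vw w)
    qed
    show "p \<in> proper_transform T (\<Union> (set (P # Qs))) (curve F)"
      unfolding proper_transform_def zariski_closure_def mem_Collect_eq
    proof (intro conjI allI impI)
      show "p \<in> proj_plane" using p curve_subset by blast
      fix e H assume "form e H \<and> T `` (curve F - \<Union> (set (P # Qs))) \<subseteq> curve H"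
      then show "p \<in> curve H" by (elim conjE) (rule in_H)
    qed
  next
    fix p assume p: "p \<in> proper_transform T (\<Union> (set (P # Qs))) (curve F)"
    \<comment> \<open>The equation of the image is itself one of the forms over which
      \<open>zariski_closure\<close> ranges: it vanishes on the image by
      \<open>G_inverse\<close>.\<close>
    have "T `` (curve F - \<Union> (set (P # Qs))) \<subseteq> curve (lin_comp G B')"
    proof
      fix r assume "r \<in> T `` (curve F - \<Union> (set (P # Qs)))"
      then obtain p' where p': "(p', r) \<in> T" "p' \<in> curve F - \<Union> (set (P # Qs))"
        by (rule ImageE)
      from p'(2) obtain x y z where xyz: "p' = ppt (A *v vector [x, y, z])" "e3 F' x y z = 0" "ev2 q x y \<noteq> 0" "ev2 (fib b) x y \<noteq> 0"
        unfolding off_lines by blast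
      define u :: "complex^3" where
        "u = vector [x * ev2 (fib b) x y ^ N, y * ev2 (fib b) x y ^ N, z * ev2 q x y - ev2 g x y]"
      have "r = ppt (B *v u)" using p'(1) T_Image[OF xyz(3,4), of z] by (auto simp: xyz(1) u_def)
      moreover have "B *v u \<noteq> 0"
        using image_nonzero[OF xyz(4)] by (simp add: u_def invertible_mult_eq_0[OF B])
      moreover have "ev3 (lin_comp G B') (B *v u) = 0"
        unfolding ev3_G u_def ev3_vector G_inverse xyz(2) by simp
      ultimately show "r \<in> curve (lin_comp G B')" unfolding curve_def by blast
    qed
    then show "p \<in> curve (lin_comp G B')"
      using p G unfolding proper_transform_def zariski_closure_def mem_Collect_eq by (elim conjE, elim allE[of _ "d * (N + 1)"] allE[of _ "lin_comp G B'"]) simp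
  qed
  show ?thesis
    unfolding N_def[symmetric] len'
  proof (intro exI[of _ "lin_comp G B'"] exI[of _ "\<lambda>i. ppt (B *v tac_pt i)"]
      exI[of _ "ppt (B *v vector [0, 0, 1])"] conjI)
    show "irreducible (lin_comp G B')" by (rule irreducible_lin_comp[OF irreducible_G B'_inv])
  qed (use G closure tac_pts_distinct[OF B] tacnode_at_tac_pt[OF B B'(1)] blow_down_tacnode_at_O[OF B B'(1)]
      singular_pt_lin_comp[OF B'] in blast)+
qed

end
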